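(* There is an algorithm that, given a polynomial $p=p_1p_2$ in $n$ variables where $p_1$ is a $\Pi_k\Sigma_c\Pi_t$ polynomial and $p_2$ is a $\Pi_m\Sigma_s$ polynomial, decides in $O(tc^k ms\sqrt{m+n})$ time whether $p$ has a multilinear monomial in its sum-product expansion.
   Context: Polynomials are in variables $x_1,\dots,x_n$. A monomial is multilinear if every variable occurring in it has exponent $1$. A $\Pi_k\Sigma_c\Pi_t$ polynomial is given as a product of $k$ clauses, each a sum of at most $c$ terms, each term a product of variables of degree at most $t$. A $\Pi_m\Sigma_s$ polynomial is a product of $m$ clauses, each a sum of at most $s$ single variables. The sum-product expansion of $p=p_1p_2$ consists of the products obtained by choosing one term from each clause of $p_1$ and of $p_2$; $p$ has a multilinear monomial in its sum-product expansion if some such product is multilinear.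
   Formalization: For c=1 the bound proved is O(kt + t·ms√(m+n)), since the printed O(t·ms√(m+n)) fails there (all k factors of p1 must be read, e.g. t=m=s=1, k=n−1); and the time bound is claimed only for c, t, m, s ≥ 1, as the printed bound is otherwise 0. *)

theory Defs
  imports Complex_Main "HOL-Library.Multiset"
begin

text \<open>
  The machine model: deterministic while programs over finitely many zero-initialised arrays of
  natural numbers, with random access. A scalar variable is an array that is used at index 0 only.
  The only arithmetic is increment and decrement, so that in \<open>T\<close> steps of a fixed program numbers
  grow by \<open>O(T)\<close> only, and unit costs cannot be exploited by computing with huge numbers.
\<close>

type_synonym vname = string
type_synonym state = "vname \<Rightarrow> nat \<Rightarrow> nat"

datatype aexp = Const nat | Cell vname aexp | Inc aexp | Dec aexp

datatype bexp = Less aexp aexp | Neg bexp | And bexp bexp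

datatype com =
    Skip
  | Assign vname aexp aexp
  | Seq com com
  | Cond bexp com com
  | While bexp com

fun aval :: "aexp \<Rightarrow> state \<Rightarrow> nat" where
  "aval (Const a) \<sigma> = a"
| "aval (Cell x e) \<sigma> = \<sigma> x (aval e \<sigma>)"
| "aval (Inc e) \<sigma> = aval e \<sigma> + 1"
| "aval (Dec e) \<sigma> = aval e \<sigma> - 1"

fun bval :: "bexp \<Rightarrow> state \<Rightarrow> bool" where
  "bval (Less e f) \<sigma> \<longleftrightarrow> aval e \<sigma> < aval f \<sigma>"
| "bval (Neg b) \<sigma> \<longleftrightarrow> \<not> bval b \<sigma>"
| "bval (And a b) \<sigma> \<longleftrightarrow> bval a \<sigma> \<and> bval b \<sigma>"

definition update :: "state \<Rightarrow> vname \<Rightarrow> nat \<Rightarrow> nat \<Rightarrow> state" where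
  "update \<sigma> x i v = \<sigma>(x := (\<sigma> x)(i := v))"

text \<open>
  \<open>exec P \<sigma> T \<sigma>'\<close>: program \<open>P\<close> started in \<open>\<sigma>\<close> halts in \<open>\<sigma>'\<close> after \<open>T\<close> time units. Every executed
  assignment, skip and test costs one unit; the size of the expressions involved is bounded by a
  constant that depends on the program only.
\<close>

inductive exec :: "com \<Rightarrow> state \<Rightarrow> nat \<Rightarrow> state \<Rightarrow> bool" where
  Skip: "exec Skip \<sigma> 1 \<sigma>"
| Assign: "exec (Assign x i e) \<sigma> 1 (update \<sigma> x (aval i \<sigma>) (aval e \<sigma>))"
| Seq: "exec P \<sigma> T \<sigma>' \<Longrightarrow> exec Q \<sigma>' T' \<sigma>'' \<Longrightarrow> exec (Seq P Q) \<sigma> (T + T') \<sigma>''"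
| CondTrue: "bval b \<sigma> \<Longrightarrow> exec P \<sigma> T \<sigma>' \<Longrightarrow> exec (Cond b P Q) \<sigma> (1 + T) \<sigma>'"
| CondFalse: "\<not> bval b \<sigma> \<Longrightarrow> exec Q \<sigma> T \<sigma>' \<Longrightarrow> exec (Cond b P Q) \<sigma> (1 + T) \<sigma>'"
| WhileFalse: "\<not> bval b \<sigma> \<Longrightarrow> exec (While b P) \<sigma> 1 \<sigma>"
| WhileTrue: "bval b \<sigma> \<Longrightarrow> exec P \<sigma> T \<sigma>' \<Longrightarrow> exec (While b P) \<sigma>' T' \<sigma>'' \<Longrightarrow>
    exec (While b P) \<sigma> (1 + T + T') \<sigma>''"

inductive_cases SkipE: "exec Skip \<sigma> T \<sigma>'"
inductive_cases AssignE: "exec (Assign x i e) \<sigma> T \<sigma>'"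
inductive_cases SeqE: "exec (Seq P Q) \<sigma> T \<sigma>'"
inductive_cases CondE: "exec (Cond b P Q) \<sigma> T \<sigma>'"
inductive_cases WhileE: "exec (While b P) \<sigma> T \<sigma>'"

lemma exec_deterministic:
  "exec P \<sigma> T \<sigma>' \<Longrightarrow> exec P \<sigma> T' \<sigma>'' \<Longrightarrow> T' = T \<and> \<sigma>'' = \<sigma>'"
proof (induction arbitrary: T' \<sigma>'' rule: exec.induct)
  case Skip
  then show ?case by (auto elim: SkipE)
next
  case Assign
  then show ?case by (auto elim: AssignE)
next
  case Seq
  from Seq.prems show ?case by (rule SeqE) (metis Seq.IH)
next
  case CondTrue
  from CondTrue.prems show ?case by (rule CondE) (metis CondTrue.IH CondTrue.hyps(1) plus_1_eq_Suc)+
next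
  case CondFalse
  from CondFalse.prems show ?case by (rule CondE) (metis CondFalse.IH CondFalse.hyps(1) plus_1_eq_Suc)+
next
  case WhileFalse
  from WhileFalse.prems show ?case by (rule WhileE) (simp_all add: WhileFalse.hyps)
next
  case WhileTrue
  from WhileTrue.prems show ?case by (rule WhileE) (metis WhileTrue.IH WhileTrue.hyps(1) plus_1_eq_Suc add_Suc)+
qed

text \<open>
  The variables \<open>x\<^sub>1, \<dots>, x\<^sub>n\<close> are the numbers \<open>1, \<dots>, n\<close>. A term is the list of its variables with
  repetitions (so its length is its degree), a clause is the list of its terms, and a product is the
  list of its clauses. The terms of a clause of a \<open>\<Pi>\<^sub>m\<Sigma>\<^sub>s\<close> polynomial are plain variables.
\<close>

type_synonym var = nat
type_synonym psp_poly = "var list list list"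
type_synonym ps_poly = "var list list"

definition Pi_Sigma_Pi :: "nat \<Rightarrow> nat \<Rightarrow> nat \<Rightarrow> nat \<Rightarrow> psp_poly \<Rightarrow> bool" where
  "Pi_Sigma_Pi n k c t p \<longleftrightarrow> length p = k \<and>
    (\<forall>cl \<in> set p. length cl \<le> c \<and> (\<forall>tm \<in> set cl. length tm \<le> t \<and> set tm \<subseteq> {1..n}))"

definition Pi_Sigma :: "nat \<Rightarrow> nat \<Rightarrow> nat \<Rightarrow> ps_poly \<Rightarrow> bool" where
  "Pi_Sigma n m s p \<longleftrightarrow> length p = m \<and> (\<forall>cl \<in> set p. length cl \<le> s \<and> set cl \<subseteq> {1..n})"

text \<open>A monomial is the multiset of its variables; multiplicities are exponents.\<close>

definition multilinear :: "var multiset \<Rightarrow> bool" where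
  "multilinear M \<longleftrightarrow> (\<forall>x \<in># M. count M x = 1)"

definition expansion :: "psp_poly \<Rightarrow> ps_poly \<Rightarrow> var multiset set" where
  "expansion p\<^sub>1 p\<^sub>2 =
    {mset (concat tms) + mset vs | tms vs.
      tms \<in> set (product_lists p\<^sub>1) \<and> vs \<in> set (product_lists p\<^sub>2)}"

definition has_multilinear_monomial :: "psp_poly \<Rightarrow> ps_poly \<Rightarrow> bool" where
  "has_multilinear_monomial p\<^sub>1 p\<^sub>2 \<longleftrightarrow> (\<exists>M \<in> expansion p\<^sub>1 p\<^sub>2. multilinear M)"

definition block :: "nat list \<Rightarrow> nat list" where
  "block xs = length xs # xs"

definition encode :: "nat \<Rightarrow> psp_poly \<Rightarrow> ps_poly \<Rightarrow> nat list" where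
  "encode n p\<^sub>1 p\<^sub>2 = [n, length p\<^sub>1, length p\<^sub>2]
    @ concat (map (\<lambda>cl. length cl # concat (map block cl)) p\<^sub>1)
    @ concat (map block p\<^sub>2)"

definition input_state :: "nat list \<Rightarrow> state" where
  "input_state w = (\<lambda>x i. if x = ''in'' \<and> i < length w then w ! i else 0)"

definition answer :: "state \<Rightarrow> nat" where
  "answer \<sigma> = \<sigma> ''out'' 0"

definition time_bound :: "nat \<Rightarrow> nat \<Rightarrow> nat \<Rightarrow> nat \<Rightarrow> nat \<Rightarrow> nat \<Rightarrow> real" where
  "time_bound n k c t m s = real t * real c ^ k * real m * real s * sqrt (real m + real n)"

end

theory Submission
  imports Defs
begin

text \<open>
  The program enumerates the choices of one term per clause of \<open>p\<^sub>1\<close> by backtracking, keeping the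
  exponents of the current monomial and the number of surplus occurrences of variables. Since the
  exponents are updated incrementally, the work at the inner nodes of the search tree is a geometric
  sum of order \<open>t c\<^sup>k\<close>. A multilinear monomial \<open>M\<close> of \<open>p\<^sub>1\<close> extends to one of \<open>p\<^sub>1 p\<^sub>2\<close> iff the clauses of
  \<open>p\<^sub>2\<close> can be matched to distinct variables outside \<open>M\<close>.

  This matching is found in time \<open>O(m s \<surd>m)\<close> without layered graphs. First, the clauses bid for
  variables in an auction: a clause takes a cheapest neighbour, raises its price by one and evicts
  the previous owner, and it gives up when all its neighbours cost at least \<open>L \<approx> \<surd>(2 m)\<close>. By weak
  duality at most \<open>m / L \<le> L\<close> clauses give up if there is a perfect matching, and each of these is
  then matched by one depth-first search for an augmenting path.
\<close>

section \<open>Weakest preconditions with running time\<close>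

text \<open>The threshold \<open>L\<close> balances two costs. Let \<open>E\<close> be the storage
  size of \<open>p\<^sub>2\<close>. In the auction a clause rescans its list once per price level,
  which costs order \<open>L * E\<close>; each augmenting search costs order \<open>E\<close>. With
  \<open>m <= L * L\<close> the deficiency bound leaves at most \<open>L\<close> searches, so both
  phases take order \<open>E\<close> times the root of \<open>m\<close>. As the machine cannot
  multiply, \<open>L\<close> is obtained by counting through triangular numbers. The matching
  problem is solved anew at up to \<open>c ^ k\<close> leaves, and \<open>n\<close> may be far
  larger than \<open>m * s\<close>, so arrays indexed by variables cannot be cleared as a whole.
  Only the cells indexed by words of \<open>p\<^sub>2\<close> are cleared, and the proofs look at
  these arrays through \<open>mask\<close>. The exponents, in contrast, are undone exactly when the
  search backtracks. Spent time is an argument of every postcondition and is bounded by potentials,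
  mainly the total number of cursor moves. The inner nodes form a geometric sum only for
  \<open>c >= 2\<close>. For \<open>c = 1\<close> the search tree is a path, and its nodes and the
  input cost order \<open>k * t\<close>; hence the extra summand in the theorem.\<close>

fun writes :: "com \<Rightarrow> vname set" where
  "writes Skip = {}"
| "writes (Assign x i e) = {x}"
| "writes (Seq P Q) = writes P \<union> writes Q"
| "writes (Cond b P Q) = writes P \<union> writes Q"
| "writes (While b P) = writes P"

lemma exec_frame: "exec P \<sigma> T \<sigma>' \<Longrightarrow> x \<notin> writes P \<Longrightarrow> \<sigma>' x = \<sigma> x"
  by (induction rule: exec.induct) (auto simp: update_def)

text \<open>The last argument is the time that has been spent before \<open>P\<close> is started.\<close>

definition wp :: "com \<Rightarrow> (state \<Rightarrow> nat \<Rightarrow> bool) \<Rightarrow> state \<Rightarrow> nat \<Rightarrow> bool" where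
  "wp P Q \<sigma> T \<longleftrightarrow> (\<exists>T' \<sigma>'. exec P \<sigma> T' \<sigma>' \<and> Q \<sigma>' (T + T'))"

lemma wp_Skip: "wp Skip Q \<sigma> T = Q \<sigma> (T + 1)"
  unfolding wp_def by (auto elim!: SkipE intro!: exI[of _ 1] exec.Skip)

lemma wp_Assign: "wp (Assign x i e) Q \<sigma> T = Q (update \<sigma> x (aval i \<sigma>) (aval e \<sigma>)) (T + 1)"
  unfolding wp_def by (auto elim!: AssignE intro!: exI[of _ 1] exec.Assign)

lemma wp_Seq: "wp (Seq P R) Q \<sigma> T = wp P (wp R Q) \<sigma> T"
proof
  assume "wp (Seq P R) Q \<sigma> T"
  then show "wp P (wp R Q) \<sigma> T"
    unfolding wp_def by (auto elim!: SeqE) (metis add.assoc)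
next
  assume "wp P (wp R Q) \<sigma> T"
  then show "wp (Seq P R) Q \<sigma> T"
    unfolding wp_def by (metis exec.Seq add.assoc)
qed

lemma wp_Cond:
  "wp (Cond b P R) Q \<sigma> T = (if bval b \<sigma> then wp P Q \<sigma> (T + 1) else wp R Q \<sigma> (T + 1))"
proof
  assume "wp (Cond b P R) Q \<sigma> T"
  then show "if bval b \<sigma> then wp P Q \<sigma> (T + 1) else wp R Q \<sigma> (T + 1)"
    unfolding wp_def by (elim exE conjE CondE) (simp_all add: add.assoc, blast+)
next
  assume "if bval b \<sigma> then wp P Q \<sigma> (T + 1) else wp R Q \<sigma> (T + 1)"
  then show "wp (Cond b P R) Q \<sigma> T"
    unfolding wp_def by (metis exec.CondTrue exec.CondFalse add.assoc)
qed

lemmas wp_simps = wp_Skip wp_Assign wp_Seq wp_Cond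

lemma wp_While_False: "\<not> bval b \<sigma> \<Longrightarrow> Q \<sigma> (T + 1) \<Longrightarrow> wp (While b P) Q \<sigma> T"
  unfolding wp_def by (blast intro: exec.WhileFalse)

lemma wp_While_True: "bval b \<sigma> \<Longrightarrow> wp P (wp (While b P) Q) \<sigma> (T + 1) \<Longrightarrow> wp (While b P) Q \<sigma> T"
  unfolding wp_def by (metis exec.WhileTrue add.assoc)

text \<open>The frame property is built into the rule of consequence, so a specification of a
  subprogram states only what changes; callers recover the rest from \<open>writes\<close>.\<close>

lemma wp_mono:
  assumes "wp P Q \<sigma> T"
    and "\<And>\<sigma>' T'. Q \<sigma>' T' \<Longrightarrow> (\<And>x. x \<notin> writes P \<Longrightarrow> \<sigma>' x = \<sigma> x) \<Longrightarrow> Q' \<sigma>' T'"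
  shows "wp P Q' \<sigma> T"
  using assms exec_frame unfolding wp_def by blast

lemma wp_strict: "wp P Q \<sigma> T \<Longrightarrow> wp P (\<lambda>\<sigma>' T'. Q \<sigma>' T' \<and> T < T') \<sigma> T"
proof -
  have "exec P \<sigma> T \<sigma>' \<Longrightarrow> 0 < T" for T \<sigma>'
    by (induction rule: exec.induct) auto
  then show "wp P Q \<sigma> T \<Longrightarrow> wp P (\<lambda>\<sigma>' T'. Q \<sigma>' T' \<and> T < T') \<sigma> T"
    unfolding wp_def by fastforce
qed

text \<open>Every iteration costs time, so an invariant that bounds the time spent forces termination.\<close>

lemma wp_While:
  assumes init: "I \<sigma> T"
    and bound: "\<And>\<sigma>' T'. I \<sigma>' T' \<Longrightarrow> (\<And>x. x \<notin> writes P \<Longrightarrow> \<sigma>' x = \<sigma> x) \<Longrightarrow> T' \<le> B"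
    and step: "\<And>\<sigma>' T'. I \<sigma>' T' \<Longrightarrow> (\<And>x. x \<notin> writes P \<Longrightarrow> \<sigma>' x = \<sigma> x) \<Longrightarrow> bval b \<sigma>' \<Longrightarrow>
      wp P I \<sigma>' (T' + 1)"
    and exit: "\<And>\<sigma>' T'. I \<sigma>' T' \<Longrightarrow> (\<And>x. x \<notin> writes P \<Longrightarrow> \<sigma>' x = \<sigma> x) \<Longrightarrow> \<not> bval b \<sigma>' \<Longrightarrow>
      Q \<sigma>' (T' + 1)"
  shows "wp (While b P) Q \<sigma> T"
proof -
  have "wp (While b P) Q \<sigma>' T'" if "I \<sigma>' T'" "\<And>x. x \<notin> writes P \<Longrightarrow> \<sigma>' x = \<sigma> x" for \<sigma>' T'
    using that
  \<comment> \<open>The remaining time budget is the termination measure: \<open>wp_strict\<close>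
    makes the spent time grow in every round, and \<open>bound\<close> keeps it below
    \<open>B\<close>.\<close>
  proof (induction "B - T'" arbitrary: \<sigma>' T' rule: less_induct)
    case less
    show ?case
    proof (cases "bval b \<sigma>'")
      case True
      have "wp P (\<lambda>\<sigma>'' T''. I \<sigma>'' T'' \<and> T' + 1 < T'') \<sigma>' (T' + 1)"
        using wp_strict step[OF less.prems True] by blast
      then have "wp P (wp (While b P) Q) \<sigma>' (T' + 1)"
      proof (rule wp_mono)
        fix \<sigma>'' T''
        assume *: "I \<sigma>'' T'' \<and> T' + 1 < T''" "\<And>x. x \<notin> writes P \<Longrightarrow> \<sigma>'' x = \<sigma>' x"
        have fr: "\<And>x. x \<notin> writes P \<Longrightarrow> \<sigma>'' x = \<sigma> x"
          using * less.prems by simp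
        have "T'' \<le> B" using bound * fr by blast
        with * have "B - T'' < B - T'" by linarith
        then show "wp (While b P) Q \<sigma>'' T''" using less.hyps * fr by blast
      qed
      with True show ?thesis by (rule wp_While_True)
    next
      case False
      then show ?thesis using exit less.prems by (blast intro: wp_While_False)
    qed
  qed
  then show ?thesis using init by blast
qed

abbreviation V :: "vname \<Rightarrow> aexp" where "V x \<equiv> Cell x (Const 0)"
abbreviation SetV :: "vname \<Rightarrow> aexp \<Rightarrow> com" (infix "::=" 61) where "x ::= e \<equiv> Assign x (Const 0) e"
abbreviation Pos :: "aexp \<Rightarrow> bexp" where "Pos e \<equiv> Less (Const 0) e"
notation Seq (infixr ";;" 60)

section \<open>Bipartite matching\<close>

text \<open>
  A bipartite graph in compressed form: the neighbours of the clause \<open>u\<close> are stored in \<open>a\<close> strictly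
  between the positions \<open>st u\<close> and \<open>st (Suc u)\<close> (the position \<open>st u\<close> itself holds the length of the
  clause), and \<open>ex v \<noteq> 0\<close> marks the variables that must not be used. In a matching \<open>ow\<close> the variable
  \<open>v\<close> is assigned to the clause \<open>u\<close> if \<open>ow v = Suc u\<close>, and it is free if \<open>ow v = 0\<close>.
\<close>

locale clause_graph =
  fixes m :: nat and st a ex :: "nat \<Rightarrow> nat"
  assumes st_less: "u < m \<Longrightarrow> st u < st (Suc u)"
begin

definition nb :: "nat \<Rightarrow> nat set" where
  "nb u = {a q | q. st u < q \<and> q < st (Suc u) \<and> ex (a q) = 0}"

definition perfect :: bool where
  "perfect \<longleftrightarrow> (\<exists>f. inj_on f {..<m} \<and> (\<forall>u<m. f u \<in> nb u))"

definition is_match :: "(nat \<Rightarrow> nat) \<Rightarrow> bool" where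
  "is_match ow \<longleftrightarrow> (\<forall>v u. ow v = Suc u \<longrightarrow> u < m \<and> v \<in> nb u) \<and>
    (\<forall>v v'. ow v = ow v' \<longrightarrow> 0 < ow v \<longrightarrow> v = v')"

definition covered :: "(nat \<Rightarrow> nat) \<Rightarrow> nat set" where
  "covered ow = {u. \<exists>v. ow v = Suc u}"

definition len :: "nat \<Rightarrow> nat" where "len u = st (Suc u) - st u"

lemma nbI: "st u < q \<Longrightarrow> q < st (Suc u) \<Longrightarrow> ex (a q) = 0 \<Longrightarrow> a q \<in> nb u"
  unfolding nb_def by blast

lemma is_matchD: "is_match ow \<Longrightarrow> ow v = Suc u \<Longrightarrow> u < m \<and> v \<in> nb u"
  unfolding is_match_def by blast

lemma is_match_inj: "is_match ow \<Longrightarrow> ow v = Suc u \<Longrightarrow> ow v' = Suc u \<Longrightarrow> v = v'"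
  unfolding is_match_def by force

lemma covered_choice:
  assumes "is_match ow"
  shows "\<exists>g. inj_on g (covered ow) \<and> (\<forall>u \<in> covered ow. ow (g u) = Suc u)"
proof -
  have "\<exists>v. ow v = Suc u" if "u \<in> covered ow" for u
    using that unfolding covered_def by blast
  then obtain g where g: "\<And>u. u \<in> covered ow \<Longrightarrow> ow (g u) = Suc u" by metis
  then have "inj_on g (covered ow)" by (metis inj_onI nat.inject)
  with g show ?thesis by blast
qed

lemma perfectI:
  assumes "is_match ow" "covered ow = {..<m}"
  shows perfect
  using covered_choice[OF assms(1)] assms is_matchD unfolding perfect_def by (metis lessThan_iff)

lemma st_mono: "u \<le> w \<Longrightarrow> w \<le> m \<Longrightarrow> st u \<le> st w"
proof (induction w rule: nat_induct_at_least[of u])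
  case base
  show ?case by simp
next
  case (Suc w)
  then show ?case using st_less[of w] by simp
qed

lemma sum_len: "w \<le> m \<Longrightarrow> (\<Sum>u<w. len u) = st w - st 0"
proof (induction w)
  case (Suc w)
  then show ?case using st_mono[of 0 w] st_less[of w] by (simp add: len_def)
qed simp

text \<open>Even an empty clause occupies its length cell. Costs per clause can therefore be charged
  to the storage size \<open>st m - st 0\<close>.\<close>

lemma st_ge: "w \<le> m \<Longrightarrow> w \<le> st w - st 0"
proof (induction w)
  case (Suc w)
  then have "w \<le> st w - st 0" "st 0 \<le> st w" "st w < st (Suc w)"
    using st_mono[of 0 w] st_less[of w] by auto
  then show ?case by linarith
qed simp

text \<open>The variable \<open>v\<close> may already have an owner, who is evicted by the
  overwriting; only \<open>u\<close> has to be uncovered before.\<close>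

lemma is_match_upd:
  assumes "is_match ow" "u < m" "v \<in> nb u" "u \<notin> covered ow"
  shows "is_match (ow(v := Suc u))"
proof -
  have "(ow(v := Suc u)) x = Suc w \<Longrightarrow> w < m \<and> x \<in> nb w" for x w
    using assms(2,3) is_matchD[OF assms(1)] by (cases "x = v") auto
  moreover have "x = y" if "(ow(v := Suc u)) x = Suc w" "(ow(v := Suc u)) y = Suc w" for x y w
  proof -
    have "w \<noteq> u" if "ow z = Suc w" for z using that assms(4) by (auto simp: covered_def)
    then show ?thesis
      using that is_match_inj[OF assms(1), of x w y] by (cases "x = v"; cases "y = v") auto
  qed
  ultimately show ?thesis unfolding is_match_def by (metis gr0_implies_Suc)
qed

text \<open>The set \<open>{u'. ow v = Suc u'}\<close> plays the part of an optional value: it holds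
  the evicted owner, or nothing if \<open>v\<close> was free. The same encoding passes on the active
  bidder in \<open>auction_bid\<close>.\<close>

lemma covered_upd:
  assumes "is_match ow"
  shows "covered (ow(v := Suc u)) = insert u (covered ow - {u'. ow v = Suc u'})"
proof (intro set_eqI iffI)
  fix w
  assume "w \<in> insert u (covered ow - {u'. ow v = Suc u'})"
  then have *: "w = u \<or> (\<exists>v'. ow v' = Suc w \<and> v' \<noteq> v)"
    unfolding covered_def by auto
  show "w \<in> covered (ow(v := Suc u))"
  proof (cases "w = u")
    case True
    then have "(ow(v := Suc u)) v = Suc w" by simp
    then show ?thesis unfolding covered_def by blast
  next
    case False
    with * obtain v' where "(ow(v := Suc u)) v' = Suc w" by (metis fun_upd_other)
    then show ?thesis unfolding covered_def by blast
  qed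
next
  fix w
  assume "w \<in> covered (ow(v := Suc u))"
  then obtain x where "(ow(v := Suc u)) x = Suc w" unfolding covered_def by blast
  then show "w \<in> insert u (covered ow - {u'. ow v = Suc u'})"
    using is_match_inj[OF assms, of x w v] unfolding covered_def by (cases "x = v") auto
qed

subsection \<open>The auction\<close>

text \<open>The first \<open>b\<close> clauses have entered, those in \<open>G\<close> have given
  up, and \<open>H\<close> holds the clause that is bidding, if any. Clause \<open>u\<close> accepts
  the price \<open>lev u\<close>, and \<open>cur u\<close> scans its list for a variable at that
  price: no neighbour is cheaper, and those already passed are dearer. Since prices never fall, bids
  of other clauses cannot spoil this. The last two conditions are complementary slackness up to one
  unit, on which \<open>auction_deficiency\<close> rests.\<close>

definition auction ::
    "nat \<Rightarrow> (nat \<Rightarrow> nat) \<Rightarrow> (nat \<Rightarrow> nat) \<Rightarrow> (nat \<Rightarrow> nat) \<Rightarrow> (nat \<Rightarrow> nat) \<Rightarrow> nat set \<Rightarrow> nat set \<Rightarrow> nat \<Rightarrow> bool"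
where
  "auction L cur lev pr ow G H b \<longleftrightarrow>
    is_match ow \<and> covered ow = {..<b} - G - H \<and> G \<subseteq> {..<b} \<and> H \<subseteq> {..<b} - G \<and> b \<le> m \<and>
    (\<forall>u<m. st u < cur u \<and> cur u \<le> st (Suc u) \<and> lev u \<le> L) \<and>
    (\<forall>u\<in>H. lev u < L) \<and> (\<forall>u\<in>G. lev u = L) \<and> (\<forall>u. b \<le> u \<longrightarrow> u < m \<longrightarrow> lev u = 0) \<and>
    (\<forall>u<m. \<forall>q. st u < q \<longrightarrow> q < st (Suc u) \<longrightarrow> ex (a q) = 0 \<longrightarrow>
      lev u \<le> pr (a q) \<and> (q < cur u \<longrightarrow> lev u < pr (a q))) \<and>
    (\<forall>v u. ow v = Suc u \<longrightarrow> pr v = Suc (lev u)) \<and> (\<forall>v. ow v = 0 \<longrightarrow> pr v = 0)"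

lemma auctionD:
  assumes "auction L cur lev pr ow G H b"
  shows "is_match ow" "covered ow = {..<b} - G - H" "G \<subseteq> {..<b}" "H \<subseteq> {..<b} - G" "b \<le> m"
    "\<And>u. u < m \<Longrightarrow> st u < cur u" "\<And>u. u < m \<Longrightarrow> cur u \<le> st (Suc u)" "\<And>u. u < m \<Longrightarrow> lev u \<le> L"
    "\<And>u. u \<in> H \<Longrightarrow> lev u < L" "\<And>u. u \<in> G \<Longrightarrow> lev u = L" "\<And>u. b \<le> u \<Longrightarrow> u < m \<Longrightarrow> lev u = 0"
    "\<And>u q. u < m \<Longrightarrow> st u < q \<Longrightarrow> q < st (Suc u) \<Longrightarrow> ex (a q) = 0 \<Longrightarrow> lev u \<le> pr (a q)"
    "\<And>u q. u < m \<Longrightarrow> st u < q \<Longrightarrow> q < cur u \<Longrightarrow> q < st (Suc u) \<Longrightarrow> ex (a q) = 0 \<Longrightarrow> lev u < pr (a q)"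
    "\<And>u v. ow v = Suc u \<Longrightarrow> pr v = Suc (lev u)" "\<And>v. ow v = 0 \<Longrightarrow> pr v = 0"
  using assms unfolding auction_def by simp_all

lemma auction_start:
  assumes "\<And>u. u < m \<Longrightarrow> cur u = Suc (st u) \<and> lev u = 0" 
  shows "auction L cur lev (\<lambda>_. 0) (\<lambda>_. 0) {} {} 0"
  unfolding auction_def using assms st_less
  by (auto simp: is_match_def covered_def Suc_le_eq)

lemma auction_enter:
  assumes "auction L cur lev pr ow G {} b" "b < m" "0 < L"
  shows "auction L cur lev pr ow G {b} (Suc b)"
  unfolding auction_def using auctionD[OF assms(1)] assms(2,3)
  by (auto simp: less_Suc_eq)

text \<open>No neighbour is cheaper than \<open>lev u\<close>, so the price of \<open>v\<close>
  equals \<open>lev u\<close>. A previous owner has a level one below this price, hence below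
  \<open>L\<close>, and may bid next.\<close>

lemma auction_bid:
  assumes auc: "auction L cur lev pr ow G {u} b"
    and q: "cur u < st (Suc u)" "v = a (cur u)" "ex v = 0" "\<not> lev u < pr v"
  shows "auction L (cur(u := Suc (cur u))) lev (pr(v := Suc (pr v))) (ow(v := Suc u)) G
    {u'. ow v = Suc u'} b"
proof -
  note D = auctionD[OF auc]
  have u: "u < m" "u < b" "u \<notin> G" "u \<notin> covered ow" using D(2,4,5) by auto
  have pv: "pr v = lev u" using D(12)[of u "cur u"] D(6)[of u] u q by simp
  have v: "v \<in> nb u" using q nbI D(6) u by metis
  have lev': "Suc (lev u') = lev u" if "ow v = Suc u'" for u'
    using D(14)[OF that] pv by simp
  have ne: "u' \<noteq> u" if "ow w = Suc u'" for w u' using that u(4) by (auto simp: covered_def)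
  have inG: "u' \<in> {..<b} - G - {u}" if "ow w = Suc u'" for w u'
    using that D(2) unfolding covered_def by blast
  show ?thesis
    unfolding auction_def
  proof (intro conjI)
    show "is_match (ow(v := Suc u))" using is_match_upd D(1) u v by blast
    show "covered (ow(v := Suc u)) = {..<b} - G - {u'. ow v = Suc u'}"
      unfolding covered_upd[OF D(1)] D(2) using u ne by auto
    show "\<forall>x\<in>{u'. ow v = Suc u'}. lev x < L" using lev' D(9) by fastforce
    show "\<forall>x<m. \<forall>q. st x < q \<longrightarrow> q < st (Suc x) \<longrightarrow> ex (a q) = 0 \<longrightarrow>
      lev x \<le> (pr(v := Suc (pr v))) (a q) \<and>
      (q < (cur(u := Suc (cur u))) x \<longrightarrow> lev x < (pr(v := Suc (pr v))) (a q))"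
    proof (intro allI impI)
      fix x q'
      assume x: "x < m" "st x < q'" "q' < st (Suc x)" "ex (a q') = 0"
      then show "lev x \<le> (pr(v := Suc (pr v))) (a q') \<and>
        (q' < (cur(u := Suc (cur u))) x \<longrightarrow> lev x < (pr(v := Suc (pr v))) (a q'))"
        using D(12)[OF x] D(13)[OF x(1,2) _ x(3,4)] q pv by (auto simp: less_Suc_eq)
    qed
    show "\<forall>w x. (ow(v := Suc u)) w = Suc x \<longrightarrow> (pr(v := Suc (pr v))) w = Suc (lev x)"
      using D(14) pv by auto
    show "\<forall>w. (ow(v := Suc u)) w = 0 \<longrightarrow> (pr(v := Suc (pr v))) w = 0"
      using D(15) by auto
    show "\<forall>x<m. st x < (cur(u := Suc (cur u))) x \<and> (cur(u := Suc (cur u))) x \<le> st (Suc x) \<and> lev x \<le> L"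
      using D(6-8) q u by (auto simp: less_Suc_eq)
  qed (use D inG in auto)
qed

lemma auction_advance:
  assumes auc: "auction L cur lev pr ow G {u} b"
    and q: "cur u < st (Suc u)" "ex (a (cur u)) = 0 \<longrightarrow> lev u < pr (a (cur u))"
  shows "auction L (cur(u := Suc (cur u))) lev pr ow G {u} b"
proof -
  note D = auctionD[OF auc]
  have "u < m" using D(4,5) by auto
  show ?thesis
    unfolding auction_def
  proof (intro conjI)
    show "\<forall>x<m. \<forall>q. st x < q \<longrightarrow> q < st (Suc x) \<longrightarrow> ex (a q) = 0 \<longrightarrow>
      lev x \<le> pr (a q) \<and> (q < (cur(u := Suc (cur u))) x \<longrightarrow> lev x < pr (a q))"
      using D(12,13) q by (auto simp: less_Suc_eq)
    show "\<forall>x<m. st x < (cur(u := Suc (cur u))) x \<and> (cur(u := Suc (cur u))) x \<le> st (Suc x) \<and> lev x \<le> L"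
      using D(6-8) q \<open>u < m\<close> by (auto simp: less_Suc_eq)
  qed (use D in auto)
qed

text \<open>With the cursor at the end, all usable neighbours cost more than \<open>lev u\<close>,
  which is the level condition for \<open>Suc (lev u)\<close>. The scan restarts, unless the new
  level is \<open>L\<close> and the clause gives up.\<close>

lemma auction_raise:
  assumes auc: "auction L cur lev pr ow G {u} b" and q: "\<not> cur u < st (Suc u)"
  shows "auction L (cur(u := Suc (st u))) (lev(u := Suc (lev u))) pr ow
    (if Suc (lev u) < L then G else insert u G) (if Suc (lev u) < L then {u} else {}) b"
proof -
  note D = auctionD[OF auc]
  have u: "u < m" "u < b" "u \<notin> G" "u \<notin> covered ow" "lev u < L" using D(2,4,5,9) by auto
  have full: "q < cur u" if "q < st (Suc u)" for q using that q by simp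
  have ne: "u' \<noteq> u" if "ow w = Suc u'" for w u' using that u(4) by (auto simp: covered_def)
  show ?thesis
    unfolding auction_def
  proof (intro conjI)
    show "\<forall>x<m. \<forall>q. st x < q \<longrightarrow> q < st (Suc x) \<longrightarrow> ex (a q) = 0 \<longrightarrow>
      (lev(u := Suc (lev u))) x \<le> pr (a q) \<and>
      (q < (cur(u := Suc (st u))) x \<longrightarrow> (lev(u := Suc (lev u))) x < pr (a q))"
      using D(12,13) full by (auto simp: Suc_le_eq)
    show "\<forall>x<m. st x < (cur(u := Suc (st u))) x \<and> (cur(u := Suc (st u))) x \<le> st (Suc x) \<and>
      (lev(u := Suc (lev u))) x \<le> L"
      using D(6-8) u st_less by (auto simp: Suc_le_eq)
    show "\<forall>v x. ow v = Suc x \<longrightarrow> pr v = Suc ((lev(u := Suc (lev u))) x)" using D(14) ne by simp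
  qed (use D u in auto)
qed

text \<open>
  Weak duality: the clauses of a matching pay at most one more than the price of their variable in
  \<open>f\<close>, every free clause would have to pay at least \<open>L\<close> there, and free variables have price 0.
\<close>

lemma auction_deficiency:
  assumes auc: "auction L cur lev pr ow G {} m" and perfect
  shows "card G * L \<le> m"
proof -
  note D = auctionD[OF auc]
  obtain f where f: "inj_on f {..<m}" "\<And>u. u < m \<Longrightarrow> f u \<in> nb u"
    using \<open>perfect\<close> unfolding perfect_def by blast
  obtain g where g: "inj_on g (covered ow)" "\<And>u. u \<in> covered ow \<Longrightarrow> ow (g u) = Suc u"
    using covered_choice D(1) by blast
  define K where "K = covered ow"
  have K: "K = {..<m} - G" using D(2) by (simp add: K_def)
  have finG: "finite G" and Gm: "G \<subseteq> {..<m}" using D(3) finite_subset by auto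
  have lev: "lev u \<le> pr (f u)" if "u < m" for u
    using f(2)[OF that] D(12)[OF that] unfolding nb_def by auto
  have "(\<Sum>u\<in>G. pr (f u)) + (\<Sum>u\<in>K. pr (f u)) = (\<Sum>u<m. pr (f u))"
    using sum.subset_diff[OF Gm, of "\<lambda>u. pr (f u)"] K by simp
  also have "\<dots> = (\<Sum>v\<in>f ` {..<m}. pr v)" using f(1) by (simp add: sum.reindex)
  also have "\<dots> = (\<Sum>v\<in>{v \<in> f ` {..<m}. 0 < ow v}. pr v)"
    by (rule sum.mono_neutral_right) (use D(15) in auto)
  also have "\<dots> \<le> (\<Sum>v\<in>g ` K. pr v)"
  proof (rule sum_mono2)
    show "{v \<in> f ` {..<m}. 0 < ow v} \<subseteq> g ` K"
    proof
      fix v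
      assume "v \<in> {v \<in> f ` {..<m}. 0 < ow v}"
      then obtain u where u: "ow v = Suc u" by (auto simp: gr0_conv_Suc)
      then have "u \<in> K" unfolding K_def covered_def by blast
      with g(2) u is_match_inj[OF D(1)] show "v \<in> g ` K" unfolding K_def by blast
    qed
  qed (use K in auto)
  also have "\<dots> = (\<Sum>u\<in>K. pr (g u))" using g(1) by (simp add: sum.reindex K_def)
  also have "\<dots> = (\<Sum>u\<in>K. Suc (lev u))"
    by (rule sum.cong) (use g(2) D(14) in \<open>auto simp: K_def\<close>)
  also have "\<dots> \<le> (\<Sum>u\<in>K. Suc (pr (f u)))"
    by (rule sum_mono) (use lev K in auto)
  also have "\<dots> = (\<Sum>u\<in>K. pr (f u)) + card K" by (simp add: sum_Suc)
  finally have "(\<Sum>u\<in>G. pr (f u)) \<le> card K" by simp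
  moreover have "card K \<le> m" using K card_mono[of "{..<m}" K] by simp
  moreover have "(\<Sum>u\<in>G. L) \<le> (\<Sum>u\<in>G. pr (f u))"
    by (rule sum_mono) (use lev D(10) Gm in fastforce)
  ultimately show ?thesis by simp
qed

text \<open>One full pass over the list of \<open>u\<close> takes \<open>len u - 1\<close> cursor
  moves and one raise. The product counts the completed passes and the difference the current one,
  so every such step adds exactly 1. With all levels 0 it measures the depth-first search as
  well.\<close>

definition progress :: "(nat \<Rightarrow> nat) \<Rightarrow> (nat \<Rightarrow> nat) \<Rightarrow> nat" where
  "progress cur lev = (\<Sum>u<m. lev u * len u + (cur u - Suc (st u)))"

lemma progress_upd:
  assumes "u < m"
    and "lev' * len u + (cur' - Suc (st u)) = Suc (lev u * len u + (cur u - Suc (st u)))"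
  shows "progress (cur(u := cur')) (lev(u := lev')) = Suc (progress cur lev)"
proof -
  have "progress c l = (l u * len u + (c u - Suc (st u))) +
      (\<Sum>x\<in>{..<m} - {u}. l x * len x + (c x - Suc (st x)))" for c l
    unfolding progress_def using assms(1) by (simp add: sum.remove)
  then show ?thesis using assms(2) by simp
qed

lemma progress_advance:
  assumes "u < m" "st u < cur u"
  shows "progress (cur(u := Suc (cur u))) lev = Suc (progress cur lev)"
  using progress_upd[OF assms(1), where lev = lev and cur = cur and lev' = "lev u" and cur' = "Suc (cur u)"] assms(2) by simp

lemma progress_raise:
  assumes "u < m" "cur u = st (Suc u)"
  shows "progress (cur(u := Suc (st u))) (lev(u := Suc (lev u))) = Suc (progress cur lev)"
  using progress_upd[OF assms(1), where lev = lev and cur = cur and lev' = "Suc (lev u)" and cur' = "Suc (st u)"] assms st_less[of u]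
  by (simp add: len_def)

lemma progress_le:
  assumes "\<And>u. u < m \<Longrightarrow> cur u \<le> st (Suc u) \<and> lev u \<le> L"
  shows "progress cur lev \<le> (L + 1) * (st m - st 0)"
proof -
  have "progress cur lev \<le> (\<Sum>u<m. (L + 1) * len u)"
    unfolding progress_def
  proof (rule sum_mono)
    fix u
    assume "u \<in> {..<m}"
    then have "lev u * len u \<le> L * len u" "cur u - Suc (st u) \<le> len u"
      using assms[of u] by (auto simp: len_def intro: mult_le_mono1)
    then have "lev u * len u + (cur u - Suc (st u)) \<le> L * len u + len u" by (rule add_mono)
    then show "lev u * len u + (cur u - Suc (st u)) \<le> (L + 1) * len u" by simp
  qed
  also have "\<dots> = (L + 1) * (st m - st 0)"
    using sum_len[of m] by (simp only: sum_distrib_left[symmetric] order.refl)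
  finally show ?thesis .
qed

subsection \<open>Augmenting paths\<close>

text \<open>These are the clauses of the alternating tree rooted at \<open>r\<close>: apart from the
  root, a clause is entered only through the variable it owns.\<close>

definition reached :: "(nat \<Rightarrow> nat) \<Rightarrow> nat \<Rightarrow> (nat \<Rightarrow> nat) \<Rightarrow> nat set" where
  "reached ow r vis = insert r {u. \<exists>v. 0 < vis v \<and> ow v = Suc u}"

text \<open>The stack \<open>s\<close> of height \<open>sp\<close> holds the current alternating path, which leaves the clause \<open>s i\<close>
  through the variable that \<open>cur (s i)\<close> has just passed.\<close>

definition dfs ::
    "(nat \<Rightarrow> nat) \<Rightarrow> nat \<Rightarrow> (nat \<Rightarrow> nat) \<Rightarrow> (nat \<Rightarrow> nat) \<Rightarrow> (nat \<Rightarrow> nat) \<Rightarrow> nat \<Rightarrow> bool"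
where
  "dfs ow r vis cur s sp \<longleftrightarrow>
    is_match ow \<and> r < m \<and> r \<notin> covered ow \<and> (0 < sp \<longrightarrow> s 0 = r) \<and> inj_on s {..<sp} \<and>
    s ` {..<sp} \<subseteq> reached ow r vis \<and>
    (\<forall>i. Suc i < sp \<longrightarrow> ow (a (cur (s i) - 1)) = Suc (s (Suc i)) \<and> Suc (st (s i)) < cur (s i) \<and>
      0 < vis (a (cur (s i) - 1))) \<and>
    (\<forall>u<m. st u < cur u \<and> cur u \<le> st (Suc u)) \<and>
    (\<forall>u<m. \<forall>q. st u < q \<longrightarrow> q < cur u \<longrightarrow> ex (a q) = 0 \<longrightarrow> 0 < vis (a q)) \<and>
    (\<forall>u \<in> reached ow r vis. u \<notin> s ` {..<sp} \<longrightarrow> cur u = st (Suc u)) \<and>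
    (\<forall>v. 0 < vis v \<longrightarrow> 0 < ow v)"

text \<open>The path runs \<open>s 0, p 0, s 1, p 1, ...\<close>: the pairs \<open>s i, p i\<close>
  are to become matched, the pairs \<open>p i, s (Suc i)\<close> are matched now, and the last
  variable is free.\<close>

definition aug_path :: "(nat \<Rightarrow> nat) \<Rightarrow> nat \<Rightarrow> (nat \<Rightarrow> nat) \<Rightarrow> (nat \<Rightarrow> nat) \<Rightarrow> nat \<Rightarrow> bool" where
  "aug_path ow r s p sp \<longleftrightarrow>
    is_match ow \<and> r \<notin> covered ow \<and> 0 < sp \<and> s 0 = r \<and> inj_on s {..<sp} \<and>
    (\<forall>i<sp. s i < m \<and> p i \<in> nb (s i)) \<and>
    (\<forall>i. Suc i < sp \<longrightarrow> ow (p i) = Suc (s (Suc i))) \<and> ow (p (sp - 1)) = 0"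

lemma dfsD:
  assumes "dfs ow r vis cur s sp"
  shows "is_match ow" "r < m" "r \<notin> covered ow" "0 < sp \<Longrightarrow> s 0 = r" "inj_on s {..<sp}"
    "\<And>i. i < sp \<Longrightarrow> s i \<in> reached ow r vis"
    "\<And>i. Suc i < sp \<Longrightarrow> ow (a (cur (s i) - 1)) = Suc (s (Suc i))"
    "\<And>i. Suc i < sp \<Longrightarrow> Suc (st (s i)) < cur (s i)"
    "\<And>i. Suc i < sp \<Longrightarrow> 0 < vis (a (cur (s i) - 1))"
    "\<And>u. u < m \<Longrightarrow> st u < cur u" "\<And>u. u < m \<Longrightarrow> cur u \<le> st (Suc u)"
    "\<And>u q. u < m \<Longrightarrow> st u < q \<Longrightarrow> q < cur u \<Longrightarrow> ex (a q) = 0 \<Longrightarrow> 0 < vis (a q)"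
    "\<And>u. u \<in> reached ow r vis \<Longrightarrow> u \<notin> s ` {..<sp} \<Longrightarrow> cur u = st (Suc u)"
    "\<And>v. 0 < vis v \<Longrightarrow> 0 < ow v"
  using assms unfolding dfs_def by (simp_all add: image_subset_iff)

lemma reached_less: "is_match ow \<Longrightarrow> r < m \<Longrightarrow> u \<in> reached ow r vis \<Longrightarrow> u < m"
  unfolding reached_def using is_matchD by blast

lemma dfs_start:
  assumes "is_match ow" "r < m" "r \<notin> covered ow" "\<And>u. u < m \<Longrightarrow> cur u = Suc (st u)" "s 0 = r"
  shows "dfs ow r (\<lambda>_. 0) cur s 1"
  unfolding dfs_def using assms st_less by (auto simp: reached_def Suc_le_eq inj_on_def)

lemma dfs_advance:
  assumes dfs: "dfs ow r vis cur s (Suc sp)" and u: "u = s sp"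
    and q: "cur u < st (Suc u)" "ex (a (cur u)) = 0 \<longrightarrow> 0 < vis (a (cur u))"
  shows "dfs ow r vis (cur(u := Suc (cur u))) s (Suc sp)"
proof -
  note D = dfsD[OF dfs]
  have ne: "s i \<noteq> u" if "i < sp" for i
    using inj_onD[OF D(5), of i sp] that u by auto
  have "u \<in> s ` {..<Suc sp}" "u < m" using u D(6) reached_less[OF D(1,2)] by auto
  then show ?thesis
    unfolding dfs_def
    using D ne q by (auto simp: less_Suc_eq)
qed

text \<open>A clause leaves the stack only with its list exhausted, which is what the invariant
  demands of reached clauses off the stack.\<close>

lemma dfs_pop:
  assumes dfs: "dfs ow r vis cur s (Suc sp)" and q: "\<not> cur (s sp) < st (Suc (s sp))"
  shows "dfs ow r vis cur s sp"
proof -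
  note D = dfsD[OF dfs]
  have "cur (s sp) = st (Suc (s sp))" using D(11)[of "s sp"] reached_less[OF D(1,2) D(6)] q by force
  then have "cur u = st (Suc u)" if "u \<in> reached ow r vis" "u \<notin> s ` {..<sp}" for u
    using D(13)[of u] that by (auto simp: lessThan_Suc)
  moreover have "inj_on s {..<sp}" using D(5) by (rule inj_on_subset) auto
  ultimately show ?thesis
    unfolding dfs_def using D by auto
qed

lemma dfs_push:
  assumes dfs: "dfs ow r vis cur s (Suc sp)" and u: "u = s sp"
    and q: "cur u < st (Suc u)" and v: "v = a (cur u)" "ex v = 0" "vis v = 0" "ow v = Suc w"
  shows "dfs ow r (vis(v := 1)) (cur(u := Suc (cur u))) (s(Suc sp := w)) (Suc (Suc sp))"
proof -
  note D = dfsD[OF dfs]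
  \<comment> \<open>Had \<open>w\<close> been reached before, it would be through its own variable
    \<open>v\<close>, which is unvisited; and \<open>w\<close> is not the root, because the root
    owns nothing.\<close>
  have w_new: "w \<notin> reached ow r vis"
    using D(3) v is_match_inj[OF D(1)] unfolding reached_def covered_def by force
  have um: "u < m" and ur: "u \<in> reached ow r vis" using u D(6) reached_less[OF D(1,2)] by auto
  have wm: "w < m" using is_matchD[OF D(1)] v by blast
  have wu: "w \<noteq> u" using w_new ur by blast
  have R: "reached ow r (vis(v := 1)) = insert w (reached ow r vis)"
  proof -
    have "(\<exists>y. 0 < (vis(v := 1)) y \<and> ow y = Suc x) \<longleftrightarrow>
        x = w \<or> (\<exists>y. 0 < vis y \<and> ow y = Suc x)" for x
      using v(4) by (metis fun_upd_apply nat.inject zero_less_one)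
    then show ?thesis unfolding reached_def by blast
  qed
  have ne: "s i \<noteq> u" if "i < sp" for i
    using inj_onD[OF D(5), of i sp] that u by auto
  have nw: "s i \<noteq> w" if "i < Suc sp" for i
    using D(6)[OF that] w_new by auto
  have inj: "inj_on (s(Suc sp := w)) {..<Suc (Suc sp)}"
  proof (rule inj_onI)
    fix i j
    assume "i \<in> {..<Suc (Suc sp)}" "j \<in> {..<Suc (Suc sp)}"
      "(s(Suc sp := w)) i = (s(Suc sp := w)) j"
    then show "i = j"
      using nw[of i] nw[of j] inj_onD[OF D(5), of i j]
      by (cases "i = Suc sp"; cases "j = Suc sp") auto
  qed
  have im: "(s(Suc sp := w)) ` {..<Suc (Suc sp)} = insert w (s ` {..<Suc sp})"
    by (auto simp: less_Suc_eq image_iff lessThan_Suc)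
  have sw: "(s(Suc sp := w)) i = s i" if "i < Suc sp" for i using that by simp
  show ?thesis
    unfolding dfs_def R im
  proof (intro conjI)
    show "inj_on (s(Suc sp := w)) {..<Suc (Suc sp)}" by (rule inj)
    show "insert w (s ` {..<Suc sp}) \<subseteq> insert w (reached ow r vis)" using D(6) by auto
    show "\<forall>i. Suc i < Suc (Suc sp) \<longrightarrow>
      ow (a ((cur(u := Suc (cur u))) ((s(Suc sp := w)) i) - 1)) = Suc ((s(Suc sp := w)) (Suc i)) \<and>
      Suc (st ((s(Suc sp := w)) i)) < (cur(u := Suc (cur u))) ((s(Suc sp := w)) i) \<and>
      0 < (vis(v := 1)) (a ((cur(u := Suc (cur u))) ((s(Suc sp := w)) i) - 1))"
    proof (intro allI impI)
      fix i
      assume i: "Suc i < Suc (Suc sp)"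
      show "ow (a ((cur(u := Suc (cur u))) ((s(Suc sp := w)) i) - 1)) = Suc ((s(Suc sp := w)) (Suc i)) \<and>
        Suc (st ((s(Suc sp := w)) i)) < (cur(u := Suc (cur u))) ((s(Suc sp := w)) i) \<and>
        0 < (vis(v := 1)) (a ((cur(u := Suc (cur u))) ((s(Suc sp := w)) i) - 1))"
      proof (cases "i = sp")
        case True
        then show ?thesis using u v D(10)[OF um] by simp
      next
        case False
        with i have "i < sp" by simp
        then show ?thesis using D(7-9)[of i] ne[of i] by simp
      qed
    qed
    show "\<forall>x<m. st x < (cur(u := Suc (cur u))) x \<and> (cur(u := Suc (cur u))) x \<le> st (Suc x)"
      using D(10,11) q by (auto simp: less_Suc_eq)
    show "\<forall>x<m. \<forall>q. st x < q \<longrightarrow> q < (cur(u := Suc (cur u))) x \<longrightarrow> ex (a q) = 0 \<longrightarrow>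
      0 < (vis(v := 1)) (a q)"
      using D(12) v(1) by (auto simp: less_Suc_eq)
    show "\<forall>x\<in>insert w (reached ow r vis). x \<notin> insert w (s ` {..<Suc sp}) \<longrightarrow>
      (cur(u := Suc (cur u))) x = st (Suc x)"
      using D(13) u by auto
    show "\<forall>x. 0 < (vis(v := 1)) x \<longrightarrow> 0 < ow x" using D(14) v by auto
  qed (use D in auto)
qed

lemma dfs_found:
  assumes dfs: "dfs ow r vis cur s (Suc sp)" and u: "u = s sp"
    and q: "cur u < st (Suc u)" and v: "v = a (cur u)" "ex v = 0" "ow v = 0"
  shows "aug_path ow r s (\<lambda>i. a ((cur(u := Suc (cur u))) (s i) - 1)) (Suc sp)"
proof -
  note D = dfsD[OF dfs]
  have ne: "s i \<noteq> u" if "i < sp" for i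
    using inj_onD[OF D(5), of i sp] that u by auto
  have sm: "s i < m" if "i < Suc sp" for i using D(6) reached_less[OF D(1,2)] that by blast
  have last: "a (cur u) \<in> nb u" using nbI D(10)[of u] sm[of sp] u q v by auto
  have mem: "a (cur (s i) - 1) \<in> nb (s i)" if "i < sp" for i
  proof (rule nbI)
    have *: "Suc (st (s i)) < cur (s i)" "cur (s i) \<le> st (Suc (s i))"
      using D(8)[of i] D(11)[of "s i"] sm[of i] that by auto
    then show "st (s i) < cur (s i) - 1" "cur (s i) - 1 < st (Suc (s i))" by auto
    \<comment> \<open>This variable is matched to the next clause of the stack, hence a neighbour of
      that clause and not excluded.\<close>
    show "ex (a (cur (s i) - 1)) = 0"
      using is_matchD[OF D(1) D(7)[of i]] that unfolding nb_def by force
  qed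
  show ?thesis
    unfolding aug_path_def
    using D(1,3,4,5,7) sm last mem ne u v by (auto simp: less_Suc_eq)
qed

text \<open>The reached clauses \<open>R\<close> violate Hall's condition. With an empty stack all
  their lists are exhausted, so all their usable neighbours are visited, hence owned, and owned by
  members of \<open>R\<close> other than \<open>r\<close>. An injective choice \<open>f\<close>
  would squeeze \<open>R\<close> into \<open>card R - 1\<close> variables. A single failed search
  thus settles the whole problem.\<close>

lemma dfs_fail:
  assumes dfs: "dfs ow r vis cur s 0"
  shows "\<not> perfect"
proof
  assume perfect
  note D = dfsD[OF dfs]
  define R where "R = reached ow r vis"
  define W where "W = {v. \<exists>u \<in> R - {r}. ow v = Suc u}"
  obtain f where f: "inj_on f {..<m}" "\<And>u. u < m \<Longrightarrow> f u \<in> nb u"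
    using \<open>perfect\<close> unfolding perfect_def by blast
  have Rm: "R \<subseteq> {..<m}" unfolding R_def using reached_less[OF D(1,2)] by blast
  then have "finite R" using finite_subset by blast
  have "f ` R \<subseteq> W"
  proof
    fix v
    assume "v \<in> f ` R"
    then obtain u where u: "u \<in> R" "v = f u" by blast
    then have "u < m" using Rm by blast
    then obtain q where q: "v = a q" "st u < q" "q < st (Suc u)" "ex (a q) = 0"
      using f(2) u unfolding nb_def by blast
    then have "0 < vis v" using D(12,13)[of u] u \<open>u < m\<close> by (simp add: R_def)
    moreover from this obtain w where "ow v = Suc w" using D(14) gr0_implies_Suc by blast
    moreover have "w \<noteq> r" using calculation D(3) unfolding covered_def by blast
    ultimately show "v \<in> W" unfolding W_def R_def reached_def by blast
  qed
  moreover have "W \<subseteq> (\<lambda>u. SOME v. ow v = Suc u) ` (R - {r})"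
  proof
    fix v
    assume "v \<in> W"
    then obtain u where u: "u \<in> R - {r}" "ow v = Suc u" unfolding W_def by blast
    from u(2) have "ow (SOME v. ow v = Suc u) = Suc u" by (rule someI)
    then have "v = (SOME v. ow v = Suc u)" using u(2) is_match_inj[OF D(1)] by blast
    with u(1) show "v \<in> (\<lambda>u. SOME v. ow v = Suc u) ` (R - {r})" by blast
  qed
  ultimately have "f ` R \<subseteq> (\<lambda>u. SOME v. ow v = Suc u) ` (R - {r})" by (rule subset_trans)
  then have "card (f ` R) \<le> card (R - {r})"
    using \<open>finite R\<close> surj_card_le[of "R - {r}" "f ` R"] by simp
  moreover have "card (f ` R) = card R"
    using card_image inj_on_subset[OF f(1) Rm] by blast
  moreover have "card (R - {r}) < card R"
    using \<open>finite R\<close> by (intro psubset_card_mono) (auto simp: R_def reached_def)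
  ultimately show False by simp
qed

section \<open>Flipping the matching along an augmenting path\<close>

text \<open>Variables before the last one have distinct owners, the next clauses of the path, and
  only the last one is free.\<close>

lemma aug_path_inj:
  assumes "aug_path ow r s p sp"
  shows "inj_on p {..<sp}"
proof (rule inj_onI)
  fix i j
  assume ij: "i \<in> {..<sp}" "j \<in> {..<sp}" "p i = p j"
  have s: "inj_on s {..<sp}" "\<And>i. Suc i < sp \<Longrightarrow> ow (p i) = Suc (s (Suc i))" "ow (p (sp - 1)) = 0"
    using assms unfolding aug_path_def by auto
  have last: "i = sp - 1 \<longleftrightarrow> ow (p i) = 0" if "i < sp" for i
    using s(2)[of i] s(3) that by (cases "Suc i < sp") auto
  show "i = j"
  proof (cases "Suc i < sp \<and> Suc j < sp")
    case True
    then have "s (Suc i) = s (Suc j)" using s(2) ij(3) by (metis nat.inject)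
    then show ?thesis using inj_onD[OF s(1)] True by auto
  next
    case False
    then show ?thesis using last[of i] last[of j] ij by auto
  qed
qed

text \<open>The flipped matching is described by its values on and off the path only, so the order
  in which the program writes them does not matter.\<close>

lemma augment:
  assumes path: "aug_path ow r s p sp"
    and on: "\<And>i. i < sp \<Longrightarrow> ow' (p i) = Suc (s i)"
    and off: "\<And>v. v \<notin> p ` {..<sp} \<Longrightarrow> ow' v = ow v"
  shows "is_match ow'" "covered ow' = insert r (covered ow)"
proof -
  have P: "is_match ow" "r \<notin> covered ow" "0 < sp" "s 0 = r" "inj_on s {..<sp}"
    "\<And>i. i < sp \<Longrightarrow> s i < m" "\<And>i. i < sp \<Longrightarrow> p i \<in> nb (s i)"
    "\<And>i. Suc i < sp \<Longrightarrow> ow (p i) = Suc (s (Suc i))" "ow (p (sp - 1)) = 0"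
    using path unfolding aug_path_def by auto
  \<comment> \<open>Whatever a clause of the path owned before lies on the path too, so no clause
    keeps an old variable besides its new one. The root owned nothing.\<close>
  have nopath: "v \<in> p ` {..<sp}" if "i < sp" "ow v = Suc (s i)" for v i
  proof (cases i)
    case 0
    then show ?thesis using that P(2,4) unfolding covered_def by blast
  next
    case (Suc j)
    then show ?thesis using that P(8)[of j] is_match_inj[OF P(1)] by force
  qed
  show "is_match ow'"
    unfolding is_match_def
  proof (intro conjI allI impI)
    fix v u
    assume *: "ow' v = Suc u"
    show "u < m" "v \<in> nb u"
      using * on off P(6,7) is_matchD[OF P(1)] by (cases "v \<in> p ` {..<sp}"; force)+
  next
    fix v w
    assume *: "ow' v = ow' w" "0 < ow' v"
    consider i j where "i < sp" "j < sp" "v = p i" "w = p j"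
      | i where "i < sp" "v = p i" "w \<notin> p ` {..<sp}"
      | i where "i < sp" "w = p i" "v \<notin> p ` {..<sp}"
      | "v \<notin> p ` {..<sp}" "w \<notin> p ` {..<sp}" by blast
    then show "v = w"
    proof cases
      case 1
      then show ?thesis using * on inj_onD[OF P(5), of i j] by auto
    next
      case 2
      then show ?thesis using * on off nopath by metis
    next
      case 3
      then show ?thesis using * on off nopath by metis
    next
      case 4
      then show ?thesis using * off P(1) unfolding is_match_def by metis
    qed
  qed
  show "covered ow' = insert r (covered ow)"
  proof (intro set_eqI iffI)
    fix u
    assume "u \<in> covered ow'"
    then obtain v where v: "ow' v = Suc u" unfolding covered_def by blast
    show "u \<in> insert r (covered ow)"
    proof (cases "v \<in> p ` {..<sp}")
      case True
      then obtain i where i: "i < sp" "u = s i" using on v by auto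
      show ?thesis
      proof (cases i)
        case (Suc j)
        then show ?thesis using i P(8)[of j] unfolding covered_def by auto
      qed (use i P(4) in simp)
    next
      case False
      then show ?thesis using v off unfolding covered_def by auto
    qed
  next
    fix u
    assume "u \<in> insert r (covered ow)"
    then consider "u = s 0" | v where "ow v = Suc u" using P(4) unfolding covered_def by blast
    then show "u \<in> covered ow'"
    proof cases
      case 1
      then show ?thesis using on P(3) unfolding covered_def by blast
    next
      case 2
      show ?thesis
      proof (cases "v \<in> p ` {..<sp}")
        case True
        then obtain i where i: "i < sp" "v = p i" by blast
        with 2 P(9) have "i \<noteq> sp - 1" by auto
        with i have "Suc i < sp" by simp
        then have "ow' (p (Suc i)) = Suc u" using on P(8) 2 i by auto
        then show ?thesis unfolding covered_def by blast
      next
        case False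
        then show ?thesis using 2 off unfolding covered_def by force
      qed
    qed
  qed
qed

end

section \<open>The matching program\<close>

text \<open>The sweep runs over the stored words of \<open>p\<^sub>2\<close> instead of all
  variables, which keeps it within the time of one search. It also clears cells indexed by clause
  lengths; \<open>mask\<close> uses the same index set.\<close>

definition reset :: "vname \<Rightarrow> com" where
  "reset x =
    ''q'' ::= Cell ''st'' (Const 0) ;;
    While (Less (V ''q'') (Cell ''st'' (Cell ''in'' (Const 2))))
      (Assign x (Cell ''in'' (V ''q'')) (Const 0) ;;
       ''q'' ::= Inc (V ''q''))"

definition reset_cur :: com where
  "reset_cur =
    ''u'' ::= Const 0 ;;
    While (Less (V ''u'') (Cell ''in'' (Const 2)))
      (Assign ''cur'' (V ''u'') (Inc (Cell ''st'' (V ''u''))) ;;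
       Assign ''lev'' (V ''u'') (Const 0) ;;
       ''u'' ::= Inc (V ''u''))"

definition auction_step :: com where
  "auction_step =
    Cond (Pos (V ''act''))
      (Cond (Less (Cell ''cur'' (V ''u'')) (Cell ''st'' (Inc (V ''u''))))
        (''v'' ::= Cell ''in'' (Cell ''cur'' (V ''u'')) ;;
         Assign ''cur'' (V ''u'') (Inc (Cell ''cur'' (V ''u''))) ;;
         Cond (And (Neg (Pos (Cell ''cnt'' (V ''v''))))
              (Neg (Less (Cell ''lev'' (V ''u'')) (Cell ''pr'' (V ''v'')))))
           (Assign ''pr'' (V ''v'') (Inc (Cell ''pr'' (V ''v''))) ;;
            ''w'' ::= Cell ''ow'' (V ''v'') ;;
            Assign ''ow'' (V ''v'') (Inc (V ''u'')) ;;
            Cond (Pos (V ''w'')) (''u'' ::= Dec (V ''w'')) (''act'' ::= Const 0))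
           Skip)
        (Assign ''lev'' (V ''u'') (Inc (Cell ''lev'' (V ''u''))) ;;
         Assign ''cur'' (V ''u'') (Inc (Cell ''st'' (V ''u''))) ;;
         Cond (Less (Cell ''lev'' (V ''u'')) (V ''L'')) Skip
           (Assign ''fr'' (V ''f'') (V ''u'') ;;
            ''f'' ::= Inc (V ''f'') ;;
            ''act'' ::= Const 0)))
      (''u'' ::= V ''b'' ;;
       ''b'' ::= Inc (V ''b'') ;;
       ''act'' ::= Const 1)"

definition auction_loop :: com where
  "auction_loop =
    ''f'' ::= Const 0 ;; ''b'' ::= Const 0 ;; ''act'' ::= Const 0 ;;
    While (Neg (And (Neg (Less (V ''b'') (Cell ''in'' (Const 2)))) (Neg (Pos (V ''act'')))))
      auction_step"

definition dfs_step :: com where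
  "dfs_step =
    ''u'' ::= Cell ''s'' (Dec (V ''sp'')) ;;
    Cond (Less (Cell ''cur'' (V ''u'')) (Cell ''st'' (Inc (V ''u''))))
      (''v'' ::= Cell ''in'' (Cell ''cur'' (V ''u'')) ;;
       Assign ''cur'' (V ''u'') (Inc (Cell ''cur'' (V ''u''))) ;;
       Cond (And (Neg (Pos (Cell ''cnt'' (V ''v'')))) (Neg (Pos (Cell ''vis'' (V ''v'')))))
         (Assign ''vis'' (V ''v'') (Const 1) ;;
          Cond (Pos (Cell ''ow'' (V ''v'')))
            (Assign ''s'' (V ''sp'') (Dec (Cell ''ow'' (V ''v''))) ;; ''sp'' ::= Inc (V ''sp''))
            (''fnd'' ::= Const 1))
         Skip)
      (''sp'' ::= Dec (V ''sp''))"

definition dfs_loop :: com where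
  "dfs_loop =
    ''sp'' ::= Const 1 ;; ''fnd'' ::= Const 0 ;;
    While (And (Pos (V ''sp'')) (Neg (Pos (V ''fnd'')))) dfs_step"

text \<open>The variables of the path are not stored: the cursor of each clause on the stack stands
  one position behind the variable through which the path leaves it.\<close>

definition augment_loop :: com where
  "augment_loop =
    While (Pos (V ''sp''))
      (''sp'' ::= Dec (V ''sp'') ;;
       ''u'' ::= Cell ''s'' (V ''sp'') ;;
       Assign ''ow'' (Cell ''in'' (Dec (Cell ''cur'' (V ''u'')))) (Inc (V ''u'')))"

definition augment_step :: com where
  "augment_step =
    reset ''vis'' ;; reset_cur ;;
    Assign ''s'' (Const 0) (Cell ''fr'' (V ''i'')) ;;
    dfs_loop ;;
    Cond (Pos (V ''fnd'')) augment_loop (''ok'' ::= Const 0) ;;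
    ''i'' ::= Inc (V ''i'')"

text \<open>More than \<open>L\<close> leftover clauses already refute a perfect matching, so never
  more than \<open>L\<close> searches are paid for.\<close>

definition match_clauses :: com where
  "match_clauses =
    reset ''ow'' ;; reset ''pr'' ;; reset_cur ;;
    auction_loop ;;
    Cond (Less (V ''L'') (V ''f'')) (''ok'' ::= Const 0)
      (''ok'' ::= Const 1 ;; ''i'' ::= Const 0 ;;
       While (And (Less (V ''i'') (V ''f'')) (Pos (V ''ok''))) augment_step)"

lemma writes_reset [simp]: "writes (reset x) = {x, ''q''}"
  by (auto simp: reset_def)

lemma writes_reset_cur [simp]: "writes reset_cur = {''u'', ''cur'', ''lev''}"
  by (auto simp: reset_cur_def)

lemma writes_auction_step [simp]:
  "writes auction_step =
    {''act'', ''u'', ''v'', ''w'', ''cur'', ''pr'', ''ow'', ''lev'', ''fr'', ''f'', ''b''}"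
  by (auto simp: auction_step_def)

lemma writes_auction_loop [simp]: "writes auction_loop = writes auction_step"
  by (auto simp: auction_loop_def)

lemma writes_dfs_step [simp]: "writes dfs_step = {''u'', ''v'', ''cur'', ''vis'', ''s'', ''sp'', ''fnd''}"
  by (auto simp: dfs_step_def)

lemma writes_dfs_loop [simp]: "writes dfs_loop = writes dfs_step"
  by (auto simp: dfs_loop_def)

lemma writes_augment_loop [simp]: "writes augment_loop = {''sp'', ''u'', ''ow''}"
  by (auto simp: augment_loop_def)

lemma writes_augment_step [simp]:
  "writes augment_step =
    {''q'', ''u'', ''v'', ''cur'', ''lev'', ''vis'', ''s'', ''sp'', ''fnd'', ''ow'', ''ok'', ''i''}"
  by (auto simp: augment_step_def)

lemma writes_match_clauses [simp]:
  "writes match_clauses =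
    {''q'', ''u'', ''v'', ''w'', ''cur'', ''lev'', ''vis'', ''pr'', ''s'', ''sp'', ''fnd'', ''ow'', ''ok'',
     ''i'', ''act'', ''fr'', ''f'', ''b''}"
  by (auto simp: match_clauses_def)

section \<open>Correctness and running time of the matching program\<close>

locale stored_graph = clause_graph +
  assumes a2: "a 2 = m"
begin

text \<open>Array cells outside the range of the graph keep stale values, which the invariants must ignore.\<close>

definition mask :: "(nat \<Rightarrow> nat) \<Rightarrow> nat \<Rightarrow> nat" where
  "mask g v = (if v \<in> a ` {st 0..<st m} then g v else 0)"

definition stored :: "state \<Rightarrow> bool" where
  "stored \<sigma> \<longleftrightarrow> \<sigma> ''in'' = a \<and> \<sigma> ''st'' = st \<and> \<sigma> ''cnt'' = ex"

lemma storedD: "stored \<sigma> \<Longrightarrow> \<sigma> ''in'' = a" "stored \<sigma> \<Longrightarrow> \<sigma> ''st'' = st" "stored \<sigma> \<Longrightarrow> \<sigma> ''cnt'' = ex"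
  by (simp_all add: stored_def)

lemma range_pos: "u < m \<Longrightarrow> st u < q \<Longrightarrow> q < st (Suc u) \<Longrightarrow> q \<in> {st 0..<st m}"
  using st_mono[of 0 u] st_mono[of "Suc u" m] by auto

lemma mask_pos:
  assumes "u < m" "st u < q" "q < st (Suc u)"
  shows "mask g (a q) = g (a q)" "mask (g(a q := x)) = (mask g)(a q := x)"
  using range_pos[OF assms] unfolding mask_def by auto

lemma mask_nb: "u < m \<Longrightarrow> v \<in> nb u \<Longrightarrow> mask g v = g v"
  unfolding nb_def using mask_pos by auto

lemma wp_reset:
  assumes "stored \<sigma>" "x \<notin> {''in'', ''st'', ''q'', ''cnt''}"
  shows "wp (reset x) (\<lambda>\<sigma>' T'. mask (\<sigma>' x) = (\<lambda>_. 0) \<and> T' \<le> T + 2 + 3 * (st m - st 0)) \<sigma> T"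
  unfolding reset_def wp_simps
proof (rule wp_While[where B = "T + 1 + 3 * (st m - st 0)" and
      I = "\<lambda>\<sigma>' T'. st 0 \<le> \<sigma>' ''q'' 0 \<and> \<sigma>' ''q'' 0 \<le> st m \<and>
        (\<forall>p. st 0 \<le> p \<and> p < \<sigma>' ''q'' 0 \<longrightarrow> \<sigma>' x (a p) = 0) \<and>
        T' \<le> T + 1 + 3 * (\<sigma>' ''q'' 0 - st 0)"], goal_cases)
  case 1
  then show ?case using assms st_mono[of 0 m] by (simp add: update_def stored_def)
next
  case (2 \<sigma>' T')
  then show ?case by linarith
next
  case (3 \<sigma>' T')
  then have "stored \<sigma>'" using assms by (auto simp: stored_def update_def)
  from storedD[OF this] show ?case
    using 3(1,3) assms(2-) a2 by (auto simp: wp_simps update_def less_Suc_eq)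
next
  case (4 \<sigma>' T')
  then have "stored \<sigma>'" using assms by (auto simp: stored_def update_def)
  from storedD[OF this] show ?case using 4(1,3) a2 by (auto simp: mask_def fun_eq_iff)
qed

lemma wp_reset_cur:
  assumes "stored \<sigma>"
  shows "wp reset_cur (\<lambda>\<sigma>' T'. (\<forall>u<m. \<sigma>' ''cur'' u = Suc (st u) \<and> \<sigma>' ''lev'' u = 0) \<and>
    T' \<le> T + 2 + 4 * (st m - st 0)) \<sigma> T"
  unfolding reset_cur_def wp_simps
proof (rule wp_While[where B = "T + 1 + 4 * m" and
      I = "\<lambda>\<sigma>' T'. \<sigma>' ''u'' 0 \<le> m \<and>
        (\<forall>u<\<sigma>' ''u'' 0. \<sigma>' ''cur'' u = Suc (st u) \<and> \<sigma>' ''lev'' u = 0) \<and>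
        T' \<le> T + 1 + 4 * \<sigma>' ''u'' 0"], goal_cases)
  case 1
  then show ?case by (simp add: update_def)
next
  case (2 \<sigma>' T')
  then show ?case by linarith
next
  case (3 \<sigma>' T')
  then have "stored \<sigma>'" using assms by (auto simp: stored_def update_def)
  from storedD[OF this] show ?case
    using 3(1,3) a2 by (auto simp: wp_simps update_def less_Suc_eq)
next
  case (4 \<sigma>' T')
  then have "stored \<sigma>'" using assms by (auto simp: stored_def update_def)
  from storedD[OF this] show ?case using 4(1,3) a2 st_ge[of m] by auto
qed

text \<open>Each round either makes a step counted by \<open>progress\<close> or lets a new clause
  enter, which is counted by \<open>b\<close>; together with the loop test it costs at most 12
  units. Injectivity of \<open>fr\<close> makes \<open>f\<close> the cardinality of the set of
  clauses that gave up.\<close>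

definition auction_inv :: "nat \<Rightarrow> nat \<Rightarrow> state \<Rightarrow> nat \<Rightarrow> bool" where
  "auction_inv L T\<^sub>0 \<sigma> T \<longleftrightarrow>
    auction L (\<sigma> ''cur'') (\<sigma> ''lev'') (mask (\<sigma> ''pr'')) (mask (\<sigma> ''ow'')) (\<sigma> ''fr'' ` {..<\<sigma> ''f'' 0})
      (if 0 < \<sigma> ''act'' 0 then {\<sigma> ''u'' 0} else {}) (\<sigma> ''b'' 0) \<and>
    inj_on (\<sigma> ''fr'') {..<\<sigma> ''f'' 0} \<and>
    T \<le> T\<^sub>0 + 12 * (progress (\<sigma> ''cur'') (\<sigma> ''lev'') + \<sigma> ''b'' 0)"

lemma auction_inv_step:
  assumes inv: "auction_inv L T\<^sub>0 \<sigma> T" and "stored \<sigma>" and "\<sigma> ''L'' 0 = L"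
    and guard: "0 < \<sigma> ''act'' 0 \<or> \<sigma> ''b'' 0 < m" and L: "0 < m \<longrightarrow> 0 < L"
  shows "wp auction_step (auction_inv L T\<^sub>0) \<sigma> (T + 1)"
proof -
  note st = storedD[OF \<open>stored \<sigma>\<close>]
  let ?u = "\<sigma> ''u'' 0" and ?b = "\<sigma> ''b'' 0" and ?f = "\<sigma> ''f'' 0"
  let ?cur = "\<sigma> ''cur''" and ?lev = "\<sigma> ''lev''" and ?pr = "mask (\<sigma> ''pr'')" and ?ow = "mask (\<sigma> ''ow'')"
    and ?fr = "\<sigma> ''fr''"
  let ?v = "a (?cur ?u)"
  note I = inv[unfolded auction_inv_def]
  show ?thesis
  proof (cases "0 < \<sigma> ''act'' 0")
    case False
    then have "auction L ?cur ?lev ?pr ?ow (?fr ` {..<?f}) {?b} (Suc ?b)"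
      using I guard L by (intro auction_enter) auto
    then show ?thesis
      using False I by (simp add: auction_step_def wp_simps update_def auction_inv_def)
  next
    case True
    then have auc: "auction L ?cur ?lev ?pr ?ow (?fr ` {..<?f}) {?u} ?b" using I by simp
    note D = auctionD[OF auc]
    have u: "?u < m" "?u \<notin> ?fr ` {..<?f}" using D(4,5) by auto
    show ?thesis
    proof (cases "?cur ?u < st (Suc ?u)")
      case q: True
      note M = mask_pos[OF u(1) D(6)[OF u(1)] q]
      have P: "progress (?cur(?u := Suc (?cur ?u))) ?lev = Suc (progress ?cur ?lev)"
        using progress_advance u(1) D(6) by blast
      show ?thesis
      proof (cases "ex ?v = 0 \<and> \<not> ?lev ?u < \<sigma> ''pr'' ?v")
        case bid: True
        have "auction L (?cur(?u := Suc (?cur ?u))) ?lev (?pr(?v := Suc (?pr ?v))) (?ow(?v := Suc ?u))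
            (?fr ` {..<?f}) {u'. ?ow ?v = Suc u'} ?b"
          by (rule auction_bid[OF auc q refl]) (use bid M in auto)
        moreover have "{u'. ?ow ?v = Suc u'} = (if 0 < \<sigma> ''ow'' ?v then {\<sigma> ''ow'' ?v - 1} else {})"
          using M by auto
        ultimately show ?thesis
          using True q bid I P M st
          by (auto simp: auction_step_def wp_simps update_def auction_inv_def)
      next
        case nobid: False
        then have "auction L (?cur(?u := Suc (?cur ?u))) ?lev ?pr ?ow (?fr ` {..<?f}) {?u} ?b"
          using M by (intro auction_advance[OF auc q]) auto
        then show ?thesis
          using True q nobid I P st
          by (auto simp: auction_step_def wp_simps update_def auction_inv_def)
      qed
    next
      case q: False
      then have "?cur ?u = st (Suc ?u)" using D(7)[OF u(1)] by simp
      then have P: "progress (?cur(?u := Suc (st ?u))) (?lev(?u := Suc (?lev ?u))) = Suc (progress ?cur ?lev)"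
        using progress_raise u(1) by blast
      have fr: "(?fr(?f := ?u)) ` {..<Suc ?f} = insert ?u (?fr ` {..<?f})"
        "inj_on (?fr(?f := ?u)) {..<Suc ?f}"
      proof -
        show "(?fr(?f := ?u)) ` {..<Suc ?f} = insert ?u (?fr ` {..<?f})"
          by (auto simp: lessThan_Suc)
        have "inj_on (?fr(?f := ?u)) {..<?f}"
          using I u(2) by (intro inj_on_fun_updI) auto
        then show "inj_on (?fr(?f := ?u)) {..<Suc ?f}"
          using u(2) by (simp add: lessThan_Suc)
      qed
      show ?thesis
        using auction_raise[OF auc q] True q I P st fr \<open>\<sigma> ''L'' 0 = L\<close>
        by (auto simp: auction_step_def wp_simps update_def auction_inv_def)
    qed
  qed
qed

lemma wp_auction_loop:
  assumes "stored \<sigma>" "\<sigma> ''L'' 0 = L" "0 < m \<longrightarrow> 0 < L"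
    and "mask (\<sigma> ''pr'') = (\<lambda>_. 0)" "mask (\<sigma> ''ow'') = (\<lambda>_. 0)"
    and "\<forall>u<m. \<sigma> ''cur'' u = Suc (st u) \<and> \<sigma> ''lev'' u = 0"
  shows "wp auction_loop (\<lambda>\<sigma>' T'.
    auction L (\<sigma>' ''cur'') (\<sigma>' ''lev'') (mask (\<sigma>' ''pr'')) (mask (\<sigma>' ''ow''))
      (\<sigma>' ''fr'' ` {..<\<sigma>' ''f'' 0}) {} m \<and>
    inj_on (\<sigma>' ''fr'') {..<\<sigma>' ''f'' 0} \<and>
    T' \<le> T + 4 + 12 * ((L + 2) * (st m - st 0))) \<sigma> T"
  unfolding auction_loop_def wp_simps
proof (rule wp_While[where B = "T + 3 + 12 * ((L + 2) * (st m - st 0))" and I = "auction_inv L (T + 3)"],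
    goal_cases)
  case 1
  have "auction L (\<sigma> ''cur'') (\<sigma> ''lev'') (\<lambda>_. 0) (\<lambda>_. 0) {} {} 0"
    using auction_start assms(6) by blast
  then show ?case using assms(4,5) by (simp add: update_def auction_inv_def)
next
  case (2 \<sigma>' T')
  note D = auctionD[OF 2(1)[unfolded auction_inv_def, THEN conjunct1]]
  have "progress (\<sigma>' ''cur'') (\<sigma>' ''lev'') \<le> (L + 1) * (st m - st 0)"
    using progress_le D(7,8) by blast
  \<comment> \<open>This adds one to the factor \<open>L + 1\<close> from
    \<open>progress_le\<close>, which gives the \<open>L + 2\<close> of the bound.\<close>
  moreover have "\<sigma>' ''b'' 0 \<le> st m - st 0" using D(5) st_ge[of m] by simp
  ultimately show ?case using 2(1) by (simp add: auction_inv_def)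
next
  case (3 \<sigma>' T')
  then have "stored \<sigma>'" "\<sigma>' ''L'' 0 = L" using assms by (auto simp: stored_def update_def)
  then show ?case
    using 3(1,3) a2 assms(3) storedD[OF \<open>stored \<sigma>'\<close>] by (intro auction_inv_step) auto
next
  case (4 \<sigma>' T')
  then have "stored \<sigma>'" using assms by (auto simp: stored_def update_def)
  note I = 4(1)[unfolded auction_inv_def]
  note D = auctionD[OF I[THEN conjunct1]]
  have b: "\<sigma>' ''b'' 0 = m" "\<sigma>' ''act'' 0 = 0"
    using 4(3) a2 D(5) storedD[OF \<open>stored \<sigma>'\<close>] by auto
  have "progress (\<sigma>' ''cur'') (\<sigma>' ''lev'') \<le> (L + 1) * (st m - st 0)"
    using progress_le D(7,8) by blast
  then show ?case using I b st_ge[of m] by simp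
qed

text \<open>The time is amortised with 10 units of credit per stack entry. A cursor move earns 20:
  at most 10 pay for the round, whose dearest case is a push, and 10 are deposited on the pushed
  clause to pay for its later removal.\<close>

definition dfs_inv :: "(nat \<Rightarrow> nat) \<Rightarrow> nat \<Rightarrow> nat \<Rightarrow> state \<Rightarrow> nat \<Rightarrow> bool" where
  "dfs_inv ow r T\<^sub>0 \<sigma> T \<longleftrightarrow>
    (if \<sigma> ''fnd'' 0 = 0
     then dfs (mask ow) r (mask (\<sigma> ''vis'')) (\<sigma> ''cur'') (\<sigma> ''s'') (\<sigma> ''sp'' 0)
     else aug_path (mask ow) r (\<sigma> ''s'') (\<lambda>i. a (\<sigma> ''cur'' (\<sigma> ''s'' i) - 1)) (\<sigma> ''sp'' 0)) \<and>
    (\<forall>u<m. \<sigma> ''cur'' u \<le> st (Suc u)) \<and>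
    T + 10 * \<sigma> ''sp'' 0 \<le> T\<^sub>0 + 20 * progress (\<sigma> ''cur'') (\<lambda>_. 0) + 10"

lemma dfs_inv_step:
  assumes inv: "dfs_inv ow r T\<^sub>0 \<sigma> T" and "stored \<sigma>" and ow: "\<sigma> ''ow'' = ow"
    and guard: "0 < \<sigma> ''sp'' 0" "\<sigma> ''fnd'' 0 = 0"
  shows "wp dfs_step (dfs_inv ow r T\<^sub>0) \<sigma> (T + 1)"
proof -
  note st = storedD[OF \<open>stored \<sigma>\<close>] and I = inv[unfolded dfs_inv_def]
  obtain sp where sp: "\<sigma> ''sp'' 0 = Suc sp" using guard(1) gr0_implies_Suc by blast
  let ?cur = "\<sigma> ''cur''" and ?vis = "mask (\<sigma> ''vis'')" and ?s = "\<sigma> ''s''"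
  define u where "u = ?s sp"
  let ?v = "a (?cur u)"
  have dfs: "dfs (mask ow) r ?vis ?cur ?s (Suc sp)" using I guard sp by simp
  note D = dfsD[OF dfs]
  have u: "u < m" using D(6) reached_less[OF D(1,2)] unfolding u_def by blast
  show ?thesis
  proof (cases "?cur u < st (Suc u)")
    case q: True
    note M = mask_pos[OF u D(10)[OF u] q]
    have P: "progress (?cur(u := Suc (?cur u))) (\<lambda>_. 0) = Suc (progress ?cur (\<lambda>_. 0))"
      using progress_advance u D(10) by blast
    show ?thesis
    proof (cases "ex ?v = 0 \<and> \<sigma> ''vis'' ?v = 0")
      case new: True
      show ?thesis
      proof (cases "ow ?v")
        case 0
        then have "aug_path (mask ow) r ?s (\<lambda>i. a ((?cur(u := Suc (?cur u))) (?s i) - 1)) (Suc sp)"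
          using new M by (intro dfs_found[OF dfs u_def q refl]) auto
        then show ?thesis
          using q new I P M st sp ow guard 0
          by (auto simp: dfs_step_def wp_simps update_def dfs_inv_def u_def[symmetric])
      next
        case (Suc w)
        then have "dfs (mask ow) r (?vis(?v := 1)) (?cur(u := Suc (?cur u))) (?s(Suc sp := w)) (Suc (Suc sp))"
          using new M by (intro dfs_push[OF dfs u_def q refl]) auto
        then show ?thesis
          using q new I P M st sp ow guard Suc
          by (auto simp: dfs_step_def wp_simps update_def dfs_inv_def u_def[symmetric])
      qed
    next
      case old: False
      then have "dfs (mask ow) r ?vis (?cur(u := Suc (?cur u))) ?s (Suc sp)"
        using M by (intro dfs_advance[OF dfs u_def q]) auto
      then show ?thesis
        using q old I P st sp guard
        by (auto simp: dfs_step_def wp_simps update_def dfs_inv_def u_def[symmetric])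
    qed
  next
    case q: False
    then show ?thesis
      using dfs_pop[OF dfs] I st sp guard
      by (auto simp: dfs_step_def wp_simps update_def dfs_inv_def u_def[symmetric])
  qed
qed

lemma wp_dfs_loop:
  assumes "stored \<sigma>" "\<sigma> ''ow'' = ow" "is_match (mask ow)" "r < m" "r \<notin> covered (mask ow)"
    and "mask (\<sigma> ''vis'') = (\<lambda>_. 0)" "\<forall>u<m. \<sigma> ''cur'' u = Suc (st u)" "\<sigma> ''s'' 0 = r"
  shows "wp dfs_loop (\<lambda>\<sigma>' T'. 
    (if \<sigma>' ''fnd'' 0 = 0 then \<not> perfect
     else aug_path (mask ow) r (\<sigma>' ''s'') (\<lambda>i. a (\<sigma>' ''cur'' (\<sigma>' ''s'' i) - 1)) (\<sigma>' ''sp'' 0)) \<and>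
    T' \<le> T + 23 + 20 * (st m - st 0)) \<sigma> T"
  unfolding dfs_loop_def wp_simps
proof (rule wp_While[where B = "T + 22 + 20 * (st m - st 0)" and I = "dfs_inv ow r (T + 12)"], goal_cases)
  case 1
  have "dfs (mask ow) r (\<lambda>_. 0) (\<sigma> ''cur'') (\<sigma> ''s'') 1"
    by (rule dfs_start) (use assms in auto)
  then show ?case
    using assms st_less by (simp add: update_def dfs_inv_def Suc_le_eq)
next
  case (2 \<sigma>' T')
  have "progress (\<sigma>' ''cur'') (\<lambda>_. 0) \<le> (0 + 1) * (st m - st 0)"
    by (rule progress_le) (use 2(1) in \<open>auto simp: dfs_inv_def\<close>)
  then show ?case using 2(1) by (simp add: dfs_inv_def)
next
  case (3 \<sigma>' T')
  then have "stored \<sigma>'" "\<sigma>' ''ow'' = ow" using assms by (auto simp: stored_def update_def)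
  then show ?case using 3(1,3) by (intro dfs_inv_step) auto
next
  case (4 \<sigma>' T')
  have "progress (\<sigma>' ''cur'') (\<lambda>_. 0) \<le> (0 + 1) * (st m - st 0)"
    by (rule progress_le) (use 4(1) in \<open>auto simp: dfs_inv_def\<close>)
  then show ?case using 4(1,3) dfs_fail by (auto simp: dfs_inv_def)
qed

lemma wp_augment_loop:
  assumes "stored \<sigma>" "\<sigma> ''ow'' = ow"
    and path: "aug_path (mask ow) r (\<sigma> ''s'') (\<lambda>i. a (\<sigma> ''cur'' (\<sigma> ''s'' i) - 1)) (\<sigma> ''sp'' 0)"
  shows "wp augment_loop (\<lambda>\<sigma>' T'. is_match (mask (\<sigma>' ''ow'')) \<and>
    covered (mask (\<sigma>' ''ow'')) = insert r (covered (mask ow)) \<and>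
    T' \<le> T + 1 + 4 * (st m - st 0)) \<sigma> T"
proof -
  define s where "s = \<sigma> ''s''"
  define p where "p = (\<lambda>i. a (\<sigma> ''cur'' (s i) - 1))"
  define sp where "sp = \<sigma> ''sp'' 0"
  have path: "aug_path (mask ow) r s p sp" using path by (simp add: s_def p_def sp_def)
  have P: "inj_on s {..<sp}" "\<And>i. i < sp \<Longrightarrow> s i < m" "\<And>i. i < sp \<Longrightarrow> p i \<in> nb (s i)"
    using path unfolding aug_path_def by auto
  have inj: "inj_on p {..<sp}" using aug_path_inj[OF path] .
  \<comment> \<open>The stack holds distinct clauses, so its height is at most
    \<open>m\<close>.\<close>
  have "s ` {..<sp} \<subseteq> {..<m}" using P(2) by blast
  then have sp_le: "sp \<le> st m - st 0"
    using card_inj_on_le[OF P(1), of "{..<m}"] st_ge[of m] by simp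
  show ?thesis
    unfolding augment_loop_def
  proof (rule wp_While[where B = "T + 4 * sp" and I = "\<lambda>\<sigma>' T'. \<sigma>' ''sp'' 0 \<le> sp \<and>
        (\<forall>j. \<sigma>' ''sp'' 0 \<le> j \<and> j < sp \<longrightarrow> \<sigma>' ''ow'' (p j) = Suc (s j)) \<and>
        (\<forall>v. v \<notin> p ` {\<sigma>' ''sp'' 0..<sp} \<longrightarrow> \<sigma>' ''ow'' v = ow v) \<and>
        T' + 4 * \<sigma>' ''sp'' 0 \<le> T + 4 * sp"], goal_cases)
    case 1
    then show ?case using assms by (simp add: sp_def)
  next
    case (2 \<sigma>' T')
    then show ?case by linarith
  next
    case (3 \<sigma>' T')
    then have fr: "\<sigma>' ''in'' = a" "\<sigma>' ''cur'' = \<sigma> ''cur''" "\<sigma>' ''s'' = s"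
      using assms by (auto simp: stored_def s_def)
    obtain i where i: "\<sigma>' ''sp'' 0 = Suc i" using 3(3) gr0_implies_Suc by force
    have i_sp: "i < sp" using 3(1) i by simp
    \<comment> \<open>The variables of the path are distinct, so this assignment does not destroy
      those made for higher stack positions.\<close>
    have "p j = p i \<Longrightarrow> j = i" if "j < sp" for j using inj_onD[OF inj] that i_sp by blast
    then have on: "\<forall>j. i \<le> j \<and> j < sp \<longrightarrow> ((\<sigma>' ''ow'')(p i := Suc (s i))) (p j) = Suc (s j)"
      using 3(1) i by (metis fun_upd_apply le_neq_implies_less Suc_leI)
    have "{i..<sp} = insert i {Suc i..<sp}" using i_sp by auto
    then have off: "\<forall>v. v \<notin> p ` {i..<sp} \<longrightarrow> ((\<sigma>' ''ow'')(p i := Suc (s i))) v = ow v"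
      using 3(1) i by simp
    have "a (\<sigma> ''cur'' (s i) - Suc 0) = p i" by (simp add: p_def)
    then show ?case
      using 3(1) i fr on off by (simp add: wp_simps update_def)
  next
    case (4 \<sigma>' T')
    let ?ow = "mask (\<sigma>' ''ow'')"
    have sp0: "\<sigma>' ''sp'' 0 = 0" using 4(3) by simp
    have "?ow (p i) = Suc (s i)" if "i < sp" for i
      using 4(1) sp0 that mask_nb[OF P(2,3)] by auto
    moreover have "?ow v = mask ow v" if "v \<notin> p ` {..<sp}" for v
      using 4(1) sp0 that by (auto simp: mask_def atLeast0LessThan)
    ultimately show ?case
      using augment[OF path] 4(1) sp_le by auto
  qed
qed

lemma wp_augment_step:
  assumes "stored \<sigma>" "is_match (mask (\<sigma> ''ow''))" "\<sigma> ''fr'' (\<sigma> ''i'' 0) = r" "r < m"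
    "r \<notin> covered (mask (\<sigma> ''ow''))" "\<sigma> ''ok'' 0 = 1"
  shows "wp augment_step (\<lambda>\<sigma>' T'.
    (\<sigma>' ''ok'' 0 = 1 \<and> is_match (mask (\<sigma>' ''ow'')) \<and>
      covered (mask (\<sigma>' ''ow'')) = insert r (covered (mask (\<sigma> ''ow''))) \<or>
     \<sigma>' ''ok'' 0 = 0 \<and> \<not> perfect) \<and>
    \<sigma>' ''i'' 0 = Suc (\<sigma> ''i'' 0) \<and> T' \<le> T + 32 + 31 * (st m - st 0)) \<sigma> T"
  unfolding augment_step_def wp_Seq
proof (rule wp_mono[OF wp_reset], goal_cases)
  case (3 \<sigma>1 T1)
  have "stored \<sigma>1" using 3(2) assms(1) by (simp add: stored_def)
  then show ?case
  proof (rule wp_mono[OF wp_reset_cur], goal_cases)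
    case (1 \<sigma>2 T2)
    define \<sigma>3 where "\<sigma>3 = update \<sigma>2 ''s'' 0 (\<sigma>2 ''fr'' (\<sigma>2 ''i'' 0))"
    have e: "\<sigma>3 ''in'' = \<sigma> ''in''" "\<sigma>3 ''st'' = \<sigma> ''st''" "\<sigma>3 ''cnt'' = \<sigma> ''cnt''" "\<sigma>3 ''ow'' = \<sigma> ''ow''"
      "\<sigma>3 ''fr'' = \<sigma> ''fr''" "\<sigma>3 ''i'' = \<sigma> ''i''" "\<sigma>3 ''ok'' = \<sigma> ''ok''" "\<sigma>3 ''s'' 0 = r"
      "\<sigma>3 ''vis'' = \<sigma>1 ''vis''" "\<sigma>3 ''cur'' = \<sigma>2 ''cur''"
      using 1(2) 3(2) assms(3) by (simp_all add: \<sigma>3_def update_def)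
    have "stored \<sigma>3" using assms(1) e by (simp add: stored_def)
    from this e(4) assms(2,4,5)
    have "wp dfs_loop (\<lambda>\<sigma>' T'. 
      (if \<sigma>' ''fnd'' 0 = 0 then \<not> perfect
       else aug_path (mask (\<sigma> ''ow'')) r (\<sigma>' ''s'') (\<lambda>i. a (\<sigma>' ''cur'' (\<sigma>' ''s'' i) - 1)) (\<sigma>' ''sp'' 0)) \<and>
      T' \<le> T2 + 1 + 23 + 20 * (st m - st 0)) \<sigma>3 (T2 + 1)"
      by (rule wp_dfs_loop) (use 1(1) 3(1) e in auto)
    then have "wp dfs_loop (wp (Cond (Pos (V ''fnd'')) augment_loop (''ok'' ::= Const 0))
      (wp (''i'' ::= Inc (V ''i''))
        (\<lambda>\<sigma>' T'.
          (\<sigma>' ''ok'' 0 = 1 \<and> is_match (mask (\<sigma>' ''ow'')) \<and>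
            covered (mask (\<sigma>' ''ow'')) = insert r (covered (mask (\<sigma> ''ow''))) \<or>
           \<sigma>' ''ok'' 0 = 0 \<and> \<not> perfect) \<and>
          \<sigma>' ''i'' 0 = Suc (\<sigma> ''i'' 0) \<and> T' \<le> T + 32 + 31 * (st m - st 0)))) \<sigma>3 (T2 + 1)"
    proof (rule wp_mono, goal_cases)
      case (1 \<sigma>4 T4)
      have e4: "\<sigma>4 ''in'' = \<sigma> ''in''" "\<sigma>4 ''st'' = \<sigma> ''st''" "\<sigma>4 ''cnt'' = \<sigma> ''cnt''" "\<sigma>4 ''ow'' = \<sigma> ''ow''"
        "\<sigma>4 ''i'' = \<sigma> ''i''" "\<sigma>4 ''ok'' = \<sigma> ''ok''"
        using 1(2) e by simp_all
      have T4: "T4 \<le> T + 28 + 27 * (st m - st 0)"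
        using 1(1) \<open>_ \<and> T2 \<le> _\<close> 3(1) by linarith
      show ?case
      proof (cases "\<sigma>4 ''fnd'' 0 = 0")
        case True
        then show ?thesis using 1(1) T4 e4 by (simp add: wp_simps update_def)
      next
        case False
        have "stored \<sigma>4" using assms(1) e4 by (simp add: stored_def)
        then have "wp augment_loop (\<lambda>\<sigma>' T'. is_match (mask (\<sigma>' ''ow'')) \<and>
          covered (mask (\<sigma>' ''ow'')) = insert r (covered (mask (\<sigma> ''ow''))) \<and>
          T' \<le> T4 + 1 + 1 + 4 * (st m - st 0)) \<sigma>4 (T4 + 1)"
          by (rule wp_augment_loop) (use 1(1) False e4 in auto)
        then have "wp augment_loop (wp (''i'' ::= Inc (V ''i''))
        (\<lambda>\<sigma>' T'.
          (\<sigma>' ''ok'' 0 = 1 \<and> is_match (mask (\<sigma>' ''ow'')) \<and>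
            covered (mask (\<sigma>' ''ow'')) = insert r (covered (mask (\<sigma> ''ow''))) \<or>
           \<sigma>' ''ok'' 0 = 0 \<and> \<not> perfect) \<and>
          \<sigma>' ''i'' 0 = Suc (\<sigma> ''i'' 0) \<and> T' \<le> T + 32 + 31 * (st m - st 0))) \<sigma>4 (T4 + 1)"
        proof (rule wp_mono, goal_cases)
          case (1 \<sigma>5 T5)
          have "\<sigma>5 ''i'' = \<sigma> ''i''" "\<sigma>5 ''ok'' = \<sigma> ''ok''" using 1(2) e4 by simp_all
          then show ?case using 1(1) T4 assms(6) by (simp add: wp_simps update_def)
        qed
        then show ?thesis using False by (simp add: wp_Cond)
      qed
    qed
    then show ?case by (simp add: wp_Assign \<sigma>3_def)
  qed
qed (use assms in auto)

lemma wp_augment_all: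
  assumes "stored \<sigma>" "is_match (mask (\<sigma> ''ow''))" "\<sigma> ''fr'' = fr" "\<sigma> ''f'' 0 = f"
    and cov: "covered (mask (\<sigma> ''ow'')) = {..<m} - fr ` {..<f}" "fr ` {..<f} \<subseteq> {..<m}" "inj_on fr {..<f}"
    and "\<sigma> ''ok'' 0 = 1" "\<sigma> ''i'' 0 = 0"
  shows "wp (While (And (Less (V ''i'') (V ''f'')) (Pos (V ''ok''))) augment_step)
    (\<lambda>\<sigma>' T'. \<sigma>' ''ok'' 0 = (if perfect then 1 else 0) \<and>
      T' \<le> T + 1 + f * (33 + 31 * (st m - st 0))) \<sigma> T"
proof (rule wp_While[where B = "T + f * (33 + 31 * (st m - st 0))" and I = "\<lambda>\<sigma>' T'. \<sigma>' ''i'' 0 \<le> f \<and>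
      (\<sigma>' ''ok'' 0 = 1 \<and> is_match (mask (\<sigma>' ''ow'')) \<and>
        covered (mask (\<sigma>' ''ow'')) = {..<m} - fr ` {\<sigma>' ''i'' 0..<f} \<or>
       \<sigma>' ''ok'' 0 = 0 \<and> \<not> perfect) \<and>
      T' \<le> T + \<sigma>' ''i'' 0 * (33 + 31 * (st m - st 0))"], goal_cases)
  case 1
  then show ?case using assms by (simp add: atLeast0LessThan)
next
  case (2 \<sigma>' T')
  then have "\<sigma>' ''i'' 0 * (33 + 31 * (st m - st 0)) \<le> f * (33 + 31 * (st m - st 0))"
    by (intro mult_le_mono1) simp
  then show ?case using 2(1) by linarith
next
  case (3 \<sigma>' T')
  let ?i = "\<sigma>' ''i'' 0"
  have e: "\<sigma>' ''fr'' = fr" "\<sigma>' ''f'' 0 = f" "stored \<sigma>'"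
    using assms(1,3,4) 3(2) by (simp_all add: stored_def)
  have i: "?i < f" "\<sigma>' ''ok'' 0 = 1" using 3(1,3) e by auto
  have I: "is_match (mask (\<sigma>' ''ow''))" "covered (mask (\<sigma>' ''ow'')) = {..<m} - fr ` {?i..<f}"
    using 3(1) i by auto
  have r: "fr ?i < m" "fr ?i \<notin> covered (mask (\<sigma>' ''ow''))" using i cov(2) I(2) by auto
  have ins: "{?i..<f} = insert ?i {Suc ?i..<f}" using i by auto
  \<comment> \<open>Each leftover clause is listed once, so covering this one removes exactly one
    entry from the rest.\<close>
  have "fr ?i \<notin> fr ` {Suc ?i..<f}"
    using inj_on_image_mem_iff[OF cov(3), of ?i "{Suc ?i..<f}"] i by (simp add: subset_eq)
  then have c: "insert (fr ?i) (covered (mask (\<sigma>' ''ow''))) = {..<m} - fr ` {Suc ?i..<f}"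
    unfolding I(2) ins using r(1) by auto
  have "wp augment_step (\<lambda>\<sigma>'' T''.
    (\<sigma>'' ''ok'' 0 = 1 \<and> is_match (mask (\<sigma>'' ''ow'')) \<and>
      covered (mask (\<sigma>'' ''ow'')) = insert (fr ?i) (covered (mask (\<sigma>' ''ow''))) \<or>
     \<sigma>'' ''ok'' 0 = 0 \<and> \<not> perfect) \<and>
    \<sigma>'' ''i'' 0 = Suc (\<sigma>' ''i'' 0) \<and> T'' \<le> T' + 1 + 32 + 31 * (st m - st 0)) \<sigma>' (T' + 1)"
    by (rule wp_augment_step) (use e i I r in auto)
  then show ?case
    by (rule wp_mono) (use 3(1) i c in auto)
next
  case (4 \<sigma>' T')
  have e: "\<sigma>' ''f'' 0 = f" using assms(4) 4(2) by simp
  have "\<sigma>' ''i'' 0 * (33 + 31 * (st m - st 0)) \<le> f * (33 + 31 * (st m - st 0))"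
    using 4(1) by (intro mult_le_mono1) simp
  then have time: "T' + 1 \<le> T + 1 + f * (33 + 31 * (st m - st 0))" using 4(1) by linarith
  from 4(1) consider "\<sigma>' ''ok'' 0 = 0 \<and> \<not> perfect"
    | "\<sigma>' ''ok'' 0 = 1" "is_match (mask (\<sigma>' ''ow''))"
      "covered (mask (\<sigma>' ''ow'')) = {..<m} - fr ` {\<sigma>' ''i'' 0..<f}"
    by blast
  then show ?case
  proof cases
    case 1
    then show ?thesis using time by simp
  next
    case 2
    then have "\<sigma>' ''i'' 0 = f" using 4(1,3) e by simp
    then have perfect using 2 perfectI by simp
    then show ?thesis using 2 time by simp
  qed
qed

text \<open>Correctness of the early rejection rests on \<open>m <= L * L\<close>: a perfect
  matching and \<open>f\<close> leftover clauses give \<open>f * L <= m\<close>, hence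
  \<open>f <= L\<close>. That \<open>L\<close> is not too large matters only for the final time
  estimate.\<close>

lemma wp_match_clauses:
  assumes "stored \<sigma>" "\<sigma> ''L'' 0 = L" "m \<le> L * L"
  shows "wp match_clauses (\<lambda>\<sigma>' T'. \<sigma>' ''ok'' 0 = (if perfect then 1 else 0) \<and>
    T' \<le> T + 90 * ((L + 1) * (st m - st 0 + 1))) \<sigma> T"
  unfolding match_clauses_def wp_Seq
proof (rule wp_mono[OF wp_reset], goal_cases)
  case (3 \<sigma>1 T1)
  have "stored \<sigma>1" using 3(2) assms(1) by (simp add: stored_def)
  then show ?case
  proof (rule wp_mono[OF wp_reset], goal_cases)
    case (2 \<sigma>2 T2)
    have "stored \<sigma>2" using 2(2) \<open>stored \<sigma>1\<close> by (simp add: stored_def)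
    then show ?case
    proof (rule wp_mono[OF wp_reset_cur], goal_cases)
      case (1 \<sigma>3 T3)
      have s3: "stored \<sigma>3" using 1(2) \<open>stored \<sigma>2\<close> by (simp add: stored_def)
      have e: "\<sigma>3 ''L'' 0 = L" "\<sigma>3 ''pr'' = \<sigma>2 ''pr''" "\<sigma>3 ''ow'' = \<sigma>1 ''ow''"
        using 1(2) 2(2) 3(2) assms(2) by simp_all
      have T3: "T3 \<le> T + 6 + 10 * (st m - st 0)" using 1(1) 2(1) 3(1) by linarith
      have "0 < m \<longrightarrow> 0 < L" using assms(3) by (cases L) auto
      from s3 e(1) this show ?case
      proof (rule wp_mono[OF wp_auction_loop], goal_cases)
        case (4 \<sigma>4 T4)
        let ?ow = "mask (\<sigma>4 ''ow'')" and ?fr = "\<sigma>4 ''fr''" and ?f = "\<sigma>4 ''f'' 0"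
        have s4: "stored \<sigma>4" using 4(2) s3 by (simp add: stored_def)
        have L4: "\<sigma>4 ''L'' 0 = L" using 4(2) e by simp
        have T4: "T4 \<le> T + 10 + 10 * (st m - st 0) + 12 * ((L + 2) * (st m - st 0))"
          using 4(1) T3 by linarith
        have auc: "auction L (\<sigma>4 ''cur'') (\<sigma>4 ''lev'') (mask (\<sigma>4 ''pr'')) ?ow (?fr ` {..<?f}) {} m"
          and inj: "inj_on ?fr {..<?f}" using 4(1) by auto
        note D = auctionD[OF auc]
        \<comment> \<open>The leading terms are \<open>12 * (L * E)\<close> from the auction and
          \<open>31 * (L * E)\<close> from the searches; 90 is a generous common factor.\<close>
        have "10 + 10 * E + 12 * ((L + 2) * E) + 4 + L * (33 + 31 * E) \<le> 90 * ((L + 1) * (E + 1))"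
          for E by (simp add: algebra_simps)
        from this[of "st m - st 0"]
        have total: "T4 + 4 + L * (33 + 31 * (st m - st 0)) \<le> T + 90 * ((L + 1) * (st m - st 0 + 1))"
          using T4 by linarith
        show ?case
        proof (cases "L < ?f")
          case True
          have "\<not> perfect"
          proof
            assume perfect
            then have "?f * L \<le> m"
              using auction_deficiency[OF auc] card_image[OF inj] by simp
            then have "?f * L \<le> L * L" using assms(3) by (rule order.trans)
            \<comment> \<open>For \<open>L = 0\<close> there is no clause at all, so none can be
              left over, against \<open>L < f\<close>.\<close>
            moreover have "0 < L"
            proof (rule ccontr)
              assume "\<not> 0 < L"
              then have "?fr ` {..<?f} \<subseteq> {}" using D(3) assms(3) by simp
              then show False using True by auto
            qed
            ultimately show False using True by simp
          qed
          moreover have "T4 + 1 + 1 \<le> T + 90 * ((L + 1) * (st m - st 0 + 1))" using total by linarith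
          ultimately show ?thesis using True L4 by (simp add: wp_simps update_def)
        next
          case False
          define \<sigma>5 where "\<sigma>5 = update (update \<sigma>4 ''ok'' 0 1) ''i'' 0 0"
          have "wp (While (And (Less (V ''i'') (V ''f'')) (Pos (V ''ok''))) augment_step)
            (\<lambda>\<sigma>' T'. \<sigma>' ''ok'' 0 = (if perfect then 1 else 0) \<and>
              T' \<le> T4 + 3 + 1 + ?f * (33 + 31 * (st m - st 0))) \<sigma>5 (T4 + 3)"
            by (rule wp_augment_all[where fr = ?fr])
              (use s4 D(1-3) inj in \<open>simp_all add: \<sigma>5_def update_def stored_def\<close>)
          moreover have "?f * (33 + 31 * (st m - st 0)) \<le> L * (33 + 31 * (st m - st 0))"
            using False by (intro mult_le_mono1) simp
          ultimately have "wp (While (And (Less (V ''i'') (V ''f'')) (Pos (V ''ok''))) augment_step)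
            (\<lambda>\<sigma>' T'. \<sigma>' ''ok'' 0 = (if perfect then 1 else 0) \<and>
              T' \<le> T + 90 * ((L + 1) * (st m - st 0 + 1))) \<sigma>5 (T4 + 3)"
            using total by (elim wp_mono) linarith
          then show ?thesis
            using False L4 by (simp add: wp_simps \<sigma>5_def eval_nat_numeral)
        qed
      qed (use 1(1) 2(1) 3(1) e in auto)
    qed
  qed auto
qed (use assms in auto)

end

section \<open>Reading the input\<close>

definition reads :: "(nat \<Rightarrow> nat) \<Rightarrow> nat \<Rightarrow> nat list \<Rightarrow> bool" where
  "reads a q xs \<longleftrightarrow> (\<forall>i<length xs. a (q + i) = xs ! i)"

lemma reads_Nil [simp]: "reads a q []"
  by (simp add: reads_def)

lemma reads_Cons [simp]: "reads a q (x # xs) \<longleftrightarrow> a q = x \<and> reads a (Suc q) xs"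
  unfolding reads_def by (auto simp: All_less_Suc2)

lemma reads_append [simp]: "reads a q (xs @ ys) \<longleftrightarrow> reads a q xs \<and> reads a (q + length xs) ys"
  by (induction xs arbitrary: q) auto

text \<open>Terms are not copied; \<open>ts\<close> and \<open>te\<close> delimit them inside the
  input. Terms are numbered consecutively across clauses, and clause \<open>i\<close> has the
  numbers from \<open>cs i\<close> up to but excluding \<open>cs (Suc i)\<close>.\<close>

definition terms_stored :: "(nat \<Rightarrow> nat) \<Rightarrow> (nat \<Rightarrow> nat) \<Rightarrow> (nat \<Rightarrow> nat) \<Rightarrow> nat list list \<Rightarrow> bool" where
  "terms_stored a ts te tms \<longleftrightarrow>
    (\<forall>g<length tms. reads a (ts g) (tms ! g) \<and> te g = ts g + length (tms ! g))"

lemma terms_stored_snoc: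
  "terms_stored a ts te tms \<Longrightarrow> reads a x tm \<Longrightarrow>
    terms_stored a (ts(length tms := x)) (te(length tms := x + length tm)) (tms @ [tm])"
  unfolding terms_stored_def by (auto simp: less_Suc_eq nth_append)

definition skip_block :: com where
  "skip_block =
    ''r'' ::= Cell ''in'' (V ''q'') ;; ''q'' ::= Inc (V ''q'') ;;
    While (Pos (V ''r'')) (''q'' ::= Inc (V ''q'') ;; ''r'' ::= Dec (V ''r''))"

definition parse_clause :: com where
  "parse_clause =
    ''j'' ::= Cell ''in'' (V ''q'') ;; ''q'' ::= Inc (V ''q'') ;;
    While (Pos (V ''j''))
      (Assign ''ts'' (V ''g'') (Inc (V ''q'')) ;;
       skip_block ;;
       Assign ''te'' (V ''g'') (V ''q'') ;;
       ''g'' ::= Inc (V ''g'') ;;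
       ''j'' ::= Dec (V ''j''))"

text \<open>The last assignment stores a sentinel that bounds the term numbers of the last clause.
  The counters \<open>i\<close> and \<open>g\<close> start at 0 as all arrays do, and the final
  \<open>q\<close> is where \<open>parse_ps\<close> goes on.\<close>

definition parse_psp :: com where
  "parse_psp =
    ''q'' ::= Const 3 ;;
    While (Less (V ''i'') (Cell ''in'' (Const 1)))
      (Assign ''cs'' (V ''i'') (V ''g'') ;; parse_clause ;; ''i'' ::= Inc (V ''i'')) ;;
    Assign ''cs'' (V ''i'') (V ''g'')"

definition parse_ps :: com where
  "parse_ps =
    While (Less (V ''u'') (Cell ''in'' (Const 2)))
      (Assign ''st'' (V ''u'') (V ''q'') ;; skip_block ;; ''u'' ::= Inc (V ''u'')) ;;
    Assign ''st'' (V ''u'') (V ''q'')"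

text \<open>The clauses are counted off in groups of sizes 1, 2, 3, ...; \<open>L\<close> is the
  size of the current group and \<open>j\<close> the number of its places still open, so
  \<open>i + j\<close> is the triangular number of \<open>L\<close>.\<close>

definition root_loop :: com where
  "root_loop =
    ''i'' ::= Const 0 ;; ''j'' ::= Const 0 ;;
    While (Less (V ''i'') (Cell ''in'' (Const 2)))
      (''i'' ::= Inc (V ''i'') ;;
       Cond (Pos (V ''j'')) (''j'' ::= Dec (V ''j''))
         (''L'' ::= Inc (V ''L'') ;; ''j'' ::= Dec (V ''L'')))"

lemma writes_skip_block [simp]: "writes skip_block = {''q'', ''r''}"
  by (auto simp: skip_block_def)

lemma writes_parse_clause [simp]: "writes parse_clause = {''j'', ''q'', ''r'', ''ts'', ''te'', ''g''}"
  by (auto simp: parse_clause_def)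

lemma writes_parse_psp [simp]:
  "writes parse_psp = {''j'', ''q'', ''r'', ''ts'', ''te'', ''g'', ''cs'', ''i''}"
  by (auto simp: parse_psp_def)

lemma writes_parse_ps [simp]: "writes parse_ps = {''q'', ''r'', ''u'', ''st''}"
  by (auto simp: parse_ps_def)

lemma writes_root_loop [simp]: "writes root_loop = {''i'', ''j'', ''L''}"
  by (auto simp: root_loop_def)

section \<open>Correctness and running time of the parsing loops\<close>

lemma wp_skip_block:
  "wp skip_block (\<lambda>\<sigma>' T'. \<sigma>' ''q'' 0 = \<sigma> ''q'' 0 + 1 + \<sigma> ''in'' (\<sigma> ''q'' 0) \<and>
    T' \<le> T + 3 + 3 * \<sigma> ''in'' (\<sigma> ''q'' 0)) \<sigma> T"
  unfolding skip_block_def wp_simps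
  by (rule wp_While[where B = "T + 2 + 3 * \<sigma> ''in'' (\<sigma> ''q'' 0)" and I = "\<lambda>\<sigma>' T'.
      \<sigma>' ''q'' 0 + \<sigma>' ''r'' 0 = \<sigma> ''q'' 0 + 1 + \<sigma> ''in'' (\<sigma> ''q'' 0) \<and>
      T' + 3 * \<sigma>' ''r'' 0 \<le> T + 2 + 3 * \<sigma> ''in'' (\<sigma> ''q'' 0)"])
    (simp_all add: wp_simps update_def, arith)

lemma wp_parse_clause:
  assumes "\<sigma> ''in'' = a" "reads a (\<sigma> ''q'' 0) (length cl # concat (map block cl))"
    and "terms_stored a (\<sigma> ''ts'') (\<sigma> ''te'') tms" "\<sigma> ''g'' 0 = length tms"
  shows "wp parse_clause (\<lambda>\<sigma>' T'.
    terms_stored a (\<sigma>' ''ts'') (\<sigma>' ''te'') (tms @ cl) \<and> \<sigma>' ''g'' 0 = length (tms @ cl) \<and>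
    \<sigma>' ''q'' 0 = \<sigma> ''q'' 0 + length (length cl # concat (map block cl)) \<and>
    T' \<le> T + 8 * length (length cl # concat (map block cl))) \<sigma> T"
proof -
  \<comment> \<open>The offset reached after the length cell of the clause and \<open>d\<close>
    terms. A round costs at most 8 units plus 3 per variable, hence the factor 8 on offsets.\<close>
  define off where "off d = Suc (length (concat (map block (take d cl))))" for d
  have off_Suc: "off (Suc d) = off d + 1 + length (cl ! d)" if "d < length cl" for d
    using that by (simp add: off_def take_Suc_conv_app_nth block_def)
  have off_le: "off d \<le> length (length cl # concat (map block cl))" for d
  proof -
    have "concat (map block cl) = concat (map block (take d cl)) @ concat (map block (drop d cl))"
      by (simp flip: concat_append map_append)
    then show ?thesis by (simp add: off_def)
  qed
  have block_at: "reads a (\<sigma> ''q'' 0 + off d) (block (cl ! d))" if "d < length cl" for d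
  proof -
    have "concat (map block cl) =
        concat (map block (take d cl)) @ block (cl ! d) @ concat (map block (drop (Suc d) cl))"
      using id_take_nth_drop[OF that] by (metis append_Cons append_Nil concat.simps(2) concat_append list.map(2) map_append)
    then show ?thesis using assms(2) by (simp add: off_def)
  qed
  show ?thesis
    unfolding parse_clause_def wp_simps
  proof (rule wp_While[where B = "T + 8 * length (length cl # concat (map block cl))" and
        I = "\<lambda>\<sigma>' T'. \<exists>d\<le>length cl. \<sigma>' ''j'' 0 = length cl - d \<and>
          terms_stored a (\<sigma>' ''ts'') (\<sigma>' ''te'') (tms @ take d cl) \<and> \<sigma>' ''g'' 0 = length tms + d \<and>
          \<sigma>' ''q'' 0 = \<sigma> ''q'' 0 + off d \<and> T' + 1 \<le> T + 8 * off d"], goal_cases)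
    case 1
    then show ?case using assms by (auto simp: update_def off_def intro!: exI[of _ 0])
  next
    case (2 \<sigma>' T')
    then obtain d where "T' + 1 \<le> T + 8 * off d" by blast
    then show ?case using off_le[of d] by linarith
  next
    case (3 \<sigma>' T')
    from 3(1) obtain d where d: "d \<le> length cl" "\<sigma>' ''j'' 0 = length cl - d"
      "terms_stored a (\<sigma>' ''ts'') (\<sigma>' ''te'') (tms @ take d cl)" "\<sigma>' ''g'' 0 = length tms + d"
      "\<sigma>' ''q'' 0 = \<sigma> ''q'' 0 + off d" "T' + 1 \<le> T + 8 * off d"
      by blast
    with 3(3) have "d < length cl" by simp
    note d = this d(2-)
    have a: "\<sigma>' ''in'' = a" using 3(2) assms(1) by (simp add: update_def)
    define \<sigma>1 where "\<sigma>1 = update \<sigma>' ''ts'' (\<sigma>' ''g'' 0) (Suc (\<sigma>' ''q'' 0))"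
    have e1: "\<sigma>1 ''in'' = a" "\<sigma>1 ''q'' = \<sigma>' ''q''" using a by (simp_all add: \<sigma>1_def update_def)
    have b: "reads a (\<sigma>' ''q'' 0) (block (cl ! d))" using block_at d by simp
    then have len: "a (\<sigma>' ''q'' 0) = length (cl ! d)" and rd: "reads a (Suc (\<sigma>' ''q'' 0)) (cl ! d)"
      by (simp_all add: block_def)
    have "wp skip_block (wp (Assign ''te'' (V ''g'') (V ''q'') ;; ''g'' ::= Inc (V ''g'') ;; ''j'' ::= Dec (V ''j''))
      (\<lambda>\<sigma>' T'. \<exists>d\<le>length cl. \<sigma>' ''j'' 0 = length cl - d \<and>
          terms_stored a (\<sigma>' ''ts'') (\<sigma>' ''te'') (tms @ take d cl) \<and> \<sigma>' ''g'' 0 = length tms + d \<and>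
          \<sigma>' ''q'' 0 = \<sigma> ''q'' 0 + off d \<and> T' + 1 \<le> T + 8 * off d)) \<sigma>1 (T' + 1 + 1)"
    proof (rule wp_mono[OF wp_skip_block], goal_cases)
      case (1 \<sigma>2 T2)
      have e2: "\<sigma>2 ''ts'' = (\<sigma>' ''ts'')(\<sigma>' ''g'' 0 := Suc (\<sigma>' ''q'' 0))" "\<sigma>2 ''te'' = \<sigma>' ''te''"
        "\<sigma>2 ''g'' = \<sigma>' ''g''" "\<sigma>2 ''j'' = \<sigma>' ''j''"
        using 1(2) by (simp_all add: \<sigma>1_def update_def)
      have q2: "\<sigma>2 ''q'' 0 = Suc (\<sigma>' ''q'' 0) + length (cl ! d)" "T2 \<le> T' + 5 + 3 * length (cl ! d)"
        using 1(1) e1 len by auto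
      have lt: "length tms + d = length (tms @ take d cl)" using d(1) by simp
      have "terms_stored a ((\<sigma>' ''ts'')(length tms + d := Suc (\<sigma>' ''q'' 0)))
        ((\<sigma>' ''te'')(length tms + d := \<sigma>2 ''q'' 0)) (tms @ take (Suc d) cl)"
        using terms_stored_snoc[OF d(3) rd] d(1) unfolding q2 lt by (simp add: take_Suc_conv_app_nth)
      then show ?case
        using d e2 q2 off_Suc[OF d(1)]
        by (auto simp: wp_simps update_def intro!: exI[of _ "Suc d"])
    qed
    then show ?case by (simp add: wp_simps \<sigma>1_def)
  next
    case (4 \<sigma>' T')
    from 4(1) obtain d where d: "d \<le> length cl" "\<sigma>' ''j'' 0 = length cl - d"
      "terms_stored a (\<sigma>' ''ts'') (\<sigma>' ''te'') (tms @ take d cl)" "\<sigma>' ''g'' 0 = length tms + d"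
      "\<sigma>' ''q'' 0 = \<sigma> ''q'' 0 + off d" "T' + 1 \<le> T + 8 * off d"
      by blast
    with 4(3) have "d = length cl" by simp
    with d show ?case by (simp add: off_def)
  qed
qed

definition psp_words :: "psp_poly \<Rightarrow> nat list" where
  "psp_words p = concat (map (\<lambda>cl. length cl # concat (map block cl)) p)"

definition ps_words :: "ps_poly \<Rightarrow> nat list" where
  "ps_words p = concat (map block p)"

lemma psp_words_split:
  "i < length p \<Longrightarrow> psp_words p =
    psp_words (take i p) @ (length (p ! i) # concat (map block (p ! i))) @ psp_words (drop (Suc i) p)"
  unfolding psp_words_def
  by (subst id_take_nth_drop[of i p]) simp_all

lemma ps_words_split:
  "i < length p \<Longrightarrow> ps_words p = ps_words (take i p) @ block (p ! i) @ ps_words (drop (Suc i) p)"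
  unfolding ps_words_def
  by (subst id_take_nth_drop[of i p]) simp_all

lemma psp_words_take: "length (psp_words (take i p)) \<le> length (psp_words p)"
proof -
  have "psp_words p = psp_words (take i p) @ psp_words (drop i p)"
    unfolding psp_words_def by (simp flip: concat_append map_append)
  then show ?thesis by simp
qed

lemma ps_words_take: "length (ps_words (take i p)) \<le> length (ps_words p)"
proof -
  have "ps_words p = ps_words (take i p) @ ps_words (drop i p)"
    unfolding ps_words_def by (simp flip: concat_append map_append)
  then show ?thesis by simp
qed

lemma wp_parse_psp:
  assumes "\<sigma> ''in'' = a" "a 1 = length p" "reads a 3 (psp_words p)" "\<sigma> ''i'' 0 = 0" "\<sigma> ''g'' 0 = 0"
  shows "wp parse_psp (\<lambda>\<sigma>' T'.
    terms_stored a (\<sigma>' ''ts'') (\<sigma>' ''te'') (concat p) \<and>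
    (\<forall>i\<le>length p. \<sigma>' ''cs'' i = length (concat (take i p))) \<and>
    \<sigma>' ''q'' 0 = 3 + length (psp_words p) \<and>
    T' \<le> T + 3 + 11 * length (psp_words p)) \<sigma> T"
  unfolding parse_psp_def wp_Seq wp_Assign
proof (rule wp_While[where B = "T + 1 + 11 * length (psp_words p)" and
      I = "\<lambda>\<sigma>' T'. \<sigma>' ''i'' 0 \<le> length p \<and>
        terms_stored a (\<sigma>' ''ts'') (\<sigma>' ''te'') (concat (take (\<sigma>' ''i'' 0) p)) \<and>
        \<sigma>' ''g'' 0 = length (concat (take (\<sigma>' ''i'' 0) p)) \<and>
        (\<forall>i<\<sigma>' ''i'' 0. \<sigma>' ''cs'' i = length (concat (take i p))) \<and>
        \<sigma>' ''q'' 0 = 3 + length (psp_words (take (\<sigma>' ''i'' 0) p)) \<and>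
        T' \<le> T + 1 + 11 * length (psp_words (take (\<sigma>' ''i'' 0) p))"], goal_cases)
  case 1
  then show ?case using assms by (simp add: update_def terms_stored_def psp_words_def)
next
  case (2 \<sigma>' T')
  then show ?case using psp_words_take[of "\<sigma>' ''i'' 0" p] by linarith
next
  case (3 \<sigma>' T')
  have a: "\<sigma>' ''in'' = a" using 3(2) assms(1) by (simp add: update_def)
  define i where "i = \<sigma>' ''i'' 0"
  have i: "i < length p" using 3(3) a assms(2) by (simp add: i_def)
  define \<sigma>1 where "\<sigma>1 = update \<sigma>' ''cs'' i (\<sigma>' ''g'' 0)"
  have e1: "\<sigma>1 ''in'' = a" "\<sigma>1 ''q'' = \<sigma>' ''q''" "\<sigma>1 ''ts'' = \<sigma>' ''ts''" "\<sigma>1 ''te'' = \<sigma>' ''te''" "\<sigma>1 ''g'' = \<sigma>' ''g''"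
    "\<sigma>1 ''i'' 0 = i" "\<sigma>1 ''cs'' = (\<sigma>' ''cs'')(i := \<sigma>' ''g'' 0)"
    using a by (simp_all add: \<sigma>1_def update_def i_def)
  have r: "reads a (\<sigma>1 ''q'' 0) (length (p ! i) # concat (map block (p ! i)))"
    using assms(3) 3(1) e1 unfolding psp_words_split[OF i] i_def[symmetric] by simp
  have words: "length (psp_words (take (Suc i) p)) =
      length (psp_words (take i p)) + length (length (p ! i) # concat (map block (p ! i)))"
    using i by (simp add: psp_words_def take_Suc_conv_app_nth)
  have "wp parse_clause (\<lambda>\<sigma>' T''.
    terms_stored a (\<sigma>' ''ts'') (\<sigma>' ''te'') (concat (take i p) @ p ! i) \<and>
    \<sigma>' ''g'' 0 = length (concat (take i p) @ p ! i) \<and>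
    \<sigma>' ''q'' 0 = \<sigma>1 ''q'' 0 + length (length (p ! i) # concat (map block (p ! i))) \<and>
    T'' \<le> T' + 1 + 1 + 8 * length (length (p ! i) # concat (map block (p ! i)))) \<sigma>1 (T' + 1 + 1)"
    by (rule wp_parse_clause) (use 3(1) e1 r i_def in auto)
  then have "wp parse_clause (wp (''i'' ::= Inc (V ''i'')) (\<lambda>\<sigma>' T'. \<sigma>' ''i'' 0 \<le> length p \<and>
        terms_stored a (\<sigma>' ''ts'') (\<sigma>' ''te'') (concat (take (\<sigma>' ''i'' 0) p)) \<and>
        \<sigma>' ''g'' 0 = length (concat (take (\<sigma>' ''i'' 0) p)) \<and>
        (\<forall>i<\<sigma>' ''i'' 0. \<sigma>' ''cs'' i = length (concat (take i p))) \<and>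
        \<sigma>' ''q'' 0 = 3 + length (psp_words (take (\<sigma>' ''i'' 0) p)) \<and>
        T' \<le> T + 1 + 11 * length (psp_words (take (\<sigma>' ''i'' 0) p)))) \<sigma>1 (T' + 1 + 1)"
  proof (rule wp_mono, goal_cases)
    case (1 \<sigma>2 T2)
    have e2: "\<sigma>2 ''i'' 0 = i" "\<sigma>2 ''cs'' = (\<sigma>' ''cs'')(i := \<sigma>' ''g'' 0)"
      using 1(2) e1 by simp_all
    have c: "concat (take (Suc i) p) = concat (take i p) @ p ! i"
      using i by (simp add: take_Suc_conv_app_nth)
    have "T2 + 1 \<le> T + 1 + 11 * length (psp_words (take (Suc i) p))"
      using 1(1) 3(1) unfolding words i_def[symmetric] by simp
    moreover have "\<sigma>2 ''q'' 0 = 3 + length (psp_words (take (Suc i) p))"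
      using 1(1) 3(1) e1 unfolding words i_def[symmetric] by simp
    ultimately show ?case
      using 1(1) 3(1) i e2 c unfolding i_def[symmetric] by (simp add: wp_simps update_def less_Suc_eq)
  qed
  then show ?case by (simp add: wp_simps \<sigma>1_def i_def)
next
  case (4 \<sigma>' T')
  have a: "\<sigma>' ''in'' = a" using 4(2) assms(1) by (simp add: update_def)
  then have "\<sigma>' ''i'' 0 = length p" using 4(1,3) assms(2) by simp
  then show ?case using 4(1) by (simp add: update_def le_less)
qed

lemma wp_parse_ps:
  assumes "\<sigma> ''in'' = a" "a 2 = length p" "reads a q (ps_words p)" "\<sigma> ''u'' 0 = 0" "\<sigma> ''q'' 0 = q"
  shows "wp parse_ps (\<lambda>\<sigma>' T'.
    (\<forall>i\<le>length p. \<sigma>' ''st'' i = q + length (ps_words (take i p))) \<and>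
    T' \<le> T + 2 + 6 * length (ps_words p)) \<sigma> T"
  unfolding parse_ps_def wp_Seq wp_Assign
proof (rule wp_While[where B = "T + 6 * length (ps_words p)" and
      I = "\<lambda>\<sigma>' T'. \<sigma>' ''u'' 0 \<le> length p \<and>
        (\<forall>i<\<sigma>' ''u'' 0. \<sigma>' ''st'' i = q + length (ps_words (take i p))) \<and>
        \<sigma>' ''q'' 0 = q + length (ps_words (take (\<sigma>' ''u'' 0) p)) \<and>
        T' \<le> T + 6 * length (ps_words (take (\<sigma>' ''u'' 0) p))"], goal_cases)
  case 1
  then show ?case using assms by (simp add: ps_words_def)
next
  case (2 \<sigma>' T')
  then show ?case using ps_words_take[of "\<sigma>' ''u'' 0" p] by linarith
next
  case (3 \<sigma>' T')
  have a: "\<sigma>' ''in'' = a" using 3(2) assms(1) by simp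
  define i where "i = \<sigma>' ''u'' 0"
  have i: "i < length p" using 3(3) a assms(2) by (simp add: i_def)
  define \<sigma>1 where "\<sigma>1 = update \<sigma>' ''st'' i (\<sigma>' ''q'' 0)"
  have e1: "\<sigma>1 ''in'' = a" "\<sigma>1 ''q'' = \<sigma>' ''q''" "\<sigma>1 ''u'' 0 = i" "\<sigma>1 ''st'' = (\<sigma>' ''st'')(i := \<sigma>' ''q'' 0)"
    using a by (simp_all add: \<sigma>1_def update_def i_def)
  have len: "a (\<sigma>1 ''q'' 0) = length (p ! i)"
    using assms(3) 3(1) e1 unfolding ps_words_split[OF i] i_def[symmetric] by (simp add: block_def)
  have words: "length (ps_words (take (Suc i) p)) = length (ps_words (take i p)) + 1 + length (p ! i)"
    using i by (simp add: ps_words_def take_Suc_conv_app_nth block_def)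
  have "wp skip_block (wp (''u'' ::= Inc (V ''u'')) (\<lambda>\<sigma>' T'. \<sigma>' ''u'' 0 \<le> length p \<and>
        (\<forall>i<\<sigma>' ''u'' 0. \<sigma>' ''st'' i = q + length (ps_words (take i p))) \<and>
        \<sigma>' ''q'' 0 = q + length (ps_words (take (\<sigma>' ''u'' 0) p)) \<and>
        T' \<le> T + 6 * length (ps_words (take (\<sigma>' ''u'' 0) p)))) \<sigma>1 (T' + 1 + 1)"
  proof (rule wp_mono[OF wp_skip_block], goal_cases)
    case (1 \<sigma>2 T2)
    have e2: "\<sigma>2 ''u'' 0 = i" "\<sigma>2 ''st'' = (\<sigma>' ''st'')(i := \<sigma>' ''q'' 0)"
      using 1(2) e1 by simp_all
    have "T2 + 1 \<le> T + 6 * length (ps_words (take (Suc i) p))"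
      using 1(1) 3(1) len e1 unfolding words i_def[symmetric] by simp
    moreover have "\<sigma>2 ''q'' 0 = q + length (ps_words (take (Suc i) p))"
      using 1(1) 3(1) len e1 unfolding words i_def[symmetric] by simp
    ultimately show ?case
      using 3(1) i e2 unfolding i_def[symmetric] by (simp add: wp_simps update_def less_Suc_eq)
  qed
  then show ?case by (simp add: wp_simps \<sigma>1_def i_def)
next
  case (4 \<sigma>' T')
  have a: "\<sigma>' ''in'' = a" using 4(2) assms(1) by simp
  then have "\<sigma>' ''u'' 0 = length p" using 4(1,3) assms(2) by simp
  then show ?case using 4(1) by (simp add: update_def le_less)
qed

text \<open>The program finds \<open>L\<close> with \<open>m \<approx> L * (L + 1) / 2\<close>.\<close>

lemma wp_root_loop:
  assumes "\<sigma> ''in'' 2 = m" "\<sigma> ''L'' 0 = 0"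
  shows "wp root_loop (\<lambda>\<sigma>' T'. m \<le> \<sigma>' ''L'' 0 * \<sigma>' ''L'' 0 \<and>
    \<sigma>' ''L'' 0 * \<sigma>' ''L'' 0 \<le> 2 * m + \<sigma>' ''L'' 0 \<and> T' \<le> T + 3 + 5 * m) \<sigma> T"
  unfolding root_loop_def wp_Seq wp_Assign
proof (rule wp_While[where B = "T + 2 + 5 * m" and I = "\<lambda>\<sigma>' T'. \<sigma>' ''i'' 0 \<le> m \<and>
      2 * (\<sigma>' ''i'' 0 + \<sigma>' ''j'' 0) = \<sigma>' ''L'' 0 * \<sigma>' ''L'' 0 + \<sigma>' ''L'' 0 \<and> \<sigma>' ''j'' 0 \<le> \<sigma>' ''L'' 0 \<and>
      T' \<le> T + 2 + 5 * \<sigma>' ''i'' 0"], goal_cases)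
  case 1
  then show ?case using assms by (simp add: update_def)
next
  case (2 \<sigma>' T')
  then show ?case by linarith
next
  case (3 \<sigma>' T')
  have "\<sigma>' ''in'' 2 = m" using 3(2) assms(1) by (simp add: update_def)
  then show ?case using 3(1,3) by (auto simp: wp_simps update_def)
next
  case (4 \<sigma>' T')
  have "\<sigma>' ''in'' 2 = m" using 4(2) assms(1) by (simp add: update_def)
  then have *: "2 * m + 2 * \<sigma>' ''j'' 0 = \<sigma>' ''L'' 0 * \<sigma>' ''L'' 0 + \<sigma>' ''L'' 0" "\<sigma>' ''j'' 0 \<le> \<sigma>' ''L'' 0"
    "T' \<le> T + 2 + 5 * m" using 4(1,3) by auto
  \<comment> \<open>This gives \<open>2 * m <= L * L + L <= 2 * (L * L)\<close>; the upper estimate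
    of \<open>L * L\<close> uses \<open>j <= L\<close> instead.\<close>
  have "\<sigma>' ''L'' 0 \<le> \<sigma>' ''L'' 0 * \<sigma>' ''L'' 0" by simp
  with * have "m \<le> \<sigma>' ''L'' 0 * \<sigma>' ''L'' 0" by linarith
  moreover have "\<sigma>' ''L'' 0 * \<sigma>' ''L'' 0 \<le> 2 * m + \<sigma>' ''L'' 0" using * by linarith
  ultimately show ?case using * by simp
qed

section \<open>Backtracking\<close>

definition apply_term :: com where
  "apply_term =
    ''q'' ::= Cell ''ts'' (Cell ''ch'' (V ''d'')) ;;
    While (Less (V ''q'') (Cell ''te'' (Cell ''ch'' (V ''d''))))
      (''v'' ::= Cell ''in'' (V ''q'') ;;
       Cond (Pos (Cell ''cnt'' (V ''v''))) (''conf'' ::= Inc (V ''conf'')) Skip ;;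
       Assign ''cnt'' (V ''v'') (Inc (Cell ''cnt'' (V ''v''))) ;;
       ''q'' ::= Inc (V ''q''))"

text \<open>Here the test follows the decrement, whereas in \<open>apply_term\<close> it precedes
  the increment: in both cases it sees the exponent without the occurrence in question, so the two
  programs are inverse to each other on \<open>cnt\<close> and \<open>conf\<close>.\<close>

definition unapply_term :: com where
  "unapply_term =
    ''q'' ::= Cell ''ts'' (Cell ''ch'' (V ''d'')) ;;
    While (Less (V ''q'') (Cell ''te'' (Cell ''ch'' (V ''d''))))
      (''v'' ::= Cell ''in'' (V ''q'') ;;
       Assign ''cnt'' (V ''v'') (Dec (Cell ''cnt'' (V ''v''))) ;;
       Cond (Pos (Cell ''cnt'' (V ''v''))) (''conf'' ::= Dec (V ''conf'')) Skip ;;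
       ''q'' ::= Inc (V ''q''))"

definition backtrack :: com where
  "backtrack =
    Cond (Pos (V ''d''))
      (''d'' ::= Dec (V ''d'') ;; unapply_term ;; Assign ''ch'' (V ''d'') (Inc (Cell ''ch'' (V ''d''))))
      (''go'' ::= Const 0)"

text \<open>Clearing \<open>ok\<close> first lets three cases share the \<open>backtrack\<close>
  branch: an inner node with all terms tried, a leaf with a conflict, and a leaf where the matching
  fails. The matching is run only without conflicts, which is where its answer is
  meaningful.\<close>

definition search_step :: com where
  "search_step =
    ''ok'' ::= Const 0 ;;
    Cond (And (Less (V ''d'') (Cell ''in'' (Const 1)))
         (Less (Cell ''ch'' (V ''d'')) (Cell ''cs'' (Inc (V ''d'')))))
      (apply_term ;; ''d'' ::= Inc (V ''d'') ;; Assign ''ch'' (V ''d'') (Cell ''cs'' (V ''d'')))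
      (Cond (And (Neg (Less (V ''d'') (Cell ''in'' (Const 1)))) (Neg (Pos (V ''conf'')))) match_clauses Skip ;;
       Cond (Pos (V ''ok'')) (''out'' ::= Const 1 ;; ''go'' ::= Const 0) backtrack)"

definition search_loop :: com where
  "search_loop = While (Pos (V ''go'')) search_step"

lemma writes_apply_term [simp]: "writes apply_term = {''q'', ''v'', ''conf'', ''cnt''}"
  by (auto simp: apply_term_def)

lemma writes_unapply_term [simp]: "writes unapply_term = {''q'', ''v'', ''conf'', ''cnt''}"
  by (auto simp: unapply_term_def)

text \<open>The program tests multilinearity through the surplus of degree over number of distinct
  variables. Every occurring variable contributes at least 1 to the size, so equality forces all
  exponents to be 1.\<close>

lemma multilinear_iff: "multilinear M \<longleftrightarrow> size M = card (set_mset M)"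
proof
  assume "multilinear M"
  then show "size M = card (set_mset M)"
    unfolding multilinear_def size_multiset_overloaded_eq by simp
next
  assume *: "size M = card (set_mset M)"
  show "multilinear M"
  proof (rule ccontr)
    assume "\<not> multilinear M"
    then obtain x where "x \<in># M" "count M x \<noteq> 1" unfolding multilinear_def by blast
    then have "x \<in># M" "1 < count M x" by (auto simp flip: count_greater_zero_iff)
    then have "(\<Sum>x\<in>set_mset M. 1) < (\<Sum>x\<in>set_mset M. count M x)"
      by (intro sum_strict_mono_ex1) (auto simp: Suc_le_eq)
    then show False using * by (simp add: size_multiset_overloaded_eq)
  qed
qed

lemma card_set_mset_le: "card (set_mset M) \<le> size M"
proof -
  have "(\<Sum>x\<in>set_mset M. 1) \<le> (\<Sum>x\<in>set_mset M. count M x)"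
    by (rule sum_mono) (simp add: Suc_le_eq)
  then show ?thesis by (simp add: size_multiset_overloaded_eq)
qed

text \<open>Sizes add up, while the number of distinct variables loses the overlap. Hence equality
  for the sum forces equality for both summands and an empty overlap.\<close>

lemma multilinear_add:
  "multilinear (M + mset vs) \<longleftrightarrow> multilinear M \<and> distinct vs \<and> set vs \<inter> set_mset M = {}"
proof -
  have arith: "x \<le> y \<Longrightarrow> z \<le> w \<Longrightarrow> x + z = u + i \<Longrightarrow> y + w = u \<longleftrightarrow> y = x \<and> w = z \<and> i = 0"
    for x y z w u i :: nat by arith
  have "card (set_mset M) + card (set vs) = card (set_mset M \<union> set vs) + card (set_mset M \<inter> set vs)"
    by (rule card_Un_Int) auto
  from arith[OF card_set_mset_le card_length this]
  have "multilinear (M + mset vs) \<longleftrightarrow>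
    multilinear M \<and> length vs = card (set vs) \<and> card (set_mset M \<inter> set vs) = 0"
    by (simp add: multilinear_iff)
  moreover have "length vs = card (set vs) \<longleftrightarrow> distinct vs"
    using card_distinct distinct_card by metis
  ultimately show ?thesis by (simp add: Int_commute)
qed

text \<open>Here \<open>r\<close> counts the clauses still to be chosen from and \<open>F\<close> is
  the cost of the matching at a leaf. Each child is charged \<open>12 * t\<close> for applying and
  undoing one term.\<close>

fun search_time :: "nat \<Rightarrow> nat \<Rightarrow> nat \<Rightarrow> nat \<Rightarrow> nat" where
  "search_time c t F 0 = F + 20"
| "search_time c t F (Suc r) = c * (search_time c t F r + 12 * t + 40) + 20"

section \<open>The search tree and the extendability of partial choices\<close>

locale parsed_input =
  fixes p\<^sub>1 :: psp_poly and p\<^sub>2 :: ps_poly and a st cs ts te :: "nat \<Rightarrow> nat" and L c t :: nat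
  assumes a1: "a 1 = length p\<^sub>1" and a2: "a 2 = length p\<^sub>2"
    and cs: "i \<le> length p\<^sub>1 \<Longrightarrow> cs i = length (concat (take i p\<^sub>1))"
    and terms: "terms_stored a ts te (concat p\<^sub>1)"
    and st_Suc: "u < length p\<^sub>2 \<Longrightarrow> st (Suc u) = Suc (st u + length (p\<^sub>2 ! u))"
    and st_reads: "u < length p\<^sub>2 \<Longrightarrow> reads a (Suc (st u)) (p\<^sub>2 ! u)"
    and L: "length p\<^sub>2 \<le> L * L"
    and clauses: "cl \<in> set p\<^sub>1 \<Longrightarrow> length cl \<le> c"
    and degrees: "cl \<in> set p\<^sub>1 \<Longrightarrow> tm \<in> set cl \<Longrightarrow> length tm \<le> t"
begin

definition leaf_time :: nat where
  "leaf_time = 90 * ((L + 1) * (st (length p\<^sub>2) - st 0 + 1))"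

definition good :: "var multiset \<Rightarrow> bool" where
  "good M \<longleftrightarrow> (\<exists>vs \<in> set (product_lists p\<^sub>2). multilinear (M + mset vs))"

definition ext :: "nat \<Rightarrow> var multiset \<Rightarrow> bool" where
  "ext d M \<longleftrightarrow> (\<exists>tms \<in> set (product_lists (drop d p\<^sub>1)). good (M + mset (concat tms)))"

text \<open>This describes a node some of whose children are already refuted: only term numbers from
  \<open>g\<close> on remain. It is the invariant of the iteration over children.\<close>

definition ext_from :: "nat \<Rightarrow> nat \<Rightarrow> var multiset \<Rightarrow> bool" where
  "ext_from d g M \<longleftrightarrow> (\<exists>g'. g \<le> g' \<and> g' < cs (Suc d) \<and> ext (Suc d) (M + mset (concat p\<^sub>1 ! g')))"

lemma has_multilinear_monomial_iff: "has_multilinear_monomial p\<^sub>1 p\<^sub>2 \<longleftrightarrow> ext 0 {#}"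
  unfolding has_multilinear_monomial_def expansion_def ext_def good_def by auto

lemma cs_Suc: "d < length p\<^sub>1 \<Longrightarrow> cs (Suc d) = cs d + length (p\<^sub>1 ! d)"
  using cs[of d] cs[of "Suc d"] by (simp add: take_Suc_conv_app_nth)

lemma nth_term: "d < length p\<^sub>1 \<Longrightarrow> j < length (p\<^sub>1 ! d) \<Longrightarrow> concat p\<^sub>1 ! (cs d + j) = p\<^sub>1 ! d ! j"
proof -
  assume d: "d < length p\<^sub>1" "j < length (p\<^sub>1 ! d)"
  have "concat p\<^sub>1 = concat (take d p\<^sub>1) @ p\<^sub>1 ! d @ concat (drop (Suc d) p\<^sub>1)"
    by (subst id_take_nth_drop[OF d(1)]) simp
  then show ?thesis using d cs[of d] by (simp add: nth_append)
qed

lemma cs_le: "d \<le> length p\<^sub>1 \<Longrightarrow> cs d \<le> length (concat p\<^sub>1)"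
proof -
  assume "d \<le> length p\<^sub>1"
  moreover have "concat p\<^sub>1 = concat (take d p\<^sub>1) @ concat (drop d p\<^sub>1)"
    by (simp flip: concat_append)
  ultimately show ?thesis using cs[of d] by simp
qed

lemma ext_end: "ext (length p\<^sub>1) M \<longleftrightarrow> good M"
  by (simp add: ext_def)

lemma ext_unfold:
  assumes "d < length p\<^sub>1"
  shows "ext d M \<longleftrightarrow> ext_from d (cs d) M"
proof -
  have "ext d M \<longleftrightarrow> (\<exists>tm \<in> set (p\<^sub>1 ! d). ext (Suc d) (M + mset tm))"
    unfolding ext_def Cons_nth_drop_Suc[OF assms, symmetric] by (auto simp: add.assoc)
  also have "\<dots> \<longleftrightarrow> (\<exists>j<length (p\<^sub>1 ! d). ext (Suc d) (M + mset (concat p\<^sub>1 ! (cs d + j))))"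
    using nth_term[OF assms] by (metis in_set_conv_nth)
  also have "\<dots> \<longleftrightarrow> ext_from d (cs d) M"
    unfolding ext_from_def cs_Suc[OF assms] by (metis le_add1 le_Suc_ex nat_add_left_cancel_less)
  finally show ?thesis .
qed

lemma ext_from_step:
  "g < cs (Suc d) \<Longrightarrow> ext_from d g M \<longleftrightarrow> ext (Suc d) (M + mset (concat p\<^sub>1 ! g)) \<or> ext_from d (Suc g) M"
  unfolding ext_from_def by (metis Suc_leD Suc_leI le_neq_implies_less order.refl)

lemma term_length: "g < length (concat p\<^sub>1) \<Longrightarrow> length (concat p\<^sub>1 ! g) \<le> t"
  using degrees nth_mem[of g "concat p\<^sub>1"] by auto

text \<open>The exponents of the current monomial serve directly as the exclusion marks, so a graph
  is available for every \<open>M\<close> without building anything at a leaf.\<close>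

sublocale stored_graph "length p\<^sub>2" st a "count M" for M
  by unfold_locales (use st_Suc a2 in auto)

text \<open>By \<open>multilinear_add\<close>, a completing choice from \<open>p\<^sub>2\<close> is
  a system of distinct representatives that avoids the variables of \<open>M\<close>. The premise is
  essential, since the graph sees only which variables occur in \<open>M\<close>.\<close>

lemma perfect_iff: "multilinear M \<Longrightarrow> perfect M \<longleftrightarrow> good M"
proof -
  assume M: "multilinear M"
  have nb: "nb M u = {x \<in> set (p\<^sub>2 ! u). x \<notin># M}" if "u < length p\<^sub>2" for u
  proof (intro set_eqI iffI)
    fix x
    assume "x \<in> nb M u"
    then obtain q where q: "x = a q" "st u < q" "q < st (Suc u)" "count M x = 0" unfolding nb_def by blast
    then have "Suc (st u) + (q - Suc (st u)) = q" by simp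
    moreover from q have "q - Suc (st u) < length (p\<^sub>2 ! u)" using st_Suc[OF that] by auto
    ultimately have "a (Suc (st u) + (q - Suc (st u))) = p\<^sub>2 ! u ! (q - Suc (st u))"
      "q - Suc (st u) < length (p\<^sub>2 ! u)" "a (Suc (st u) + (q - Suc (st u))) = x"
      using st_reads[OF that] q(1) unfolding reads_def by auto
    then have "x \<in> set (p\<^sub>2 ! u)" by (metis nth_mem)
    then show "x \<in> {x \<in> set (p\<^sub>2 ! u). x \<notin># M}" using q by (auto simp: count_eq_zero_iff)
  next
    fix x
    assume "x \<in> {x \<in> set (p\<^sub>2 ! u). x \<notin># M}"
    then obtain i where i: "i < length (p\<^sub>2 ! u)" "x = p\<^sub>2 ! u ! i" "x \<notin># M" by (auto simp: in_set_conv_nth)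
    then have "x = a (Suc (st u) + i)" using st_reads[OF that] unfolding reads_def by auto
    then show "x \<in> nb M u"
      using i st_Suc[OF that] unfolding nb_def by (auto simp: count_eq_zero_iff intro!: exI[of _ "Suc (st u + i)"])
  qed
  show ?thesis
  proof
    assume "perfect M"
    then obtain f where f: "inj_on f {..<length p\<^sub>2}" "\<And>u. u < length p\<^sub>2 \<Longrightarrow> f u \<in> nb M u"
      unfolding perfect_def by blast
    define vs where "vs = map f [0..<length p\<^sub>2]"
    have "vs \<in> set (product_lists p\<^sub>2)"
      using f(2) nb by (auto simp: vs_def product_lists_set list_all2_conv_all_nth)
    moreover have "distinct vs" using f(1) by (simp add: vs_def distinct_map atLeast0LessThan)
    moreover have "set vs \<inter> set_mset M = {}" using f(2) nb by (auto simp: vs_def)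
    ultimately show "good M" using M unfolding good_def multilinear_add by blast
  next
    assume "good M"
    then obtain vs where vs: "length vs = length p\<^sub>2" "\<And>u. u < length p\<^sub>2 \<Longrightarrow> vs ! u \<in> set (p\<^sub>2 ! u)"
      "distinct vs" "set vs \<inter> set_mset M = {}"
      unfolding good_def multilinear_add by (auto simp: product_lists_set list_all2_conv_all_nth)
    have "inj_on ((!) vs) {..<length p\<^sub>2}" using vs(1,3) by (intro inj_on_nth) auto
    moreover have "vs ! u \<in> nb M u" if "u < length p\<^sub>2" for u
    proof -
      have "vs ! u \<in> set vs" using vs(1) that by simp
      then show ?thesis using nb[OF that] vs(2)[OF that] vs(4) by blast
    qed
    ultimately show "perfect M" unfolding perfect_def by blast
  qed
qed

text \<open>The surplus is specified by a sum, which avoids truncated subtraction.\<close>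

definition counted :: "var multiset \<Rightarrow> state \<Rightarrow> bool" where
  "counted M \<sigma> \<longleftrightarrow> \<sigma> ''cnt'' = count M \<and> \<sigma> ''conf'' 0 + card (set_mset M) = size M"

definition at_node :: "nat \<Rightarrow> var multiset \<Rightarrow> state \<Rightarrow> bool" where
  "at_node d M \<sigma> \<longleftrightarrow> \<sigma> ''in'' = a \<and> \<sigma> ''st'' = st \<and> \<sigma> ''cs'' = cs \<and> \<sigma> ''ts'' = ts \<and> \<sigma> ''te'' = te \<and>
    \<sigma> ''L'' 0 = L \<and> \<sigma> ''d'' 0 = d \<and> \<sigma> ''out'' 0 = 0 \<and> \<sigma> ''go'' 0 = 1 \<and> counted M \<sigma>"

lemma counted_add:
  "counted M \<sigma> \<Longrightarrow> \<sigma>' ''cnt'' = (\<sigma> ''cnt'')(v := Suc (\<sigma> ''cnt'' v)) \<Longrightarrow>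
    \<sigma>' ''conf'' 0 = (if 0 < \<sigma> ''cnt'' v then Suc (\<sigma> ''conf'' 0) else \<sigma> ''conf'' 0) \<Longrightarrow>
    counted (add_mset v M) \<sigma>'"
  by (auto simp: counted_def fun_eq_iff insert_absorb not_in_iff)

text \<open>If \<open>v\<close> still occurs after the removal, \<open>card_set_mset_le\<close>
  shows that \<open>conf\<close> was positive, so the truncated decrement is exact.\<close>

lemma counted_remove:
  "counted (add_mset v M) \<sigma> \<Longrightarrow> \<sigma>' ''cnt'' = (\<sigma> ''cnt'')(v := \<sigma> ''cnt'' v - 1) \<Longrightarrow>
    \<sigma>' ''conf'' 0 = (if 0 < \<sigma> ''cnt'' v - 1 then \<sigma> ''conf'' 0 - 1 else \<sigma> ''conf'' 0) \<Longrightarrow>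
    counted M \<sigma>'"
  using card_set_mset_le[of M] by (auto simp: counted_def fun_eq_iff insert_absorb not_in_iff)

lemma wp_apply_term:
  assumes "\<sigma> ''in'' = a" "\<sigma> ''ts'' = ts" "\<sigma> ''te'' = te" "\<sigma> ''ch'' (\<sigma> ''d'' 0) = g"
    and "g < length (concat p\<^sub>1)" "counted M \<sigma>"
  shows "wp apply_term (\<lambda>\<sigma>' T'. counted (M + mset (concat p\<^sub>1 ! g)) \<sigma>' \<and> T' \<le> T + 2 + 6 * t) \<sigma> T"
proof -
  define tm where "tm = concat p\<^sub>1 ! g"
  have tm: "reads a (ts g) tm" "te g = ts g + length tm"
    using terms assms(5) unfolding terms_stored_def tm_def by auto
  have "length tm \<le> t" using term_length[OF assms(5)] by (simp add: tm_def)
  show ?thesis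
    unfolding apply_term_def wp_Seq wp_Assign tm_def[symmetric]
  proof (rule wp_While[where B = "T + 1 + 6 * length tm" and I = "\<lambda>\<sigma>' T'. \<exists>i\<le>length tm.
        \<sigma>' ''q'' 0 = ts g + i \<and> counted (M + mset (take i tm)) \<sigma>' \<and> T' \<le> T + 1 + 6 * i"], goal_cases)
    case 1
    have "counted M (update \<sigma> ''q'' (aval (Const 0) \<sigma>) (aval (Cell ''ts'' (Cell ''ch'' (V ''d''))) \<sigma>))"
      using assms(6) by (simp add: counted_def update_def)
    then show ?case using assms(1-4) by (intro exI[of _ 0]) (simp add: update_def)
  next
    case (2 \<sigma>' T')
    from 2(1) show ?case by auto
  next
    case (3 \<sigma>' T')
    have e: "\<sigma>' ''in'' = a" "\<sigma>' ''te'' = te" "\<sigma>' ''ch'' (\<sigma>' ''d'' 0) = g"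
      using 3(2) assms(1-4) by (simp_all add: update_def)
    from 3(1) obtain i where i: "i \<le> length tm" "\<sigma>' ''q'' 0 = ts g + i" "counted (M + mset (take i tm)) \<sigma>'"
      "T' \<le> T + 1 + 6 * i" by blast
    with 3(3) e tm(2) have il: "i < length tm" by simp
    have v: "a (ts g + i) = tm ! i" using tm(1) il unfolding reads_def by blast
    have M: "M + mset (take (Suc i) tm) = add_mset (tm ! i) (M + mset (take i tm))"
      using il by (simp add: take_Suc_conv_app_nth)
    have c: "counted (M + mset (take (Suc i) tm)) \<sigma>''"
      if "\<sigma>'' ''cnt'' = (\<sigma>' ''cnt'')(tm ! i := Suc (\<sigma>' ''cnt'' (tm ! i)))"
        "\<sigma>'' ''conf'' 0 = (if 0 < \<sigma>' ''cnt'' (tm ! i) then Suc (\<sigma>' ''conf'' 0) else \<sigma>' ''conf'' 0)" for \<sigma>''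
      unfolding M using counted_add[OF i(3) that] .
    show ?case
      unfolding wp_simps
      using i il v e by (auto simp: update_def intro!: exI[of _ "Suc i"] c)
  next
    case (4 \<sigma>' T')
    have e: "\<sigma>' ''te'' = te" "\<sigma>' ''ch'' (\<sigma>' ''d'' 0) = g"
      using 4(2) assms(1-4) by (simp_all add: update_def)
    from 4(1) obtain i where i: "i \<le> length tm" "\<sigma>' ''q'' 0 = ts g + i" "counted (M + mset (take i tm)) \<sigma>'"
      "T' \<le> T + 1 + 6 * i" by blast
    with 4(3) e tm(2) have "i = length tm" by simp
    with i \<open>length tm \<le> t\<close> show ?case by simp
  qed
qed

lemma wp_unapply_term:
  assumes "\<sigma> ''in'' = a" "\<sigma> ''ts'' = ts" "\<sigma> ''te'' = te" "\<sigma> ''ch'' (\<sigma> ''d'' 0) = g"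
    and "g < length (concat p\<^sub>1)" "counted (M + mset (concat p\<^sub>1 ! g)) \<sigma>"
  shows "wp unapply_term (\<lambda>\<sigma>' T'. counted M \<sigma>' \<and> T' \<le> T + 2 + 6 * t) \<sigma> T"
proof -
  define tm where "tm = concat p\<^sub>1 ! g"
  have tm: "reads a (ts g) tm" "te g = ts g + length tm"
    using terms assms(5) unfolding terms_stored_def tm_def by auto
  have "length tm \<le> t" using term_length[OF assms(5)] by (simp add: tm_def)
  show ?thesis
    unfolding unapply_term_def wp_Seq wp_Assign
  proof (rule wp_While[where B = "T + 1 + 6 * length tm" and I = "\<lambda>\<sigma>' T'. \<exists>i\<le>length tm.
        \<sigma>' ''q'' 0 = ts g + i \<and> counted (M + mset (drop i tm)) \<sigma>' \<and> T' \<le> T + 1 + 6 * i"], goal_cases)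
    case 1
    have "counted (M + mset tm) (update \<sigma> ''q'' (aval (Const 0) \<sigma>) (aval (Cell ''ts'' (Cell ''ch'' (V ''d''))) \<sigma>))"
      using assms(6) by (simp add: counted_def update_def tm_def)
    then show ?case using assms(1-4) by (intro exI[of _ 0]) (simp add: update_def)
  next
    case (2 \<sigma>' T')
    from 2(1) show ?case by auto
  next
    case (3 \<sigma>' T')
    have e: "\<sigma>' ''in'' = a" "\<sigma>' ''te'' = te" "\<sigma>' ''ch'' (\<sigma>' ''d'' 0) = g"
      using 3(2) assms(1-4) by (simp_all add: update_def)
    from 3(1) obtain i where i: "i \<le> length tm" "\<sigma>' ''q'' 0 = ts g + i" "counted (M + mset (drop i tm)) \<sigma>'"
      "T' \<le> T + 1 + 6 * i" by blast
    with 3(3) e tm(2) have il: "i < length tm" by simp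
    have v: "a (ts g + i) = tm ! i" using tm(1) il unfolding reads_def by blast
    have M: "M + mset (drop i tm) = add_mset (tm ! i) (M + mset (drop (Suc i) tm))"
      using il by (simp flip: Cons_nth_drop_Suc)
    have c: "counted (M + mset (drop (Suc i) tm)) \<sigma>''"
      if "\<sigma>'' ''cnt'' = (\<sigma>' ''cnt'')(tm ! i := \<sigma>' ''cnt'' (tm ! i) - 1)"
        "\<sigma>'' ''conf'' 0 = (if 0 < \<sigma>' ''cnt'' (tm ! i) - 1 then \<sigma>' ''conf'' 0 - 1 else \<sigma>' ''conf'' 0)" for \<sigma>''
      using counted_remove[OF i(3)[unfolded M] that] .
    show ?case
      unfolding wp_simps
      using i il v e by (auto simp: update_def intro!: exI[of _ "Suc i"] c)
  next
    case (4 \<sigma>' T')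
    have e: "\<sigma>' ''te'' = te" "\<sigma>' ''ch'' (\<sigma>' ''d'' 0) = g"
      using 4(2) assms(1-4) by (simp_all add: update_def)
    from 4(1) obtain i where i: "i \<le> length tm" "\<sigma>' ''q'' 0 = ts g + i" "counted (M + mset (drop i tm)) \<sigma>'"
      "T' \<le> T + 1 + 6 * i" by blast
    with 4(3) e tm(2) have "i = length tm" by simp
    with i \<open>length tm \<le> t\<close> show ?case by simp
  qed
qed

section \<open>Correctness and running time of the search loop\<close>

lemma wp_search_loopI:
  "\<sigma> ''go'' 0 = 1 \<Longrightarrow> wp search_step (wp search_loop Q) \<sigma> (T + 1) \<Longrightarrow> wp search_loop Q \<sigma> T"
  unfolding search_loop_def by (rule wp_While_True) auto

text \<open>The program is one flat loop, without syntactic counterpart to a subtree. Subtrees are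
  therefore specified by continuations: \<open>no\<close> covers arriving at
  \<open>backtrack\<close> with the node restored, \<open>yes\<close> covers a success, which stops
  the loop.\<close>

lemma explore_leaf:
  assumes node: "at_node (length p\<^sub>1) M \<sigma>"
    and no: "\<And>\<sigma>' T'. at_node (length p\<^sub>1) M \<sigma>' \<Longrightarrow> \<sigma>' ''ch'' = \<sigma> ''ch'' \<Longrightarrow> \<not> good M \<Longrightarrow>
      T' \<le> T + leaf_time + 20 \<Longrightarrow> wp backtrack (wp search_loop Q) \<sigma>' T'"
    and yes: "\<And>\<sigma>' T'. \<sigma>' ''out'' 0 = 1 \<Longrightarrow> \<sigma>' ''go'' 0 = 0 \<Longrightarrow> good M \<Longrightarrow>
      T' \<le> T + leaf_time + 20 \<Longrightarrow> wp search_loop Q \<sigma>' T'"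
  shows "wp search_loop Q \<sigma> T"
proof (rule wp_search_loopI)
  show "\<sigma> ''go'' 0 = 1" using node by (simp add: at_node_def)
  define \<sigma>1 where "\<sigma>1 = update \<sigma> ''ok'' 0 0"
  have n1: "at_node (length p\<^sub>1) M \<sigma>1" "\<sigma>1 ''ch'' = \<sigma> ''ch''" "\<sigma>1 ''ok'' 0 = 0"
    using node by (simp_all add: \<sigma>1_def update_def at_node_def counted_def)
  have e1: "\<sigma>1 ''d'' 0 = length p\<^sub>1" "\<sigma>1 ''in'' 1 = length p\<^sub>1"
    using n1(1) a1 by (simp_all add: at_node_def)
  have multi: "multilinear M \<longleftrightarrow> \<sigma>1 ''conf'' 0 = 0"
    using n1(1) by (auto simp: at_node_def counted_def multilinear_iff)
  have good_multi: "good M \<Longrightarrow> multilinear M" unfolding good_def multilinear_add by blast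
  show "wp search_step (wp search_loop Q) \<sigma> (T + 1)"
  proof (cases "multilinear M")
    case False
    then have "wp backtrack (wp search_loop Q) \<sigma>1 (T + 6)"
      by (intro no) (use n1 good_multi in auto)
    then show ?thesis
      using False multi e1 n1(3) by (simp add: search_step_def wp_simps \<sigma>1_def[symmetric] eval_nat_numeral)
  next
    case True
    have "stored M \<sigma>1" "\<sigma>1 ''L'' 0 = L" using n1(1) by (simp_all add: stored_def at_node_def counted_def)
    then have "wp match_clauses (wp (Cond (Pos (V ''ok'')) (''out'' ::= Const 1 ;; ''go'' ::= Const 0) backtrack)
      (wp search_loop Q)) \<sigma>1 (T + 4)"
    proof (rule wp_mono[OF wp_match_clauses[OF _ _ L]], goal_cases)
      case (1 \<sigma>2 T2)
      have n2: "at_node (length p\<^sub>1) M \<sigma>2" "\<sigma>2 ''ch'' = \<sigma> ''ch''"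
        using n1 1(2) by (simp_all add: at_node_def counted_def)
      have T2: "T2 \<le> T + leaf_time + 4" using 1(1) by (simp add: leaf_time_def)
      show ?case
      proof (cases "good M")
        case gd: True
        then have "\<sigma>2 ''ok'' 0 = 1" using 1(1) perfect_iff[OF True] by simp
        moreover have "wp search_loop Q (update (update \<sigma>2 ''out'' 0 1) ''go'' 0 0) (T2 + 3)"
          by (rule yes) (use gd T2 in \<open>simp_all add: update_def\<close>)
        ultimately show ?thesis by (simp add: wp_simps eval_nat_numeral)
      next
        case gd: False
        then have "\<sigma>2 ''ok'' 0 = 0" using 1(1) perfect_iff[OF True] by simp
        moreover have "wp backtrack (wp search_loop Q) \<sigma>2 (T2 + 1)"
          by (rule no) (use gd T2 n2 in auto)
        ultimately show ?thesis by (simp add: wp_simps)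
      qed
    qed
    then show ?thesis
      using True multi e1 by (simp add: search_step_def wp_simps \<sigma>1_def[symmetric] eval_nat_numeral)
  qed
qed

text \<open>Two nested inductions rebuild the recursion: the outer one on the number
  \<open>r\<close> of remaining clauses, the inner one on the number of untried terms at the node.
  Only choices above depth \<open>d\<close> are promised unchanged, as the subtree overwrites the
  others.\<close>

lemma explore:
  assumes "d + r = length p\<^sub>1" "at_node d M \<sigma>" "\<sigma> ''ch'' d = cs d"
    and "\<And>\<sigma>' T'. at_node d M \<sigma>' \<Longrightarrow> (\<And>i. i < d \<Longrightarrow> \<sigma>' ''ch'' i = \<sigma> ''ch'' i) \<Longrightarrow> \<not> ext d M \<Longrightarrow>
      T' \<le> T + search_time c t leaf_time r \<Longrightarrow> wp backtrack (wp search_loop Q) \<sigma>' T'"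
    and "\<And>\<sigma>' T'. \<sigma>' ''out'' 0 = 1 \<Longrightarrow> \<sigma>' ''go'' 0 = 0 \<Longrightarrow> ext d M \<Longrightarrow>
      T' \<le> T + search_time c t leaf_time r \<Longrightarrow> wp search_loop Q \<sigma>' T'"
  shows "wp search_loop Q \<sigma> T"
  using assms
proof (induction r arbitrary: d M \<sigma> T)
  case 0
  then have d: "d = length p\<^sub>1" by simp
  show ?case
    by (rule explore_leaf) (use 0 d ext_end in auto)
next
  case (Suc r)
  note no = Suc.prems(4) and yes = Suc.prems(5)
  have d: "d < length p\<^sub>1" using Suc.prems(1) by simp
  \<comment> \<open>The budget of one child, including applying and undoing its term.\<close>
  define X where "X = search_time c t leaf_time r + 12 * t + 40"
  have "cs (Suc d) - cs d \<le> c" using cs_Suc[OF d] clauses[of "p\<^sub>1 ! d"] d by simp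
  then have "(cs (Suc d) - cs d) * X \<le> c * X" by (rule mult_le_mono1)
  then have start: "T + (cs (Suc d) - cs d) * X + 20 \<le> T + search_time c t leaf_time (Suc r)"
    by (simp add: X_def)
  \<comment> \<open>The claim is generalised to a node whose terms before \<open>g\<close> have
    failed, with budget left for the untried ones.\<close>
  have "wp search_loop Q \<sigma>1 T1"
    if "at_node d M \<sigma>1" "\<sigma>1 ''ch'' d = g" "g \<le> cs (Suc d)" "\<And>i. i < d \<Longrightarrow> \<sigma>1 ''ch'' i = \<sigma> ''ch'' i"
      "T1 + (cs (Suc d) - g) * X + 20 \<le> T + search_time c t leaf_time (Suc r)"
      "ext d M \<longleftrightarrow> ext_from d g M" for g \<sigma>1 T1
    using that
  proof (induction "cs (Suc d) - g" arbitrary: g \<sigma>1 T1)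
    case 0
    then have g: "g = cs (Suc d)" by simp
    define \<sigma>2 where "\<sigma>2 = update \<sigma>1 ''ok'' 0 0"
    have n2: "at_node d M \<sigma>2" "\<sigma>2 ''ch'' = \<sigma>1 ''ch''" "\<sigma>2 ''ok'' 0 = 0"
      using 0(2) by (simp_all add: \<sigma>2_def update_def at_node_def counted_def)
    have e2: "\<sigma>2 ''d'' 0 = d" "\<sigma>2 ''in'' 1 = length p\<^sub>1" "\<sigma>2 ''cs'' (Suc d) = g" "\<sigma>2 ''ch'' d = g"
      using n2 a1 g 0(3) by (simp_all add: at_node_def)
    have "\<not> ext d M" using 0(7) g by (auto simp: ext_from_def)
    then have "wp backtrack (wp search_loop Q) \<sigma>2 (T1 + 6)"
      using n2 0(5,6) by (intro no) auto
    moreover have "\<sigma>1 ''go'' 0 = 1" using 0(2) by (simp add: at_node_def)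
    ultimately show ?case
      using e2 n2(3) d
      by (intro wp_search_loopI) (simp_all add: search_step_def wp_simps \<sigma>2_def[symmetric] eval_nat_numeral)
  next
    case (Suc x)
    have g: "g < cs (Suc d)" using Suc.hyps(2) by simp
    have X: "(cs (Suc d) - g) * X = X + (cs (Suc d) - Suc g) * X"
      using g by (metis Suc_diff_Suc mult_Suc)
    have gl: "g < length (concat p\<^sub>1)" using g cs_le[of "Suc d"] d by simp
    let ?M = "M + mset (concat p\<^sub>1 ! g)"
    define \<sigma>2 where "\<sigma>2 = update \<sigma>1 ''ok'' 0 0"
    have n2: "at_node d M \<sigma>2" "\<sigma>2 ''ch'' = \<sigma>1 ''ch''"
      using Suc.prems(1) by (simp_all add: \<sigma>2_def update_def at_node_def counted_def)
    have e2: "\<sigma>2 ''d'' 0 = d" "\<sigma>2 ''in'' = a" "\<sigma>2 ''cs'' = cs" "\<sigma>2 ''ch'' d = g" "\<sigma>2 ''ts'' = ts" "\<sigma>2 ''te'' = te"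
      "counted M \<sigma>2"
      using n2 a1 Suc.prems(2) by (simp_all add: at_node_def)
    have "wp apply_term (wp (''d'' ::= Inc (V ''d'') ;; Assign ''ch'' (V ''d'') (Cell ''cs'' (V ''d'')))
      (wp search_loop Q)) \<sigma>2 (T1 + 3)"
    proof (rule wp_mono[OF wp_apply_term[where g = g and M = M]], goal_cases)
      case (7 \<sigma>3 T3)
      define \<sigma>4 where "\<sigma>4 = update (update \<sigma>3 ''d'' 0 (Suc d)) ''ch'' (Suc d) (cs (Suc d))"
      have ch4: "\<sigma>4 ''ch'' = (\<sigma>1 ''ch'')(Suc d := cs (Suc d))"
        using 7(2) n2 by (simp add: \<sigma>4_def update_def)
      have d3: "\<sigma>3 ''d'' 0 = d" "\<sigma>3 ''cs'' = cs" using 7(2) e2 by simp_all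
      have n4: "at_node (Suc d) ?M \<sigma>4"
        using 7 n2(1) unfolding at_node_def counted_def by (simp add: \<sigma>4_def update_def)
      have "wp search_loop Q \<sigma>4 (T3 + 2)"
      proof (rule Suc.IH[OF _ n4])
        show "Suc d + r = length p\<^sub>1" using \<open>d + Suc r = length p\<^sub>1\<close> by simp
        show "\<sigma>4 ''ch'' (Suc d) = cs (Suc d)" by (simp add: ch4)
      next
        \<comment> \<open>The child has failed: \<open>backtrack\<close> undoes its term, and the
          inner induction continues with \<open>Suc g\<close>.\<close>
        fix \<sigma>5 :: state and T5 :: nat
        assume 5: "at_node (Suc d) ?M \<sigma>5" "\<And>i. i < Suc d \<Longrightarrow> \<sigma>5 ''ch'' i = \<sigma>4 ''ch'' i"
          "\<not> ext (Suc d) ?M" "T5 \<le> T3 + 2 + search_time c t leaf_time r"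
        define \<sigma>6 where "\<sigma>6 = update \<sigma>5 ''d'' 0 d"
        have ch6: "\<sigma>6 ''ch'' d = g" "\<And>i. i < d \<Longrightarrow> \<sigma>6 ''ch'' i = \<sigma> ''ch'' i"
          using 5(2) Suc.prems(2,4) by (simp_all add: \<sigma>6_def update_def ch4)
        have e6: "\<sigma>6 ''in'' = a" "\<sigma>6 ''ts'' = ts" "\<sigma>6 ''te'' = te" "\<sigma>6 ''ch'' (\<sigma>6 ''d'' 0) = g" "\<sigma>6 ''d'' 0 = d"
          "counted ?M \<sigma>6"
          using 5(1) ch6 by (simp_all add: \<sigma>6_def update_def at_node_def counted_def)
        have "wp unapply_term (wp (Assign ''ch'' (V ''d'') (Inc (Cell ''ch'' (V ''d''))))
          (wp search_loop Q)) \<sigma>6 (T5 + 2)"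
        proof (rule wp_mono[OF wp_unapply_term[where g = g and M = M]], goal_cases)
          case (7 \<sigma>7 T7)
          define \<sigma>8 where "\<sigma>8 = update \<sigma>7 ''ch'' d (Suc g)"
          have e7: "\<sigma>7 ''d'' 0 = d" "\<sigma>7 ''ch'' = \<sigma>6 ''ch''" using 7(2) e6 by simp_all
          have n8: "at_node d M \<sigma>8"
            using 7 5(1) unfolding at_node_def counted_def by (simp add: \<sigma>8_def \<sigma>6_def update_def)
          have "wp search_loop Q \<sigma>8 (T7 + 1)"
          proof (rule Suc.hyps(1))
            show "x = cs (Suc d) - Suc g" using Suc.hyps(2) by simp
            show "at_node d M \<sigma>8" by (rule n8)
            show "\<sigma>8 ''ch'' d = Suc g" by (simp add: \<sigma>8_def update_def)
            show "Suc g \<le> cs (Suc d)" using g by simp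
            show "\<sigma>8 ''ch'' i = \<sigma> ''ch'' i" if "i < d" for i
              using ch6(2)[OF that] that e7 by (simp add: \<sigma>8_def update_def)
            show "T7 + 1 + (cs (Suc d) - Suc g) * X + 20 \<le> T + search_time c t leaf_time (Suc r)"
              using Suc.prems(5) X \<open>_ \<and> T7 \<le> _\<close> \<open>_ \<and> T3 \<le> _\<close> 5(4) X_def by linarith
            show "ext d M \<longleftrightarrow> ext_from d (Suc g) M"
              using Suc.prems(6) ext_from_step[OF g] 5(3) by simp
          qed
          then show ?case using e7 ch6 by (simp add: wp_simps \<sigma>8_def)
        qed (use e6 gl in auto)
        moreover have "\<sigma>5 ''d'' 0 = Suc d" using 5(1) by (simp add: at_node_def)
        ultimately show "wp backtrack (wp search_loop Q) \<sigma>5 T5"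
          by (simp add: backtrack_def wp_simps \<sigma>6_def)
      next
        \<comment> \<open>The child has succeeded: with \<open>go\<close> cleared nothing is undone,
          and success passes straight up.\<close>
        fix \<sigma>5 :: state and T5 :: nat
        assume 5: "\<sigma>5 ''out'' 0 = 1" "\<sigma>5 ''go'' 0 = 0" "ext (Suc d) ?M"
          "T5 \<le> T3 + 2 + search_time c t leaf_time r"
        show "wp search_loop Q \<sigma>5 T5"
        proof (rule yes)
          show "\<sigma>5 ''out'' 0 = 1" "\<sigma>5 ''go'' 0 = 0" by (fact 5)+
          show "ext d M" using Suc.prems(6) ext_from_step[OF g] 5(3) by simp
          show "T5 \<le> T + search_time c t leaf_time (Suc r)"
            using Suc.prems(5) X \<open>_ \<and> T3 \<le> _\<close> 5(4) X_def by linarith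
        qed
      qed
      moreover have "update \<sigma>3 ''d'' 0 (Suc d) ''d'' 0 = Suc d" "update \<sigma>3 ''d'' 0 (Suc d) ''cs'' = cs"
        using d3 by (simp_all add: update_def)
      ultimately show ?case using d3 by (simp add: wp_simps \<sigma>4_def)
    qed (use e2 gl in auto)
    moreover have "\<sigma>1 ''go'' 0 = 1" using Suc.prems(1) by (simp add: at_node_def)
    ultimately show ?case
      using e2 d g a1
      by (intro wp_search_loopI) (simp_all add: search_step_def wp_simps \<sigma>2_def[symmetric] eval_nat_numeral)
  qed
  from this[OF Suc.prems(2) Suc.prems(3) _ _ start ext_unfold[OF d]] show "wp search_loop Q \<sigma> T"
    using cs_Suc[OF d] by simp
qed

lemma wp_search_loop:
  assumes "at_node 0 {#} \<sigma>" "\<sigma> ''ch'' 0 = 0"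
  shows "wp search_loop (\<lambda>\<sigma>' T'. \<sigma>' ''out'' 0 = (if has_multilinear_monomial p\<^sub>1 p\<^sub>2 then 1 else 0) \<and>
    T' \<le> T + search_time c t leaf_time (length p\<^sub>1) + 3) \<sigma> T"
proof (rule explore[where r = "length p\<^sub>1", OF _ assms(1)], goal_cases)
  case 1
  then show ?case by (rule add_0)
next
  case 2
  then show ?case using assms(2) cs[of 0] by simp
next
  case (3 \<sigma>' T')
  \<comment> \<open>Depth 0 makes \<open>backtrack\<close> clear \<open>go\<close> instead of
    popping; this and the last loop test are the final 3 units.\<close>
  then show ?case
    by (auto simp: backtrack_def search_loop_def wp_simps at_node_def update_def
        has_multilinear_monomial_iff intro!: wp_While_False)
next
  case (4 \<sigma>' T')
  then show ?case
    by (auto simp: search_loop_def has_multilinear_monomial_iff intro!: wp_While_False)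
qed

end

definition decide :: com where
  "decide = parse_psp ;; parse_ps ;; root_loop ;; ''go'' ::= Const 1 ;; search_loop"

section \<open>The time bound\<close>

lemma encode_words: "encode n p\<^sub>1 p\<^sub>2 = [n, length p\<^sub>1, length p\<^sub>2] @ psp_words p\<^sub>1 @ ps_words p\<^sub>2"
  by (simp add: encode_def psp_words_def ps_words_def)

lemma wp_decide:
  assumes clauses: "\<And>cl. cl \<in> set p\<^sub>1 \<Longrightarrow> length cl \<le> c"
    and degrees: "\<And>cl tm. cl \<in> set p\<^sub>1 \<Longrightarrow> tm \<in> set cl \<Longrightarrow> length tm \<le> t"
  shows "wp decide (\<lambda>\<sigma>' T'. answer \<sigma>' = (if has_multilinear_monomial p\<^sub>1 p\<^sub>2 then 1 else 0) \<and>
    (\<exists>L. L * L \<le> 2 * length p\<^sub>2 + L \<and>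
      T' \<le> 12 + 11 * length (psp_words p\<^sub>1) + 6 * length (ps_words p\<^sub>2) + 5 * length p\<^sub>2 +
        search_time c t (90 * ((L + 1) * (length (ps_words p\<^sub>2) + 1))) (length p\<^sub>1)))
    (input_state (encode n p\<^sub>1 p\<^sub>2)) 0"
proof -
  define \<sigma> where "\<sigma> = input_state (encode n p\<^sub>1 p\<^sub>2)"
  define a where "a = \<sigma> ''in''"
  have zero: "\<sigma> x i = 0" if "x \<noteq> ''in''" for x i using that by (simp add: \<sigma>_def input_state_def)
  have "reads a 0 (encode n p\<^sub>1 p\<^sub>2)" by (simp add: a_def \<sigma>_def input_state_def reads_def)
  then have a: "a 1 = length p\<^sub>1" "a 2 = length p\<^sub>2" "reads a 3 (psp_words p\<^sub>1)"
    "reads a (3 + length (psp_words p\<^sub>1)) (ps_words p\<^sub>2)"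
    unfolding encode_words by (simp_all add: eval_nat_numeral)
  show ?thesis
    unfolding decide_def wp_Seq \<sigma>_def[symmetric]
  proof (rule wp_mono[OF wp_parse_psp[where p = "p\<^sub>1" and a = a]], goal_cases)
    case (6 \<sigma>1 T1)
    have e1: "\<sigma>1 ''in'' = a" "\<sigma>1 ''u'' 0 = 0" "\<sigma>1 ''L'' 0 = 0" "\<sigma>1 ''d'' 0 = 0" "\<sigma>1 ''out'' 0 = 0"
      "\<sigma>1 ''ch'' 0 = 0" "\<sigma>1 ''conf'' 0 = 0" "\<sigma>1 ''cnt'' = (\<lambda>_. 0)"
      using 6(2) zero by (simp_all add: a_def fun_eq_iff)
    show ?case
    proof (rule wp_mono[OF wp_parse_ps[where p = "p\<^sub>2" and a = a and q = "3 + length (psp_words p\<^sub>1)"]], goal_cases)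
      case (6 \<sigma>2 T2)
      define st where "st = \<sigma>2 ''st''"
      have st: "st i = 3 + length (psp_words p\<^sub>1) + length (ps_words (take i p\<^sub>2))" if "i \<le> length p\<^sub>2" for i
        using 6(1) that by (simp add: st_def)
      have e2: "\<sigma>2 ''in'' 2 = length p\<^sub>2" "\<sigma>2 ''L'' 0 = 0"
        using 6(2) e1 a(2) by simp_all
      show ?case
      proof (rule wp_mono[OF wp_root_loop[OF e2]], goal_cases)
        case (1 \<sigma>3 T3)
        define L where "L = \<sigma>3 ''L'' 0"
        interpret parsed_input p\<^sub>1 p\<^sub>2 a st "\<sigma>1 ''cs''" "\<sigma>1 ''ts''" "\<sigma>1 ''te''" L c t
        proof
          fix u
          assume u: "u < length p\<^sub>2"
          show "st (Suc u) = Suc (st u + length (p\<^sub>2 ! u))"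
            using st[of u] st[of "Suc u"] u by (simp add: ps_words_def take_Suc_conv_app_nth block_def)
          show "reads a (Suc (st u)) (p\<^sub>2 ! u)"
            using a(4) st[of u] u unfolding ps_words_split[OF u] by (simp add: block_def)
        next
          show "length p\<^sub>2 \<le> L * L" using 1(1) by (simp add: L_def)
        qed (use a clauses degrees \<open>terms_stored _ _ _ _ \<and> _\<close> in auto)
        define \<sigma>4 where "\<sigma>4 = update \<sigma>3 ''go'' 0 1"
        have "\<sigma>4 ''ch'' 0 = 0" "\<sigma>4 ''conf'' 0 = 0" "\<sigma>4 ''cnt'' = (\<lambda>_. 0)" "\<sigma>4 ''in'' = a" "\<sigma>4 ''st'' = st"
          "\<sigma>4 ''cs'' = \<sigma>1 ''cs''" "\<sigma>4 ''ts'' = \<sigma>1 ''ts''" "\<sigma>4 ''te'' = \<sigma>1 ''te''" "\<sigma>4 ''L'' 0 = L"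
          "\<sigma>4 ''d'' 0 = 0" "\<sigma>4 ''out'' 0 = 0" "\<sigma>4 ''go'' 0 = 1"
          using 1(2) 6(2) e1 by (simp_all add: \<sigma>4_def update_def L_def st_def)
        then have "at_node 0 {#} \<sigma>4" "\<sigma>4 ''ch'' 0 = 0"
          by (simp_all add: at_node_def counted_def fun_eq_iff)
        then have "wp search_loop (\<lambda>\<sigma>' T'. answer \<sigma>' = (if has_multilinear_monomial p\<^sub>1 p\<^sub>2 then 1 else 0) \<and>
          (\<exists>L. L * L \<le> 2 * length p\<^sub>2 + L \<and>
            T' \<le> 12 + 11 * length (psp_words p\<^sub>1) + 6 * length (ps_words p\<^sub>2) + 5 * length p\<^sub>2 +
              search_time c t (90 * ((L + 1) * (length (ps_words p\<^sub>2) + 1))) (length p\<^sub>1))) \<sigma>4 (T3 + 1)"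
        proof (rule wp_mono[OF wp_search_loop], goal_cases)
          case (1 \<sigma>5 T5)
          have "leaf_time = 90 * ((L + 1) * (length (ps_words p\<^sub>2) + 1))"
            using st[of 0] st[of "length p\<^sub>2"] by (simp add: leaf_time_def ps_words_def)
          moreover have "L * L \<le> 2 * length p\<^sub>2 + L"
            using \<open>length p\<^sub>2 \<le> \<sigma>3 ''L'' 0 * \<sigma>3 ''L'' 0 \<and> _\<close> by (simp add: L_def)
          ultimately show ?case
            using 1(1) \<open>_ \<and> _ \<and> T3 \<le> _\<close> \<open>_ \<and> T2 \<le> _\<close> \<open>_ \<and> _ \<and> _ \<and> T1 \<le> _\<close>
            by (intro conjI exI[of _ L]) (simp_all add: answer_def)
        qed
        then show ?case by (simp add: wp_simps \<sigma>4_def)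
      qed
    qed (use e1 a \<open>terms_stored _ _ _ _ \<and> _\<close> in auto)
  qed (use a zero a_def in auto)
qed

section \<open>Estimates that bring the running time into closed form\<close>

lemma concat_length_le: "(\<And>x. x \<in> set xs \<Longrightarrow> length (f x) \<le> b) \<Longrightarrow> length (concat (map f xs)) \<le> length xs * b"
  by (induction xs) (auto simp: add_mono)

lemma psp_words_le:
  assumes "Pi_Sigma_Pi n k c t p"
  shows "length (psp_words p) \<le> k * (1 + c * (1 + t))"
proof -
  have "length (length cl # concat (map block cl)) \<le> 1 + c * (1 + t)" if "cl \<in> set p" for cl
  proof -
    have "length (concat (map block cl)) \<le> length cl * (1 + t)"
      using assms that by (intro concat_length_le) (auto simp: Pi_Sigma_Pi_def block_def)
    also have "\<dots> \<le> c * (1 + t)"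
      using assms that by (intro mult_le_mono1) (auto simp: Pi_Sigma_Pi_def)
    finally show ?thesis by simp
  qed
  then have "length (psp_words p) \<le> length p * (1 + c * (1 + t))"
    unfolding psp_words_def by (rule concat_length_le)
  then show ?thesis using assms by (simp add: Pi_Sigma_Pi_def)
qed

lemma ps_words_le:
  assumes "Pi_Sigma n m s p"
  shows "length (ps_words p) \<le> m * (1 + s)"
proof -
  have "length (ps_words p) \<le> length p * (1 + s)"
    unfolding ps_words_def using assms
    by (intro concat_length_le) (auto simp: Pi_Sigma_def block_def)
  then show ?thesis using assms by (simp add: Pi_Sigma_def)
qed

text \<open>The offset \<open>24 * t + 100\<close> absorbs the inhomogeneous part of the recurrence:
  the step reduces to \<open>2 * (12 * t + 60) <= c * (12 * t + 60)\<close>, which is where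
  \<open>c >= 2\<close> enters.\<close>

lemma search_time_geometric:
  assumes "2 \<le> c"
  shows "search_time c t F r + (24 * t + 100) \<le> c ^ r * (F + (24 * t + 120))"
proof (induction r)
  case (Suc r)
  have "2 * (12 * t + 60) \<le> c * (12 * t + 60)" using assms by (rule mult_le_mono1)
  then have "search_time c t F (Suc r) + (24 * t + 100) \<le> c * (search_time c t F r + (24 * t + 100))"
    by (simp add: algebra_simps)
  also have "\<dots> \<le> c * (c ^ r * (F + (24 * t + 120)))" using Suc.IH by (rule mult_le_mono2)
  finally show ?case by (simp add: mult.assoc)
qed simp

text \<open>With one term per clause nothing grows geometrically, and the inner nodes contribute a
  term linear in \<open>r\<close>.\<close>

lemma search_time_linear: "search_time 1 t F r = F + 20 + r * (12 * t + 60)"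
  by (induction r) simp_all

text \<open>Charges the reading of \<open>p\<^sub>1\<close>, of order \<open>k * c * t\<close>, to
  \<open>t * c ^ k\<close>. This fails for \<open>c = 1\<close> and \<open>k >= 2\<close>.\<close>

lemma mult_le_power: "2 \<le> c \<Longrightarrow> k * c \<le> (c :: nat) ^ k"
proof (induction k)
  case (Suc k)
  show ?case
  proof (cases k)
    case (Suc j)
    then have "c \<le> c ^ k" using \<open>2 \<le> c\<close> by simp
    then have "Suc k * c \<le> 2 * c ^ k" using Suc.IH[OF \<open>2 \<le> c\<close>] by simp
    also have "\<dots> \<le> c * c ^ k" using \<open>2 \<le> c\<close> by (rule mult_le_mono1)
    finally show ?thesis by simp
  qed simp
qed simp

text \<open>Completing the square gives \<open>(L - 1)\<^sup>2 <= 2 * m - L + 1 <= 4 * m\<close>;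
  the missing 2 in \<open>L + 1\<close> is at most twice the root of \<open>m\<close>.\<close>

lemma root_le:
  fixes L m :: nat
  assumes "L * L \<le> 2 * m + L" "1 \<le> m"
  shows "real L + 1 \<le> 4 * sqrt (real m)"
proof -
  have "real L * real L \<le> 2 * real m + real L" using of_nat_mono[OF assms(1), where 'a = real] by simp
  moreover have "(real L - 1)\<^sup>2 = real L * real L - 2 * real L + 1"
    by (simp add: power2_eq_square algebra_simps)
  moreover have "(2 * sqrt (real m))\<^sup>2 = 4 * real m" by (simp add: power_mult_distrib)
  moreover have "1 \<le> real m" using assms(2) by simp
  ultimately have "(real L - 1)\<^sup>2 \<le> (2 * sqrt (real m))\<^sup>2" by linarith
  then have "real L - 1 \<le> 2 * sqrt (real m)" by (rule power2_le_imp_le) simp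
  moreover have "1 \<le> sqrt (real m)" using assms(2) by simp
  ultimately show ?thesis by linarith
qed

text \<open>The constant is \<open>90 * 4 * 3\<close>, with 4 from \<open>root_le\<close> and 3 from
  \<open>E + 1 <= 3 * (m * s)\<close>.\<close>

lemma matching_time_le:
  assumes "1 \<le> m" "1 \<le> s" "L * L \<le> 2 * m + L" "E \<le> m * (1 + s)"
  shows "real (90 * ((L + 1) * (E + 1))) \<le> 1080 * (real m * real s * sqrt (real m + real n))"
proof -
  have "m + m * s + 1 \<le> 3 * (m * s)"
  proof -
    have "m * 1 \<le> m * s" "1 * 1 \<le> m * s" using assms by (auto intro: mult_le_mono)
    then show ?thesis by linarith
  qed
  then have "E + 1 \<le> 3 * (m * s)" using assms(4) by simp
  from of_nat_mono[OF this, where 'a = real] have E: "real E + 1 \<le> 3 * (real m * real s)" by simp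
  have "sqrt (real m) \<le> sqrt (real m + real n)" by simp
  then have "real L + 1 \<le> 4 * sqrt (real m + real n)" using root_le[OF assms(3,1)] by linarith
  then have "(real L + 1) * (real E + 1) \<le> 4 * sqrt (real m + real n) * (3 * (real m * real s))"
    by (intro mult_mono E) auto
  then show ?thesis by (simp add: algebra_simps)
qed

text \<open>Correctness is claimed for all inputs, the time bound only where it can hold:
  \<open>time_bound\<close> is 0 if \<open>t\<close>, \<open>m\<close> or \<open>s\<close> is 0, or
  if \<open>c = 0 < k\<close>, while every run takes time. For \<open>c = 1\<close> it does not
  depend on \<open>k\<close>, although the program reads all \<open>k\<close> clauses.\<close>

theorem theorem3:
  "\<exists>(P :: com) (C :: real).
     \<forall>n k c t m s p\<^sub>1 p\<^sub>2.
       Pi_Sigma_Pi n k c t p\<^sub>1 \<longrightarrow> Pi_Sigma n m s p\<^sub>2 \<longrightarrow>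
       (\<exists>T \<sigma>.
          exec P (input_state (encode n p\<^sub>1 p\<^sub>2)) T \<sigma> \<and>
          answer \<sigma> = (if has_multilinear_monomial p\<^sub>1 p\<^sub>2 then 1 else 0) \<and>
          (t \<ge> 1 \<and> m \<ge> 1 \<and> s \<ge> 1 \<longrightarrow>
             (c \<ge> 2 \<longrightarrow> real T \<le> C * time_bound n k c t m s) \<and>
             (c = 1 \<longrightarrow> real T \<le> C * (real k * real t + time_bound n k c t m s))))"
proof (intro exI[of _ decide] exI[of _ "2000 :: real"] allI impI)
  fix n k c t m s p\<^sub>1 p\<^sub>2
  assume p: "Pi_Sigma_Pi n k c t p\<^sub>1" "Pi_Sigma n m s p\<^sub>2"
  have km: "length p\<^sub>1 = k" "length p\<^sub>2 = m" using p by (simp_all add: Pi_Sigma_Pi_def Pi_Sigma_def)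
  define E where "E = length (ps_words p\<^sub>2)"
  have "wp decide (\<lambda>\<sigma>' T'. answer \<sigma>' = (if has_multilinear_monomial p\<^sub>1 p\<^sub>2 then 1 else 0) \<and>
    (\<exists>L. L * L \<le> 2 * m + L \<and>
      T' \<le> 12 + 11 * length (psp_words p\<^sub>1) + 6 * E + 5 * m + search_time c t (90 * ((L + 1) * (E + 1))) k))
    (input_state (encode n p\<^sub>1 p\<^sub>2)) 0"
    using wp_decide[of p\<^sub>1 c t p\<^sub>2 n] p unfolding km E_def by (auto simp: Pi_Sigma_Pi_def)
  then obtain T \<sigma> L where run: "exec decide (input_state (encode n p\<^sub>1 p\<^sub>2)) T \<sigma>"
    "answer \<sigma> = (if has_multilinear_monomial p\<^sub>1 p\<^sub>2 then 1 else 0)"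
    and L: "L * L \<le> 2 * m + L"
    and T: "T \<le> 12 + 11 * length (psp_words p\<^sub>1) + 6 * E + 5 * m +
      search_time c t (90 * ((L + 1) * (E + 1))) k"
    unfolding wp_def by auto
  have "(c \<ge> 2 \<longrightarrow> real T \<le> 2000 * time_bound n k c t m s) \<and>
    (c = 1 \<longrightarrow> real T \<le> 2000 * (real k * real t + time_bound n k c t m s))"
    if pos: "t \<ge> 1 \<and> m \<ge> 1 \<and> s \<ge> 1"
  proof -
    define F where "F = 90 * ((L + 1) * (E + 1))"
    define R where "R = real m * real s * sqrt (real m + real n)"
    have E: "E \<le> m * (1 + s)" unfolding E_def using ps_words_le p(2) .
    have F: "real F \<le> 1080 * R"
      unfolding F_def R_def using matching_time_le[OF _ _ L E] pos by blast
    have ms: "1 \<le> m * s" "m \<le> m * s" using pos by auto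
    \<comment> \<open>From \<open>E <= m + m * s\<close> and \<open>m <= m * s\<close>:
      \<open>17 = 6 * 2 + 5\<close>.\<close>
    have E': "6 * E + 5 * m \<le> 17 * (m * s)" using E[unfolded distrib_left] ms(2) by linarith
    have "real m * real s * 1 \<le> R"
      unfolding R_def using pos by (intro mult_left_mono) auto
    then have ms_R: "real (m * s) \<le> R" by simp
    moreover have "1 \<le> real (m * s)"
      using of_nat_mono[OF ms(1), where 'a = real] by (simp only: of_nat_1)
    ultimately have "1 \<le> R" by linarith
    note R = ms_R this
    have tb: "time_bound n k c t m s = real c ^ k * (real t * R)"
      by (simp add: time_bound_def R_def)
    have t: "1 \<le> real t" using pos by simp
    have tR: "R \<le> real t * R" "real t \<le> real t * R"
      using t R(2) by simp_all
    show ?thesis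
    proof (intro conjI impI)
      assume c: "c \<ge> 2"
      have "1 + c * (1 + t) \<le> 3 * (c * t)"
      proof -
        have "1 * 1 \<le> c * t" "c * 1 \<le> c * t" using c pos by (intro mult_le_mono; simp)+
        then show ?thesis unfolding distrib_left by linarith
      qed
      then have "k * (1 + c * (1 + t)) \<le> k * (3 * (c * t))" by (rule mult_le_mono2)
      also have "\<dots> = 3 * t * (k * c)" by simp
      also have "\<dots> \<le> 3 * t * c ^ k" using mult_le_power[OF c] by (rule mult_le_mono2)
      finally have P: "length (psp_words p\<^sub>1) \<le> 3 * t * c ^ k" using psp_words_le[OF p(1)] by linarith
      \<comment> \<open>Parsing costs 11 per word of \<open>p\<^sub>1\<close>, hence
        \<open>33 = 11 * 3\<close>; it joins the 24 of the search to form 57 below.\<close>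
      have "T \<le> 12 + 33 * (t * c ^ k) + 17 * (m * s) + c ^ k * (F + (24 * t + 120))"
        using T P E' search_time_geometric[OF c, of t F k] unfolding F_def[symmetric] by linarith
      then have "real T \<le> real (12 + 33 * (t * c ^ k) + 17 * (m * s) + c ^ k * (F + (24 * t + 120)))"
        by (rule of_nat_mono)
      also have "\<dots> = 12 + 17 * real (m * s) + real c ^ k * (real F + (57 * real t + 120))"
        by (simp add: algebra_simps)
      also have "\<dots> \<le> real c ^ k * (29 * R) + real c ^ k * (real F + (57 * real t + 120))"
      proof -
        have "12 + 17 * real (m * s) \<le> 1 * (29 * R)" using R by simp
        also have "\<dots> \<le> real c ^ k * (29 * R)" using c R by (intro mult_right_mono) auto
        finally show ?thesis by simp
      qed
      also have "\<dots> = real c ^ k * (29 * R + real F + 57 * real t + 120)" by (simp add: algebra_simps)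
      also have "\<dots> \<le> real c ^ k * (2000 * (real t * R))"
      proof (rule mult_left_mono)
        \<comment> \<open>All summands are charged to \<open>real t * R\<close>, with total
          coefficient \<open>29 + 1080 + 57 + 120 = 1286\<close>.\<close>
        show "29 * R + real F + 57 * real t + 120 \<le> 2000 * (real t * R)" using F R tR by linarith
      qed simp
      finally show "real T \<le> 2000 * time_bound n k c t m s" by (simp add: tb)
    next
      assume c: "c = 1"
      have "k * 1 \<le> k * t" using pos by (intro mult_le_mono2) simp
      moreover have "length (psp_words p\<^sub>1) \<le> 2 * k + k * t" using psp_words_le[OF p(1)] c by simp
      ultimately have P: "length (psp_words p\<^sub>1) \<le> 3 * (k * t)" "k \<le> k * t" by linarith+
      have "search_time c t F k = F + 20 + (12 * (k * t) + 60 * k)"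
        using search_time_linear[of t F k] c by (simp add: algebra_simps)
      then have "T \<le> 32 + 105 * (k * t) + 17 * (m * s) + F"
        using T P E' unfolding F_def[symmetric] by linarith
      then have "real T \<le> real (32 + 105 * (k * t) + 17 * (m * s) + F)" by (rule of_nat_mono)
      also have "\<dots> = 32 + 105 * (real k * real t) + 17 * real (m * s) + real F" by simp
      also have "\<dots> \<le> 2000 * (real k * real t + real t * R)"
      proof -
        have "0 \<le> real k * real t" by simp
        then show ?thesis unfolding distrib_left using F R tR by linarith
      qed
      finally show "real T \<le> 2000 * (real k * real t + time_bound n k c t m s)" using tb c by simp
    qed
  qed
  with run show "\<exists>T \<sigma>. exec decide (input_state (encode n p\<^sub>1 p\<^sub>2)) T \<sigma> \<and>
      answer \<sigma> = (if has_multilinear_monomial p\<^sub>1 p\<^sub>2 then 1 else 0) \<and>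
      (t \<ge> 1 \<and> m \<ge> 1 \<and> s \<ge> 1 \<longrightarrow>
        (c \<ge> 2 \<longrightarrow> real T \<le> 2000 * time_bound n k c t m s) \<and>
        (c = 1 \<longrightarrow> real T \<le> 2000 * (real k * real t + time_bound n k c t m s)))"
    by blast
qed

end
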